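(* The map $\theta\colon W\mapsto[(\mathscr{S}(W),L_{W},f_{W})]$ yields a surjection from the class of primitive $\omega$-Stone spaces to $\boldsymbol{EPS}$, and induces the following bijections: (a) between the homeomorphism classes of compact primitive $\omega$-Stone spaces and isomorphism classes $[(P,f)]$, where $P$ is a countable simple PO system with a finite foundation and $f\colon P_{\min}^{d}\to\mathbb{N}_{+}$; (b) between the homeomorphism classes of finitary $\omega$-Stone spaces (primitive spaces $W$ with $\mathscr{S}(W)$ finite) and classes $[(P,L,f)]$, where $P$ is a finite simple PO system, $L$ is a lower subset of $P$ and $f\colon L_{\min}^{d}\to\mathbb{N}_{+}$; (c) between the homeomorphism classes of bounded $\omega$-Stone spaces and isomorphism classes $[(P,L,f)]$, where $P$ is a countable simple PO system, $L$ is a lower subset of $P$ having a finite foundation, and $f\colon L_{\min}^{d}\to\mathbb{N}_{+}$.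
   Context: A PO system is a set $P$ with an antisymmetric transitive relation $<$ (possibly $p<p$ for some $p$); $p\leqslant q$ means $p<q$ or $p=q$; $P^{d}=\{p\in P: p\nless p\}$; for $S\subseteq P$, $S_\downarrow=\{p: p\leqslant s\text{ for some }s\in S\}$ and $S_\uparrow=\{p:p\geqslant s\text{ for some }s\in S\}$; $S$ is a lower subset if $S=S_\downarrow$; $S_{\min}$ is the set of minimal elements of $(S,\leqslant)$ and $S_{\min}^d=S_{\min}\cap P^d$. $F$ is a finite foundation of $S\subseteq P$ if $F$ is a finite subset of $S_\downarrow$ with $S_\downarrow\subseteq F_\uparrow$. $P_\Delta=\{p\in P:\{p\}\text{ has a finite foundation}\}$. A morphism $\alpha\colon Q\to P$ is a map such that $\alpha$ maps $\{r\in Q: r>q\}$ onto $\{p\in P: p>\alpha(q)\}$ for each $q\in Q$. A PO system $Q$ is simple if every morphism from $Q$ to a PO system is injective. A Stone space $W$ is a locally compact Hausdorff space with a base of compact open sets (the Stone space of a Boolean ring, possibly without $1$); it is an $\omega$-Stone space if $R=\mathrm{Co}(W)$, the Boolean ring of compact open subsets, is countable. For $A\in R$ let $(A)=\{C\in R: C\subseteq A\}$ and let $[A]$ be the isomorphism class of the Boolean ring $(A)$; $A\neq\emptyset$ is pseudo-indecomposable (PI) if for all $B\in R$ with $B\subseteq A$, $(B)\cong(A)$ or $(A-B)\cong(A)$. $W$ is primitive if every element of $R$ is the disjoint union of finitely many PI elements. For a primitive $\omega$-Stone space $W$: $\mathscr{S}(W)=\{[A]\mid A\in R\text{ is PI}\}$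 is the PO system with $[A]<[B]$ iff $(A)\times(B)\cong(A)$. For $p\in\mathscr{S}(W)$, $X_p$ is the set of points of $W$ having a neighbourhood base of compact open sets $A$ with $[A]=p$. $L_W=\{p\in\mathscr{S}(W)\mid\overline{X_p}\text{ is compact}\}$ and $f_W(p)=|X_p|$ for $p\in(L_W)_{\min}^d$. $W$ is bounded if it is primitive and the closure of $\bigcup_{p\in L_W}X_p$ is compact. An extended PO system is a triple $(P,L,f)$ where $P$ is a PO system, $L$ is a lower subset of $P$ with $L\subseteq P_\Delta$, and $f\colon L_{\min}^d\to\mathbb{N}_+$. $(P,L,f)\cong(Q,M,g)$ if there is a PO system isomorphism $\alpha\colon P\to Q$ with $\alpha(L)=M$ and $g(\alpha(p))=f(p)$ for all $p\in L_{\min}^d$; $[\,\cdot\,]$ denotes isomorphism class. $\boldsymbol{EPS}$ is the set of isomorphism classes of countable extended PO systems $(P,L,f)$ such that $P$ is simple. In (a), $(P,f)$ stands for $(P,P,f)$. *)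

theory Defs
  imports "HOL-Analysis.Analysis" "HOL-Algebra.Chinese_Remainder" "HOL-Library.Equipollence"
begin

section \<open>PO systems\<close>

record 'p po_system =
  points :: "'p set"
  less_rel :: "'p rel"

definition po_system :: "'p po_system \<Rightarrow> bool" where
  "po_system P \<longleftrightarrow>
     less_rel P \<subseteq> points P \<times> points P \<and> antisym (less_rel P) \<and> trans (less_rel P)"

definition po_le :: "'p po_system \<Rightarrow> 'p \<Rightarrow> 'p \<Rightarrow> bool" where
  "po_le P p q \<longleftrightarrow> (p, q) \<in> less_rel P \<or> p = q"

definition irrefl_points :: "'p po_system \<Rightarrow> 'p set" where
  "irrefl_points P = {p \<in> points P. (p, p) \<notin> less_rel P}"

definition down_set :: "'p po_system \<Rightarrow> 'p set \<Rightarrow> 'p set" where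
  "down_set P S = {p \<in> points P. \<exists>s\<in>S. po_le P p s}"

definition up_set :: "'p po_system \<Rightarrow> 'p set \<Rightarrow> 'p set" where
  "up_set P S = {p \<in> points P. \<exists>s\<in>S. po_le P s p}"

definition lower_subset :: "'p po_system \<Rightarrow> 'p set \<Rightarrow> bool" where
  "lower_subset P S \<longleftrightarrow> S \<subseteq> points P \<and> S = down_set P S"

definition minimal_points :: "'p po_system \<Rightarrow> 'p set \<Rightarrow> 'p set" where
  "minimal_points P S = {p \<in> S. \<forall>q\<in>S. po_le P q p \<longrightarrow> q = p}"

definition minimal_irrefl_points :: "'p po_system \<Rightarrow> 'p set \<Rightarrow> 'p set" where
  "minimal_irrefl_points P S = minimal_points P S \<inter> irrefl_points P"

definition finite_foundation :: "'p po_system \<Rightarrow> 'p set \<Rightarrow> 'p set \<Rightarrow> bool" where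
  "finite_foundation P F S \<longleftrightarrow>
     finite F \<and> F \<subseteq> down_set P S \<and> down_set P S \<subseteq> up_set P F"

definition has_finite_foundation :: "'p po_system \<Rightarrow> 'p set \<Rightarrow> bool" where
  "has_finite_foundation P S \<longleftrightarrow> (\<exists>F. finite_foundation P F S)"

definition Delta_points :: "'p po_system \<Rightarrow> 'p set" where
  "Delta_points P = {p \<in> points P. has_finite_foundation P {p}}"

definition po_morphism :: "('q \<Rightarrow> 'p) \<Rightarrow> 'q po_system \<Rightarrow> 'p po_system \<Rightarrow> bool" where
  "po_morphism \<alpha> Q P \<longleftrightarrow>
     \<alpha> \<in> points Q \<rightarrow> points P \<and>
     (\<forall>q\<in>points Q. \<alpha> ` {r \<in> points Q. (q, r) \<in> less_rel Q} =
                     {p \<in> points P. (\<alpha> q, p) \<in> less_rel P})"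

text \<open>
  A definition cannot quantify over the type of the codomain, so the codomains below live on the
  type of \<open>Q\<close>.  This loses nothing: the image of a morphism is closed upwards in the codomain, so
  every morphism corestricts to its image, which has a copy on the type of \<open>Q\<close>.  The lemma
  \<open>simple_po_inj\<close> makes this precise.
\<close>

definition simple_po :: "'q po_system \<Rightarrow> bool" where
  "simple_po Q \<longleftrightarrow> po_system Q \<and>
     (\<forall>(P :: 'q po_system) \<alpha>. po_system P \<and> po_morphism \<alpha> Q P \<longrightarrow> inj_on \<alpha> (points Q))"

lemma simple_po_inj:
  fixes Q :: "'q po_system" and P :: "'p po_system"
  assumes "simple_po Q" "po_system P" "po_morphism \<alpha> Q P"
  shows "inj_on \<alpha> (points Q)"
proof -
  define g where "g = inv_into (points Q) \<alpha>"
  define I where "I = \<alpha> ` points Q"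
  define P' where "P' = \<lparr>points = g ` I,
      less_rel = {(g x, g y) | x y. x \<in> I \<and> y \<in> I \<and> (x, y) \<in> less_rel P}\<rparr>"
  have inj: "inj_on g I"
    unfolding g_def I_def by (simp add: inj_on_inv_into)
  have g_eq: "g x = g y \<longleftrightarrow> x = y" if "x \<in> I" "y \<in> I" for x y
    using inj that by (meson inj_on_eq_iff)
  have P: "antisym (less_rel P)" "trans (less_rel P)" "less_rel P \<subseteq> points P \<times> points P"
    using assms(2) by (auto simp: po_system_def)
  have up: "\<alpha> ` {r \<in> points Q. (q, r) \<in> less_rel Q} = {p \<in> points P. (\<alpha> q, p) \<in> less_rel P}"
    if "q \<in> points Q" for q
    using assms(3) that by (auto simp: po_morphism_def)
  have "antisym (less_rel P')"
    using P(1) g_eq unfolding P'_def antisym_def by auto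
  moreover have "trans (less_rel P')"
    using P(2) g_eq unfolding P'_def trans_def by simp blast
  ultimately have 1: "po_system P'"
    by (auto simp: po_system_def P'_def)
  have less': "(g x, g y) \<in> less_rel P' \<longleftrightarrow> (x, y) \<in> less_rel P" if "x \<in> I" "y \<in> I" for x y
    using that g_eq unfolding P'_def by auto
  have 2: "po_morphism (g \<circ> \<alpha>) Q P'"
    unfolding po_morphism_def
  proof (intro conjI ballI)
    show "g \<circ> \<alpha> \<in> points Q \<rightarrow> points P'"
      by (auto simp: P'_def I_def)
    fix q assume q: "q \<in> points Q"
    have "{p \<in> points P. (\<alpha> q, p) \<in> less_rel P} \<subseteq> I"
      using up[OF q] by (auto simp: I_def)
    moreover have "I \<subseteq> points P"
      using assms(3) by (auto simp: po_morphism_def I_def)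
    moreover have "\<alpha> q \<in> I"
      using q by (auto simp: I_def)
    moreover have "points P' = g ` I"
      by (simp add: P'_def)
    ultimately have "{p \<in> points P'. (g (\<alpha> q), p) \<in> less_rel P'} =
        g ` {p \<in> points P. (\<alpha> q, p) \<in> less_rel P}"
      using less' by auto
    then show "(g \<circ> \<alpha>) ` {r \<in> points Q. (q, r) \<in> less_rel Q} =
        {p \<in> points P'. ((g \<circ> \<alpha>) q, p) \<in> less_rel P'}"
      using up[OF q] by (simp only: image_comp [symmetric] comp_apply)
  qed
  have "inj_on (g \<circ> \<alpha>) (points Q)"
    using assms(1) 1 2 by (auto simp: simple_po_def)
  then show ?thesis
    by (rule inj_on_imageI2)
qed

definition po_isomorphism :: "('p \<Rightarrow> 'q) \<Rightarrow> 'p po_system \<Rightarrow> 'q po_system \<Rightarrow> bool" where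
  "po_isomorphism \<alpha> P Q \<longleftrightarrow>
     bij_betw \<alpha> (points P) (points Q) \<and>
     (\<forall>p\<in>points P. \<forall>q\<in>points P. (p, q) \<in> less_rel P \<longleftrightarrow> (\<alpha> p, \<alpha> q) \<in> less_rel Q)"


section \<open>Extended PO systems\<close>

text \<open>
  In a triple \<open>(P, L, f)\<close> the function \<open>f\<close> is total, but only its values on
  \<open>minimal_irrefl_points P L\<close> are ever used.
\<close>

type_synonym 'p ext_po = "'p po_system \<times> 'p set \<times> ('p \<Rightarrow> nat)"

definition pos_weight :: "'p po_system \<Rightarrow> 'p set \<Rightarrow> ('p \<Rightarrow> nat) \<Rightarrow> bool" where
  "pos_weight P L f \<longleftrightarrow> (\<forall>p \<in> minimal_irrefl_points P L. f p > 0)"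

definition extended_po_system :: "'p po_system \<Rightarrow> 'p set \<Rightarrow> ('p \<Rightarrow> nat) \<Rightarrow> bool" where
  "extended_po_system P L f \<longleftrightarrow>
     po_system P \<and> lower_subset P L \<and> L \<subseteq> Delta_points P \<and> pos_weight P L f"

definition ext_iso ::
  "'p po_system \<Rightarrow> 'p set \<Rightarrow> ('p \<Rightarrow> nat) \<Rightarrow> 'q po_system \<Rightarrow> 'q set \<Rightarrow> ('q \<Rightarrow> nat) \<Rightarrow> bool" where
  "ext_iso P L f Q M g \<longleftrightarrow>
     (\<exists>\<alpha>. po_isomorphism \<alpha> P Q \<and> \<alpha> ` L = M \<and>
          (\<forall>p \<in> minimal_irrefl_points P L. g (\<alpha> p) = f p))"

text \<open>
  The isomorphism class of \<open>(P, L, f)\<close>, as a class of extended PO systems on a type \<open>'q\<close> that may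
  differ from the type of \<open>P\<close>.  Every countable extended PO system has a copy on any infinite
  type \<open>'q\<close>, so for such \<open>'q\<close> these classes faithfully represent the isomorphism classes.
\<close>

definition ext_class :: "'p po_system \<Rightarrow> 'p set \<Rightarrow> ('p \<Rightarrow> nat) \<Rightarrow> 'q ext_po set" where
  "ext_class P L f = {(Q, M, g). extended_po_system Q M g \<and> ext_iso P L f Q M g}"

definition EPS :: "'q ext_po set set" where
  "EPS = {ext_class P L f | (P :: 'q po_system) L f.
            extended_po_system P L f \<and> countable (points P) \<and> simple_po P}"

definition EPS_founded :: "'q ext_po set set" where
  "EPS_founded = {ext_class P (points P) f | (P :: 'q po_system) f.
            simple_po P \<and> countable (points P) \<and> has_finite_foundation P (points P) \<and>
            pos_weight P (points P) f}"

definition EPS_finite :: "'q ext_po set set" where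
  "EPS_finite = {ext_class P L f | (P :: 'q po_system) L f.
            simple_po P \<and> finite (points P) \<and> lower_subset P L \<and> pos_weight P L f}"

definition EPS_lower_founded :: "'q ext_po set set" where
  "EPS_lower_founded = {ext_class P L f | (P :: 'q po_system) L f.
            simple_po P \<and> countable (points P) \<and> lower_subset P L \<and>
            has_finite_foundation P L \<and> pos_weight P L f}"


section \<open>Stone spaces\<close>

definition Co :: "'a topology \<Rightarrow> 'a set set" where
  "Co W = {A. openin W A \<and> compactin W A}"

definition Stone_space :: "'a topology \<Rightarrow> bool" where
  "Stone_space W \<longleftrightarrow>
     locally_compact_space W \<and> Hausdorff_space W \<and>
     openin W = arbitrary union_of (\<lambda>A. A \<in> Co W)"

definition omega_Stone_space :: "'a topology \<Rightarrow> bool" where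
  "omega_Stone_space W \<longleftrightarrow> Stone_space W \<and> countable (Co W)"

definition Co_ring :: "'a topology \<Rightarrow> 'a set \<Rightarrow> 'a set ring" where
  "Co_ring W A = \<lparr>carrier = {C \<in> Co W. C \<subseteq> A}, mult = (\<inter>), one = A, zero = {},
                  add = (\<lambda>B C. (B - C) \<union> (C - B))\<rparr>"

text \<open>
  The class \<open>[A]\<close> consists of all rings on the type \<open>'a set\<close> isomorphic to \<open>(A)\<close>.  An
  isomorphism in the sense of \<open>ring_iso\<close> preserves \<open>1\<close>, which is automatic for bijections
  preserving sums and products.
\<close>

definition Co_class :: "'a topology \<Rightarrow> 'a set \<Rightarrow> 'a set ring set" where
  "Co_class W A = {S. ring S \<and> Co_ring W A \<simeq> S}"

definition pseudo_indecomposable :: "'a topology \<Rightarrow> 'a set \<Rightarrow> bool" where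
  "pseudo_indecomposable W A \<longleftrightarrow>
     A \<in> Co W \<and> A \<noteq> {} \<and>
     (\<forall>B\<in>Co W. B \<subseteq> A \<longrightarrow> Co_ring W B \<simeq> Co_ring W A \<or> Co_ring W (A - B) \<simeq> Co_ring W A)"

definition primitive_space :: "'a topology \<Rightarrow> bool" where
  "primitive_space W \<longleftrightarrow> Stone_space W \<and>
     (\<forall>A\<in>Co W. \<exists>F. finite F \<and> (\<forall>B\<in>F. pseudo_indecomposable W B) \<and> disjoint F \<and> \<Union>F = A)"

definition PI_system :: "'a topology \<Rightarrow> 'a set ring set po_system" where
  "PI_system W =
     \<lparr>points = {Co_class W A | A. pseudo_indecomposable W A},
      less_rel = {(Co_class W A, Co_class W B) | A B.
        pseudo_indecomposable W A \<and> pseudo_indecomposable W B \<and>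
        RDirProd (Co_ring W A) (Co_ring W B) \<simeq> Co_ring W A}\<rparr>"

definition type_points :: "'a topology \<Rightarrow> 'a set ring set \<Rightarrow> 'a set" where
  "type_points W p = {x \<in> topspace W.
     neighbourhood_base_at x (\<lambda>A. A \<in> Co W \<and> Co_class W A = p) W}"

definition compact_types :: "'a topology \<Rightarrow> 'a set ring set set" where
  "compact_types W = {p \<in> points (PI_system W). compactin W (W closure_of type_points W p)}"

text \<open>
  \<open>card\<close> is \<open>0\<close> on infinite sets; that \<open>type_points W p\<close> is finite and nonempty for
  \<open>p\<close> in \<open>minimal_irrefl_points (PI_system W) (compact_types W)\<close> is part of the assertion that
  \<open>theta W\<close> belongs to \<open>EPS\<close>.
\<close>

definition type_count :: "'a topology \<Rightarrow> 'a set ring set \<Rightarrow> nat" where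
  "type_count W p = card (type_points W p)"

definition bounded_space :: "'a topology \<Rightarrow> bool" where
  "bounded_space W \<longleftrightarrow> primitive_space W \<and>
     compactin W (W closure_of (\<Union>p\<in>compact_types W. type_points W p))"

definition finitary_space :: "'a topology \<Rightarrow> bool" where
  "finitary_space W \<longleftrightarrow> primitive_space W \<and> finite (points (PI_system W))"

definition theta :: "'a topology \<Rightarrow> 'q ext_po set" where
  "theta W = ext_class (PI_system W) (compact_types W) (type_count W)"

text \<open>
  The class of all spaces is represented by the topologies on one type \<open>'a\<close> with at least
  continuum many elements: a Stone space with countably many compact open sets has at most
  continuum many points, so every \<open>\<omega>\<close>-Stone space has a homeomorphic copy on \<open>'a\<close>.
\<close>

definition homeo_rel :: "'a topology rel" where
  "homeo_rel = {(W, W'). W homeomorphic_space W'}"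

text \<open>
  The map induced on homeomorphism classes; meaningful as \<open>theta\<close> is constant on them.
\<close>

definition theta_induced :: "'a topology set \<Rightarrow> 'q ext_po set" where
  "theta_induced \<C> = the_elem (theta ` \<C>)"

end

theory Submission
  imports Defs "HOL-Library.Multiset" "HOL-Library.Sublist"
begin

text \<open>
  A labelling of a Stone space \<open>W\<close> by a PO system \<open>P\<close> assigns labels in
  \<open>P\<close> to certain compact open sets, such that every compact open set is a finite
  disjoint union of labelled ones and labels behave under cutting like isomorphism types of
  pseudo-indecomposable sets (locale \<open>labelled\<close>). All parts of the theorem come from
  one principle: if two compact open sets, possibly in different spaces with countably many compact
  open sets, can be decomposed with the same multiset of labels, then they are isomorphic. Indeed a
  cut of the one can be copied on the other, because labels above \<open>p\<close> can be cut off
  from a set with label \<open>p\<close> as often as desired without changing its label; so a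
  back-and-forth construction applies (\<open>back_and_forth.set_ring_iso_exists\<close>,
  \<open>labelled_pair.common_iso\<close>), and Stone duality turns isomorphisms of the rings of
  compact open sets into homeomorphisms (\<open>Stone_duality\<close>).

  A primitive space is labelled by the types of its pseudo-indecomposable sets
  (\<open>coded_primitive.labelled_full_split\<close>). A morphism from this PO system to another
  one pushes the labelling forward, and sets with the same new label are isomorphic by the
  principle; so the PO system is simple (\<open>labelled_full.simple_if_separated\<close>).
  Conversely, if a space is labelled by a simple PO system \<open>P\<close>, then mapping a label to
  the type of the sets that carry it is a morphism, hence injective, and \<open>P\<close> is
  isomorphic to the PO system of the space; the points, compact types and counts of the space can be
  computed from the labelling as well (\<open>labelled_simple.theta_eq\<close>).

  For injectivity let two bounded spaces have isomorphic invariants and label both by the same PO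
  system. The labels in \<open>L\<close> are confined to compact open cores. The minimal irreflexive
  labels occur in each core as often as \<open>f\<close> says, and every other label of
  \<open>L\<close> is absorbed by a label that occurs there; so the cores have a common
  decomposition. Labels outside \<open>L\<close> occur outside every compact set, so partners for
  sets outside the cores can always be found
  (\<open>labelled_full_pair.bounded_homeomorphic\<close>). Compact and finitary spaces are bounded.
  The finitely many labels in a decomposition of a core also provide the finite foundations
  (\<open>labelled_full.finite_foundation_of_confining\<close>).

  For surjectivity let \<open>(P, L, f)\<close> be given. The branches of a forest form a space
  labelled by \<open>P\<close>: a node with label \<open>p\<close> has infinitely many children for
  each label above \<open>p\<close>, which converge to the branch ending in the node
  (\<open>forest.labelled_full_W\<close>). The roots are chosen so that \<open>L\<close> and
  \<open>f\<close> come out right: infinitely many for each label outside \<open>L\<close>, as many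
  as \<open>f\<close> prescribes for each minimal irreflexive label of \<open>L\<close>, and one for
  each minimal reflexive label of \<open>L\<close> (\<open>realisation\<close>).
\<close>

section \<open>Compact open sets of a Stone space\<close>

lemma Co_empty [simp]: "{} \<in> Co W"
  by (simp add: Co_def)

lemma Co_Un [simp]: "A \<in> Co W \<Longrightarrow> B \<in> Co W \<Longrightarrow> A \<union> B \<in> Co W"
  by (simp add: Co_def compactin_Un openin_Un)

lemma Co_Union: "finite F \<Longrightarrow> F \<subseteq> Co W \<Longrightarrow> \<Union>F \<in> Co W"
  by (auto simp: Co_def intro!: compactin_Union openin_Union)

lemma Co_openin: "A \<in> Co W \<Longrightarrow> openin W A"
  by (simp add: Co_def)

lemma Co_compactin: "A \<in> Co W \<Longrightarrow> compactin W A"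
  by (simp add: Co_def)

lemma Co_subset_topspace: "A \<in> Co W \<Longrightarrow> A \<subseteq> topspace W"
  by (simp add: Co_def openin_subset)

locale stone =
  fixes W :: "'a topology"
  assumes Stone: "Stone_space W"
begin

lemma Hausdorff: "Hausdorff_space W"
  using Stone by (simp add: Stone_space_def)

lemma Co_closedin: "A \<in> Co W \<Longrightarrow> closedin W A"
  using Hausdorff compactin_imp_closedin by (auto simp: Co_def)

lemma Co_Diff [simp]: "A \<in> Co W \<Longrightarrow> B \<in> Co W \<Longrightarrow> A - B \<in> Co W"
  using closed_compactin[of W A "A - B"] Co_closedin
  by (simp add: Co_def closedin_diff openin_diff)

lemma Co_Int [simp]: "A \<in> Co W \<Longrightarrow> B \<in> Co W \<Longrightarrow> A \<inter> B \<in> Co W"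
  by (metis Co_Diff Diff_Diff_Int)

lemma Co_base:
  assumes "openin W U" "x \<in> U"
  obtains A where "A \<in> Co W" "x \<in> A" "A \<subseteq> U"
proof -
  have "(arbitrary union_of (\<lambda>A. A \<in> Co W)) U"
    using Stone assms(1) by (simp add: Stone_space_def)
  then show ?thesis
    using that assms(2) by (auto simp: union_of_def)
qed

lemma topspace_eq_Union_Co: "topspace W = \<Union>(Co W)"
proof (intro equalityI subsetI)
  fix x assume "x \<in> topspace W"
  then show "x \<in> \<Union>(Co W)"
    using Co_base[OF openin_topspace] by (metis UnionI)
qed (use Co_subset_topspace in auto)

lemma Co_separates:
  assumes "x \<in> topspace W" "y \<in> topspace W" "x \<noteq> y"
  obtains A where "A \<in> Co W" "x \<in> A" "y \<notin> A"
proof -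
  obtain U V where "openin W U" "x \<in> U" "y \<in> V" "disjnt U V"
    using Hausdorff assms unfolding Hausdorff_space_def by blast
  moreover obtain A where "A \<in> Co W" "x \<in> A" "A \<subseteq> U"
    using Co_base[OF calculation(1,2)] .
  ultimately show ?thesis
    by (intro that[of A]) (auto simp: disjnt_iff)
qed

lemma compactin_subset_Co:
  assumes "compactin W C" "openin W U" "C \<subseteq> U"
  obtains K where "K \<in> Co W" "C \<subseteq> K" "K \<subseteq> U"
proof -
  have "C \<subseteq> \<Union>{A \<in> Co W. A \<subseteq> U}"
  proof
    fix x assume "x \<in> C"
    then obtain A where "A \<in> Co W" "x \<in> A" "A \<subseteq> U"
      using Co_base[OF assms(2)] assms(3) by (metis subsetD)
    then show "x \<in> \<Union>{A \<in> Co W. A \<subseteq> U}" by auto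
  qed
  then obtain F where "finite F" "F \<subseteq> {A \<in> Co W. A \<subseteq> U}" "C \<subseteq> \<Union>F"
    using compactinD[OF assms(1), of "{A \<in> Co W. A \<subseteq> U}"] by (auto simp: Co_openin)
  then show ?thesis
    by (intro that[of "\<Union>F"] Co_Union) auto
qed

lemma compactin_closure_iff:
  assumes "S \<subseteq> topspace W"
  shows "compactin W (W closure_of S) \<longleftrightarrow> (\<exists>K\<in>Co W. S \<subseteq> K)"
proof
  assume "compactin W (W closure_of S)"
  then obtain K where "K \<in> Co W" "W closure_of S \<subseteq> K"
    by (metis compactin_subset_Co compactin_subset_topspace openin_topspace)
  then show "\<exists>K\<in>Co W. S \<subseteq> K"
    using closure_of_subset[OF assms] by auto
next
  assume "\<exists>K\<in>Co W. S \<subseteq> K"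
  then show "compactin W (W closure_of S)"
    by (meson Co_closedin Co_compactin closed_compactin closedin_closure_of closure_of_minimal)
qed

text \<open>
  Compactness turns a proper filter of compact open sets into a point. This is how points are
  produced below from data about the ring of compact open sets alone.
\<close>

lemma filter_has_point:
  assumes F: "F \<subseteq> Co W" "F \<noteq> {}" "{} \<notin> F"
    and Int: "\<And>A B. A \<in> F \<Longrightarrow> B \<in> F \<Longrightarrow> \<exists>C\<in>F. C \<subseteq> A \<inter> B"
  obtains x where "x \<in> topspace W" "\<And>A. A \<in> F \<Longrightarrow> x \<in> A"
proof -
  obtain A0 where A0: "A0 \<in> F"
    using F(2) by auto
  have fin: "\<exists>C\<in>F. C \<subseteq> A0 \<inter> \<Inter>G" if "finite G" "G \<subseteq> F" for G
    using that
  proof (induction G rule: finite_induct)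
    case (insert A G)
    then obtain C D where "C \<in> F" "C \<subseteq> A0 \<inter> \<Inter>G" "D \<in> F" "D \<subseteq> A \<inter> C"
      using Int[of A] by (metis insert_subset)
    then show ?case by (intro bexI[of _ D]) auto
  qed (use A0 in auto)
  have "A0 \<inter> \<Inter>F \<noteq> {}"
  proof -
    have "compactin W A0"
      using A0 F(1) Co_compactin by blast
    moreover have "\<forall>C\<in>F. closedin W C"
      using F(1) Co_closedin by blast
    moreover have "\<forall>G. finite G \<and> G \<subseteq> F \<longrightarrow> A0 \<inter> \<Inter>G \<noteq> {}"
      using fin F(3) by (metis subset_empty)
    ultimately show ?thesis
      unfolding compactin_fip by blast
  qed
  then show ?thesis
    using that A0 F(1) Co_subset_topspace by fastforce
qed

end


section \<open>Isomorphisms of rings of sets\<close>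

text \<open>
  Unions and differences generate the operations of a ring of sets that may lack a largest element.
  They suit cutting and pasting better than the symmetric differences of the Boolean ring.
\<close>

definition set_ring_iso :: "('a set \<Rightarrow> 'b set) \<Rightarrow> 'a set set \<Rightarrow> 'b set set \<Rightarrow> bool" where
  "set_ring_iso \<phi> R S \<longleftrightarrow> bij_betw \<phi> R S \<and>
     (\<forall>A\<in>R. \<forall>B\<in>R. \<phi> (A \<union> B) = \<phi> A \<union> \<phi> B \<and> \<phi> (A - B) = \<phi> A - \<phi> B)"

definition set_ring :: "'a set set \<Rightarrow> bool" where
  "set_ring R \<longleftrightarrow> {} \<in> R \<and> (\<forall>A\<in>R. \<forall>B\<in>R. A \<union> B \<in> R \<and> A - B \<in> R)"

lemma set_ring_Int: "set_ring R \<Longrightarrow> A \<in> R \<Longrightarrow> B \<in> R \<Longrightarrow> A \<inter> B \<in> R"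
  using Diff_Diff_Int[of A B] unfolding set_ring_def by (metis (full_types))

lemma set_ring_iso_mem: "set_ring_iso \<phi> R S \<Longrightarrow> A \<in> R \<Longrightarrow> \<phi> A \<in> S"
  by (auto simp: set_ring_iso_def bij_betw_def)

lemma set_ring_iso_surj: "set_ring_iso \<phi> R S \<Longrightarrow> B \<in> S \<Longrightarrow> \<exists>A\<in>R. \<phi> A = B"
  by (auto simp: set_ring_iso_def bij_betw_def)

lemma set_ring_iso_Un: "set_ring_iso \<phi> R S \<Longrightarrow> A \<in> R \<Longrightarrow> B \<in> R \<Longrightarrow> \<phi> (A \<union> B) = \<phi> A \<union> \<phi> B"
  by (auto simp: set_ring_iso_def)

lemma set_ring_iso_Diff: "set_ring_iso \<phi> R S \<Longrightarrow> A \<in> R \<Longrightarrow> B \<in> R \<Longrightarrow> \<phi> (A - B) = \<phi> A - \<phi> B"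
  by (auto simp: set_ring_iso_def)

lemma set_ring_iso_Int:
  assumes "set_ring R" "set_ring_iso \<phi> R S" "A \<in> R" "B \<in> R"
  shows "\<phi> (A \<inter> B) = \<phi> A \<inter> \<phi> B"
proof -
  have "A - B \<in> R"
    using assms by (simp add: set_ring_def)
  then have "\<phi> (A - (A - B)) = \<phi> A - (\<phi> A - \<phi> B)"
    using assms(2-4) by (simp add: set_ring_iso_Diff)
  then show ?thesis
    by (simp add: Diff_Diff_Int)
qed

lemma set_ring_iso_subset_iff:
  assumes "set_ring R" "set_ring_iso \<phi> R S" "A \<in> R" "B \<in> R"
  shows "\<phi> A \<subseteq> \<phi> B \<longleftrightarrow> A \<subseteq> B"
proof -
  have "inj_on \<phi> R" "A \<union> B \<in> R"
    using assms by (auto simp: set_ring_iso_def bij_betw_def set_ring_def)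
  then show ?thesis
    using set_ring_iso_Un[OF assms(2-4)] assms(4) by (metis inj_on_eq_iff subset_Un_eq)
qed

lemma set_ring_iso_id: "set_ring_iso (\<lambda>A. A) R R"
  by (auto simp: set_ring_iso_def bij_betw_def)

lemma set_ring_iso_comp:
  "set_ring_iso \<phi> R S \<Longrightarrow> set_ring_iso \<psi> S T \<Longrightarrow> set_ring_iso (\<psi> \<circ> \<phi>) R T"
  unfolding set_ring_iso_def by (auto intro: bij_betw_trans simp: bij_betw_apply)

lemma set_ring_iso_inv:
  assumes R: "set_ring R" and iso: "set_ring_iso \<phi> R S"
  shows "set_ring_iso (inv_into R \<phi>) S R"
proof -
  have bij: "bij_betw \<phi> R S"
    using iso by (simp add: set_ring_iso_def)
  have S: "\<exists>X\<in>R. A = \<phi> X" if "A \<in> S" for A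
    using bij that by (auto simp: bij_betw_def)
  have inv: "inv_into R \<phi> (\<phi> X) = X" if "X \<in> R" for X
    using bij that by (simp add: bij_betw_inv_into_left)
  have "inv_into R \<phi> (A \<union> B) = inv_into R \<phi> A \<union> inv_into R \<phi> B \<and>
        inv_into R \<phi> (A - B) = inv_into R \<phi> A - inv_into R \<phi> B"
    if AB: "A \<in> S" "B \<in> S" for A B
  proof -
    obtain X Y where XY: "X \<in> R" "Y \<in> R" "A = \<phi> X" "B = \<phi> Y"
      using S[OF AB(1)] S[OF AB(2)] by blast
    moreover have "X \<union> Y \<in> R" "X - Y \<in> R"
      using R XY by (auto simp: set_ring_def)
    ultimately show ?thesis
      using inv set_ring_iso_Un[OF iso, of X Y] set_ring_iso_Diff[OF iso, of X Y] by metis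
  qed
  then show ?thesis
    using bij by (simp add: set_ring_iso_def bij_betw_inv_into)
qed

definition Co_below :: "'a topology \<Rightarrow> 'a set \<Rightarrow> 'a set set" where
  "Co_below W A = {C \<in> Co W. C \<subseteq> A}"

definition co_equiv :: "'a topology \<Rightarrow> 'a set \<Rightarrow> 'a set \<Rightarrow> bool" where
  "co_equiv W A B \<longleftrightarrow> A \<in> Co W \<and> B \<in> Co W \<and> (\<exists>\<phi>. set_ring_iso \<phi> (Co_below W A) (Co_below W B))"

context stone
begin

abbreviation equiv_in (infix \<open>\<sim>\<close> 50) where "A \<sim> B \<equiv> co_equiv W A B"

lemma set_ring_Co: "set_ring (Co W)"
  by (simp add: set_ring_def)

lemma set_ring_Co_below: "set_ring (Co_below W A)"
  by (auto simp: set_ring_def Co_below_def)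

lemma equiv_refl: "A \<in> Co W \<Longrightarrow> A \<sim> A"
  using set_ring_iso_id by (auto simp: co_equiv_def)

lemma equiv_sym: "A \<sim> B \<Longrightarrow> B \<sim> A"
  using set_ring_iso_inv[OF set_ring_Co_below] by (auto simp: co_equiv_def)

lemma equiv_trans: "A \<sim> B \<Longrightarrow> B \<sim> C \<Longrightarrow> A \<sim> C"
  unfolding co_equiv_def by (meson set_ring_iso_comp)

lemma equiv_Co: "A \<sim> B \<Longrightarrow> A \<in> Co W" "A \<sim> B \<Longrightarrow> B \<in> Co W"
  by (auto simp: co_equiv_def)

text \<open>
  A surjection that preserves inclusion takes the largest element to the largest element.
\<close>

lemma set_ring_iso_below_top:
  assumes "A \<in> Co W" "B \<in> Co W" "set_ring_iso \<phi> (Co_below W A) (Co_below W B)"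
  shows "\<phi> A = B"
proof -
  have A: "A \<in> Co_below W A" and B: "B \<in> Co_below W B"
    using assms by (auto simp: Co_below_def)
  then obtain X where X: "X \<in> Co_below W A" "\<phi> X = B"
    using set_ring_iso_surj[OF assms(3)] by blast
  then have "\<phi> X \<subseteq> \<phi> A"
    using A assms(3) set_ring_iso_subset_iff[OF set_ring_Co_below assms(3)] by (auto simp: Co_below_def)
  moreover have "\<phi> A \<in> Co_below W B"
    using A assms(3) set_ring_iso_mem by blast
  ultimately show ?thesis
    using X by (auto simp: Co_below_def)
qed

text \<open>
  An isomorphism preserves and reflects inclusion, so it takes the sets below \<open>C\<close> to
  the sets below its image.
\<close>

lemma set_ring_iso_restrict:
  assumes iso: "set_ring_iso \<phi> (Co_below W A) (Co_below W B)" and C: "C \<in> Co_below W A"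
  shows "C \<sim> \<phi> C"
proof -
  have "\<phi> ` Co_below W C = Co_below W (\<phi> C)"
  proof (intro Set.set_eqI iffI)
    fix X assume "X \<in> \<phi> ` Co_below W C"
    then obtain D where D: "X = \<phi> D" "D \<in> Co_below W C" by auto
    then have "D \<in> Co_below W A"
      using C by (auto simp: Co_below_def)
    then show "X \<in> Co_below W (\<phi> C)"
      using D C iso set_ring_iso_subset_iff[OF set_ring_Co_below iso] set_ring_iso_mem[OF iso]
      by (auto simp: Co_below_def)
  next
    fix X assume X: "X \<in> Co_below W (\<phi> C)"
    have "\<phi> C \<in> Co_below W B"
      using set_ring_iso_mem[OF iso C] .
    then have "X \<in> Co_below W B"
      using X by (auto simp: Co_below_def)
    then obtain D where D: "D \<in> Co_below W A" "X = \<phi> D"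
      using set_ring_iso_surj[OF iso] by blast
    then have "D \<subseteq> C"
      using X C set_ring_iso_subset_iff[OF set_ring_Co_below iso] by (auto simp: Co_below_def)
    then show "X \<in> \<phi> ` Co_below W C"
      using D by (auto simp: Co_below_def)
  qed
  moreover have sub: "Co_below W C \<subseteq> Co_below W A"
    using C by (auto simp: Co_below_def)
  ultimately have "set_ring_iso \<phi> (Co_below W C) (Co_below W (\<phi> C))"
    using iso by (auto simp: set_ring_iso_def bij_betw_def subset_iff intro: inj_on_subset)
  moreover have "\<phi> C \<in> Co W" "C \<in> Co W"
    using C set_ring_iso_mem[OF iso C] by (auto simp: Co_below_def)
  ultimately show ?thesis
    by (auto simp: co_equiv_def)
qed

lemma equiv_split:
  assumes "A \<sim> B" "C \<in> Co W" "C \<subseteq> A"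
  obtains D where "D \<in> Co W" "D \<subseteq> B" "C \<sim> D" "A - C \<sim> B - D"
proof -
  obtain \<phi> where iso: "set_ring_iso \<phi> (Co_below W A) (Co_below W B)"
    and AB: "A \<in> Co W" "B \<in> Co W"
    using assms(1) by (auto simp: co_equiv_def)
  have C: "C \<in> Co_below W A" "A \<in> Co_below W A" "A - C \<in> Co_below W A"
    using assms AB by (auto simp: Co_below_def)
  have "\<phi> (A - C) = B - \<phi> C"
    using set_ring_iso_Diff[OF iso C(2,1)] set_ring_iso_below_top[OF AB iso] by simp
  then show ?thesis
    using that[of "\<phi> C"] set_ring_iso_restrict[OF iso C(1)] set_ring_iso_restrict[OF iso C(3)]
      set_ring_iso_mem[OF iso C(1)] by (auto simp: Co_below_def)
qed

text \<open>
  Isomorphisms acting on disjoint pieces can be glued, which makes \<open>\<sim>\<close> compatible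
  with disjoint unions.
\<close>

lemma set_ring_iso_join:
  assumes \<phi>: "set_ring_iso \<phi> (Co_below W A) (Co_below W C)" "A \<in> Co W" "C \<in> Co W"
    and \<psi>: "set_ring_iso \<psi> (Co_below W B) (Co_below W D)" "B \<in> Co W" "D \<in> Co W"
    and disj: "A \<inter> B = {}" "C \<inter> D = {}"
  shows "set_ring_iso (\<lambda>X. \<phi> (X \<inter> A) \<union> \<psi> (X \<inter> B)) (Co_below W (A \<union> B)) (Co_below W (C \<union> D))"
proof -
  define \<eta> where "\<eta> = (\<lambda>X. \<phi> (X \<inter> A) \<union> \<psi> (X \<inter> B))"
  have mA: "X \<inter> A \<in> Co_below W A" and mB: "X \<inter> B \<in> Co_below W B" if "X \<in> Co W" for X
    using that \<phi> \<psi> by (auto simp: Co_below_def)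
  have im: "\<phi> (X \<inter> A) \<in> Co_below W C" "\<psi> (X \<inter> B) \<in> Co_below W D" if "X \<in> Co W" for X
    using mA mB that \<phi>(1) \<psi>(1) set_ring_iso_mem by blast+
  have part: "\<eta> X \<inter> C = \<phi> (X \<inter> A)" "\<eta> X \<inter> D = \<psi> (X \<inter> B)" if "X \<in> Co W" for X
    using im[OF that] disj(2) by (auto simp: \<eta>_def Co_below_def)
  have "\<eta> (X \<union> Y) = \<eta> X \<union> \<eta> Y \<and> \<eta> (X - Y) = \<eta> X - \<eta> Y"
    if "X \<in> Co W" "Y \<in> Co W" for X Y
  proof -
    have "\<phi> ((X \<union> Y) \<inter> A) = \<phi> (X \<inter> A) \<union> \<phi> (Y \<inter> A)" "\<psi> ((X \<union> Y) \<inter> B) = \<psi> (X \<inter> B) \<union> \<psi> (Y \<inter> B)"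
      using set_ring_iso_Un[OF \<phi>(1) mA mA] set_ring_iso_Un[OF \<psi>(1) mB mB] that
      by (simp_all add: Int_Un_distrib2)
    moreover have "(X - Y) \<inter> A = (X \<inter> A) - (Y \<inter> A)" "(X - Y) \<inter> B = (X \<inter> B) - (Y \<inter> B)"
      by auto
    then have "\<phi> ((X - Y) \<inter> A) = \<phi> (X \<inter> A) - \<phi> (Y \<inter> A)" "\<psi> ((X - Y) \<inter> B) = \<psi> (X \<inter> B) - \<psi> (Y \<inter> B)"
      using set_ring_iso_Diff[OF \<phi>(1) mA mA] set_ring_iso_Diff[OF \<psi>(1) mB mB] that by simp_all
    ultimately show ?thesis
      using im[OF that(1)] im[OF that(2)] disj(2) unfolding \<eta>_def Co_below_def by auto
  qed
  moreover have "inj_on \<eta> (Co_below W (A \<union> B))"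
  proof (rule inj_onI)
    fix X Y assume XY: "X \<in> Co_below W (A \<union> B)" "Y \<in> Co_below W (A \<union> B)" "\<eta> X = \<eta> Y"
    then have Co: "X \<in> Co W" "Y \<in> Co W" by (auto simp: Co_below_def)
    have "\<phi> (X \<inter> A) = \<phi> (Y \<inter> A)" "\<psi> (X \<inter> B) = \<psi> (Y \<inter> B)"
      using part Co XY(3) by metis+
    then have "X \<inter> A = Y \<inter> A" "X \<inter> B = Y \<inter> B"
      using mA mB Co \<phi>(1) \<psi>(1) unfolding set_ring_iso_def bij_betw_def by (meson inj_on_eq_iff)+
    then show "X = Y"
      using XY by (auto simp: Co_below_def)
  qed
  moreover have "\<eta> ` Co_below W (A \<union> B) = Co_below W (C \<union> D)"
  proof (intro Set.set_eqI iffI)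
    fix Z assume "Z \<in> \<eta> ` Co_below W (A \<union> B)"
    then show "Z \<in> Co_below W (C \<union> D)"
      using im by (fastforce simp: \<eta>_def Co_below_def)
  next
    fix Z assume Z: "Z \<in> Co_below W (C \<union> D)"
    then have "Z \<inter> C \<in> Co_below W C" "Z \<inter> D \<in> Co_below W D"
      using \<phi> \<psi> by (auto simp: Co_below_def)
    then obtain X Y where XY: "X \<in> Co_below W A" "\<phi> X = Z \<inter> C" "Y \<in> Co_below W B" "\<psi> Y = Z \<inter> D"
      using set_ring_iso_surj[OF \<phi>(1)] set_ring_iso_surj[OF \<psi>(1)] by blast
    have "(X \<union> Y) \<inter> A = X" "(X \<union> Y) \<inter> B = Y"
      using XY disj by (auto simp: Co_below_def)
    then have "\<eta> (X \<union> Y) = Z"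
      using XY Z by (auto simp: \<eta>_def Co_below_def)
    moreover have "X \<union> Y \<in> Co_below W (A \<union> B)"
      using XY by (auto simp: Co_below_def)
    ultimately show "Z \<in> \<eta> ` Co_below W (A \<union> B)" by blast
  qed
  ultimately show ?thesis
    unfolding \<eta>_def[symmetric] set_ring_iso_def bij_betw_def by (auto simp: Co_below_def)
qed

lemma equiv_join:
  "A \<sim> C \<Longrightarrow> B \<sim> D \<Longrightarrow> A \<inter> B = {} \<Longrightarrow> C \<inter> D = {} \<Longrightarrow> A \<union> B \<sim> C \<union> D"
  unfolding co_equiv_def using set_ring_iso_join[of _ A C _ B D] Co_Un by blast

subsection \<open>The algebraic rings\<close>

lemma carrier_Co_ring: "carrier (Co_ring W A) = Co_below W A"
  by (auto simp: Co_ring_def Co_below_def)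

lemma ring_Co_ring: "A \<in> Co W \<Longrightarrow> ring (Co_ring W A)"
proof -
  assume A: "A \<in> Co W"
  have "cring (Co_ring W A)"
  proof (rule cringI)
    show "abelian_group (Co_ring W A)"
    proof (rule abelian_groupI)
      fix x assume "x \<in> carrier (Co_ring W A)"
      then show "\<exists>y\<in>carrier (Co_ring W A). y \<oplus>\<^bsub>Co_ring W A\<^esub> x = \<zero>\<^bsub>Co_ring W A\<^esub>"
        by (auto simp: Co_ring_def intro!: bexI[of _ x])
    qed (auto simp: Co_ring_def)
    show "Group.comm_monoid (Co_ring W A)"
      by (rule Group.comm_monoidI) (use A in \<open>auto simp: Co_ring_def\<close>)
  qed (auto simp: Co_ring_def)
  then show ?thesis
    by (simp add: cring_def)
qed

lemma set_ring_iso_to_ring_iso: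
  assumes "A \<in> Co W" "B \<in> Co W" and iso: "set_ring_iso \<phi> (Co_below W A) (Co_below W B)"
  shows "\<phi> \<in> ring_iso (Co_ring W A) (Co_ring W B)"
proof (rule ring_iso_memI)
  note sr = set_ring_Co_below
  fix x y assume "x \<in> carrier (Co_ring W A)" "y \<in> carrier (Co_ring W A)"
  then have xy: "x \<in> Co_below W A" "y \<in> Co_below W A" "x - y \<in> Co_below W A" "y - x \<in> Co_below W A"
    using sr by (auto simp: carrier_Co_ring set_ring_def)
  then show "\<phi> (x \<otimes>\<^bsub>Co_ring W A\<^esub> y) = \<phi> x \<otimes>\<^bsub>Co_ring W B\<^esub> \<phi> y"
    using set_ring_iso_Int[OF sr iso] by (simp add: Co_ring_def)
  show "\<phi> (x \<oplus>\<^bsub>Co_ring W A\<^esub> y) = \<phi> x \<oplus>\<^bsub>Co_ring W B\<^esub> \<phi> y"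
    using xy set_ring_iso_Un[OF iso xy(3,4)] set_ring_iso_Diff[OF iso] by (simp add: Co_ring_def)
next
  show "\<phi> \<one>\<^bsub>Co_ring W A\<^esub> = \<one>\<^bsub>Co_ring W B\<^esub>"
    using set_ring_iso_below_top[OF assms] by (simp add: Co_ring_def)
next
  fix x assume "x \<in> carrier (Co_ring W A)"
  then show "\<phi> x \<in> carrier (Co_ring W B)"
    using set_ring_iso_mem[OF iso] by (simp add: carrier_Co_ring)
qed (use iso in \<open>simp add: carrier_Co_ring set_ring_iso_def\<close>)

text \<open>
  Union and difference are polynomials in intersection and symmetric difference, the operations of
  the Boolean ring.
\<close>

lemma set_ring_iso_if_sym_diff:
  assumes bij: "bij_betw h (Co_below W A) S"
    and Int: "\<And>x y. x \<in> Co_below W A \<Longrightarrow> y \<in> Co_below W A \<Longrightarrow> h (x \<inter> y) = h x \<inter> h y"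
    and sym: "\<And>x y. x \<in> Co_below W A \<Longrightarrow> y \<in> Co_below W A \<Longrightarrow>
      h ((x - y) \<union> (y - x)) = (h x - h y) \<union> (h y - h x)"
  shows "set_ring_iso h (Co_below W A) S"
proof -
  have "h (x \<union> y) = h x \<union> h y \<and> h (x - y) = h x - h y"
    if xy: "x \<in> Co_below W A" "y \<in> Co_below W A" for x y
  proof -
    have in1: "x \<inter> y \<in> Co_below W A" "(x - y) \<union> (y - x) \<in> Co_below W A"
      using xy by (auto simp: Co_below_def)
    have "x - y = (x - x \<inter> y) \<union> (x \<inter> y - x)" by auto
    then have "h (x - y) = h x - h y"
      using sym[OF xy(1) in1(1)] Int[OF xy] by auto
    moreover have "x \<union> y = ((x - y) \<union> (y - x) - x \<inter> y) \<union> (x \<inter> y - ((x - y) \<union> (y - x)))" by auto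
    then have "h (x \<union> y) = h x \<union> h y"
      using sym[OF in1(2,1)] Int[OF xy] sym[OF xy] by auto
    ultimately show ?thesis by simp
  qed
  then show ?thesis
    using bij by (auto simp: set_ring_iso_def)
qed

lemma ring_iso_to_set_ring_iso:
  assumes h: "h \<in> ring_iso (Co_ring W A) (Co_ring W B)"
  shows "set_ring_iso h (Co_below W A) (Co_below W B)"
proof (rule set_ring_iso_if_sym_diff)
  show "bij_betw h (Co_below W A) (Co_below W B)"
    using ring_iso_memE(5)[OF h] by (simp add: carrier_Co_ring)
  fix x y assume "x \<in> Co_below W A" "y \<in> Co_below W A"
  then show "h (x \<inter> y) = h x \<inter> h y" "h ((x - y) \<union> (y - x)) = (h x - h y) \<union> (h y - h x)"
    using ring_iso_memE(2,3)[OF h, of x y] unfolding carrier_Co_ring by (simp_all add: Co_ring_def)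
qed

lemma Co_ring_iso_iff:
  "A \<in> Co W \<Longrightarrow> B \<in> Co W \<Longrightarrow> Co_ring W A \<simeq> Co_ring W B \<longleftrightarrow> A \<sim> B"
  unfolding is_ring_iso_def co_equiv_def
  using set_ring_iso_to_ring_iso ring_iso_to_set_ring_iso by blast

text \<open>
  The class of \<open>A\<close> contains the ring \<open>(A)\<close> itself, so equal classes belong
  to isomorphic rings.
\<close>

lemma Co_class_eq_iff:
  assumes "A \<in> Co W" "B \<in> Co W"
  shows "Co_class W A = Co_class W B \<longleftrightarrow> A \<sim> B"
proof
  assume eq: "Co_class W A = Co_class W B"
  have "Co_ring W B \<in> Co_class W B"
    using ring_Co_ring[OF assms(2)] ring_iso_refl by (auto simp: Co_class_def)
  then have "Co_ring W A \<simeq> Co_ring W B"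
    using eq by (auto simp: Co_class_def)
  then show "A \<sim> B"
    using Co_ring_iso_iff assms by blast
next
  assume "A \<sim> B"
  then have *: "Co_ring W A \<simeq> Co_ring W B" "Co_ring W B \<simeq> Co_ring W A"
    using Co_ring_iso_iff assms equiv_sym by blast+
  show "Co_class W A = Co_class W B"
    unfolding Co_class_def using * ring_iso_trans by blast
qed

text \<open>
  \<open>A\<close> absorbs \<open>B\<close> if \<open>(A) \<times> (B) \<cong> (A)\<close>; in terms of subsets, \<open>A\<close> contains a copy of \<open>B\<close> whose
  complement is a copy of \<open>A\<close>.
\<close>

definition absorbs :: "'a set \<Rightarrow> 'a set \<Rightarrow> bool" where
  "absorbs A B \<longleftrightarrow> (\<exists>C\<in>Co W. C \<subseteq> A \<and> C \<sim> B \<and> A - C \<sim> A)"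

text \<open>
  An isomorphism from \<open>(A) \<times> (B)\<close> onto \<open>(A)\<close> cuts \<open>A\<close>
  into the images \<open>P\<close> of \<open>(A, {})\<close> and \<open>Q\<close> of \<open>({},
  B)\<close>, and it restricts to isomorphisms from \<open>(A)\<close> onto \<open>(P)\<close> and
  from \<open>(B)\<close> onto \<open>(Q)\<close>. Conversely, the two parts of such a cut of
  \<open>A\<close> are recombined by taking unions.
\<close>

lemma RDirProd_iso_iff:
  assumes A: "A \<in> Co W" and B: "B \<in> Co W"
  shows "RDirProd (Co_ring W A) (Co_ring W B) \<simeq> Co_ring W A \<longleftrightarrow> absorbs A B"
proof
  note prod_simps = RDirProd_def DirProd_def monoid.defs
  assume "RDirProd (Co_ring W A) (Co_ring W B) \<simeq> Co_ring W A"
  then obtain h where h: "h \<in> ring_iso (RDirProd (Co_ring W A) (Co_ring W B)) (Co_ring W A)"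
    by (auto simp: is_ring_iso_def)
  have mult: "h (x \<inter> x', y \<inter> y') = h (x, y) \<inter> h (x', y')"
    and add: "h ((x - x') \<union> (x' - x), (y - y') \<union> (y' - y)) =
      (h (x, y) - h (x', y')) \<union> (h (x', y') - h (x, y))"
    if "x \<in> Co_below W A" "y \<in> Co_below W B" "x' \<in> Co_below W A" "y' \<in> Co_below W B" for x y x' y'
    using ring_iso_memE(2,3)[OF h, of "(x, y)" "(x', y')"] that
    by (auto simp: RDirProd_carrier carrier_Co_ring) (auto simp: prod_simps Co_ring_def)
  have bij: "bij_betw h (Co_below W A \<times> Co_below W B) (Co_below W A)"
    using ring_iso_memE(5)[OF h] by (simp add: RDirProd_carrier carrier_Co_ring)
  have mem: "h (x, y) \<in> Co_below W A" if "x \<in> Co_below W A" "y \<in> Co_below W B" for x y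
    using bij_betw_apply[OF bij] that by auto
  have emp: "{} \<in> Co_below W X" for X
    by (auto simp: Co_below_def)
  have topA: "A \<in> Co_below W A" and topB: "B \<in> Co_below W B"
    using A B by (auto simp: Co_below_def)
  define P where "P = h (A, {})"
  define Q where "Q = h ({}, B)"
  have PQ: "P \<in> Co_below W A" "Q \<in> Co_below W A"
    using mem topA topB emp by (auto simp: P_def Q_def)
  have h0: "h ({}, {}) = {}"
    using add[OF emp emp emp emp] by simp
  have "P \<inter> Q = {}"
    using mult[OF topA emp emp topB] h0 by (simp add: P_def Q_def)
  have "h (A, B) = A"
    using ring_iso_memE(4)[OF h] by (simp add: prod_simps Co_ring_def)
  then have "P \<union> Q = A"
    using add[OF topA emp emp topB] \<open>P \<inter> Q = {}\<close> by (auto simp: P_def Q_def)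
  have sub: "C \<subseteq> P \<longleftrightarrow> y = {}" "C \<subseteq> Q \<longleftrightarrow> x = {}"
    if "C = h (x, y)" "x \<in> Co_below W A" "y \<in> Co_below W B" for C x y
  proof -
    have inj: "inj_on h (Co_below W A \<times> Co_below W B)"
      using bij by (simp add: bij_betw_def)
    have "C \<inter> P = h (x, {})" "C \<inter> Q = h ({}, y)"
      using mult[OF that(2,3) topA emp] mult[OF that(2,3) emp topB] that
      by (auto simp: P_def Q_def Co_below_def Int_absorb2)
    then have "C \<subseteq> P \<longleftrightarrow> h (x, {}) = h (x, y)" "C \<subseteq> Q \<longleftrightarrow> h ({}, y) = h (x, y)"
      using that(1) by auto
    moreover have "h (x, {}) = h (x, y) \<longleftrightarrow> y = {}" "h ({}, y) = h (x, y) \<longleftrightarrow> x = {}"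
      using inj that emp by (auto simp: inj_on_eq_iff)
    ultimately show "C \<subseteq> P \<longleftrightarrow> y = {}" "C \<subseteq> Q \<longleftrightarrow> x = {}" by auto
  qed
  have "A \<sim> P"
  proof -
    have "(\<lambda>x. h (x, {})) ` Co_below W A = Co_below W P"
    proof (intro Set.set_eqI iffI)
      fix C assume "C \<in> (\<lambda>x. h (x, {})) ` Co_below W A"
      then show "C \<in> Co_below W P"
        using sub(1) mem emp by (fastforce simp: Co_below_def)
    next
      fix C assume C: "C \<in> Co_below W P"
      then have "C \<in> Co_below W A" using PQ by (auto simp: Co_below_def)
      then obtain x y where xy: "C = h (x, y)" "x \<in> Co_below W A" "y \<in> Co_below W B"
        using bij unfolding bij_betw_def by blast
      then show "C \<in> (\<lambda>x. h (x, {})) ` Co_below W A"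
        using sub(1)[OF xy] C by (auto simp: Co_below_def)
    qed
    moreover have "inj_on (\<lambda>x. h (x, {})) (Co_below W A)"
      using bij emp unfolding bij_betw_def inj_on_def by blast
    ultimately have "set_ring_iso (\<lambda>x. h (x, {})) (Co_below W A) (Co_below W P)"
      using mult[OF _ emp _ emp] add[OF _ emp _ emp] by (intro set_ring_iso_if_sym_diff) (auto simp: bij_betw_def)
    then show ?thesis
      using A PQ by (auto simp: co_equiv_def Co_below_def)
  qed
  moreover have "B \<sim> Q"
  proof -
    have "(\<lambda>y. h ({}, y)) ` Co_below W B = Co_below W Q"
    proof (intro Set.set_eqI iffI)
      fix C assume "C \<in> (\<lambda>y. h ({}, y)) ` Co_below W B"
      then show "C \<in> Co_below W Q"
        using sub(2) mem emp by (fastforce simp: Co_below_def)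
    next
      fix C assume C: "C \<in> Co_below W Q"
      then have "C \<in> Co_below W A" using PQ by (auto simp: Co_below_def)
      then obtain x y where xy: "C = h (x, y)" "x \<in> Co_below W A" "y \<in> Co_below W B"
        using bij unfolding bij_betw_def by blast
      then show "C \<in> (\<lambda>y. h ({}, y)) ` Co_below W B"
        using sub(2)[OF xy] C by (auto simp: Co_below_def)
    qed
    moreover have "inj_on (\<lambda>y. h ({}, y)) (Co_below W B)"
      using bij emp unfolding bij_betw_def inj_on_def by blast
    ultimately have "set_ring_iso (\<lambda>y. h ({}, y)) (Co_below W B) (Co_below W Q)"
      using mult[OF emp _ emp] add[OF emp _ emp] by (intro set_ring_iso_if_sym_diff) (auto simp: bij_betw_def)
    then show ?thesis
      using B PQ by (auto simp: co_equiv_def Co_below_def)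
  qed
  moreover have "A - Q = P"
    using \<open>P \<union> Q = A\<close> \<open>P \<inter> Q = {}\<close> by auto
  ultimately show "absorbs A B"
    unfolding absorbs_def using PQ by (auto simp: Co_below_def intro!: bexI[of _ Q] equiv_sym)
next
  assume "absorbs A B"
  then obtain C where C: "C \<in> Co W" "C \<subseteq> A" "B \<sim> C" "A \<sim> A - C"
    by (auto simp: absorbs_def intro: equiv_sym)
  obtain f g where "f \<in> ring_iso (Co_ring W A) (Co_ring W (A - C))" "g \<in> ring_iso (Co_ring W B) (Co_ring W C)"
    using C A B Co_ring_iso_iff[of A "A - C"] Co_ring_iso_iff[of B C] by (auto simp: is_ring_iso_def)
  then have "(\<lambda>(r, s). (f r, g s)) \<in>
      ring_iso (RDirProd (Co_ring W A) (Co_ring W B)) (RDirProd (Co_ring W (A - C)) (Co_ring W C))"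
    by (rule RDirProd_iso6)
  moreover have "(\<lambda>(r, s). r \<union> s) \<in> ring_iso (RDirProd (Co_ring W (A - C)) (Co_ring W C)) (Co_ring W A)"
  proof (rule ring_iso_memI)
    show "bij_betw (\<lambda>(r, s). r \<union> s) (carrier (RDirProd (Co_ring W (A - C)) (Co_ring W C))) (carrier (Co_ring W A))"
      using A C by (intro bij_betw_byWitness[where f' = "\<lambda>X. (X - C, X \<inter> C)"])
        (auto simp: RDirProd_carrier carrier_Co_ring Co_below_def)
  qed (use A C in \<open>auto simp: RDirProd_def DirProd_def monoid.defs Co_ring_def\<close>)
  ultimately have "(\<lambda>(r, s). r \<union> s) \<circ> (\<lambda>(r, s). (f r, g s)) \<in>
      ring_iso (RDirProd (Co_ring W A) (Co_ring W B)) (Co_ring W A)"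
    by (rule ring_iso_set_trans)
  then show "RDirProd (Co_ring W A) (Co_ring W B) \<simeq> Co_ring W A"
    by (auto simp: is_ring_iso_def)
qed

end

section \<open>Back and forth\<close>

text \<open>
  The relation \<open>E\<close> says which elements of two countable rings of sets may be matched. A
  matched pair can be cut along any element of either ring so that the parts match again, and once
  the initial pair \<open>(K, L)\<close> has been covered, every element outside the part treated so
  far has a partner outside it. For rings with a largest element \<open>(K, L)\<close> can be the
  pair of largest elements; in general it has to contain whatever occurs only in a bounded region.
\<close>

locale back_and_forth =
  fixes R :: "'a set set" and S :: "'b set set" and E :: "'a set \<Rightarrow> 'b set \<Rightarrow> bool"
    and K :: "'a set" and L :: "'b set"
  assumes R: "set_ring R" "countable R" and S: "set_ring S" "countable S"
    and E_mem: "E A B \<Longrightarrow> A \<in> R \<and> B \<in> S"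
    and E_empty_iff: "E A B \<Longrightarrow> A = {} \<longleftrightarrow> B = {}"
    and E_Un: "E A B \<Longrightarrow> E C D \<Longrightarrow> A \<inter> C = {} \<Longrightarrow> B \<inter> D = {} \<Longrightarrow> E (A \<union> C) (B \<union> D)"
    and E_split: "E A B \<Longrightarrow> C \<in> R \<Longrightarrow> C \<subseteq> A \<Longrightarrow> \<exists>D\<subseteq>B. E C D \<and> E (A - C) (B - D)"
    and E_split': "E A B \<Longrightarrow> D \<in> S \<Longrightarrow> D \<subseteq> B \<Longrightarrow> \<exists>C\<subseteq>A. E C D \<and> E (A - C) (B - D)"
    and E_start: "E K L"
    and E_extend: "E U V \<Longrightarrow> K \<subseteq> U \<Longrightarrow> L \<subseteq> V \<Longrightarrow> A \<in> R \<Longrightarrow> A \<inter> U = {} \<Longrightarrow> \<exists>B. B \<inter> V = {} \<and> E A B"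
    and E_extend': "E U V \<Longrightarrow> K \<subseteq> U \<Longrightarrow> L \<subseteq> V \<Longrightarrow> B \<in> S \<Longrightarrow> B \<inter> V = {} \<Longrightarrow> \<exists>A. A \<inter> U = {} \<and> E A B"
begin

text \<open>
  A stage of the construction is a finite set of matched pairs of disjoint blocks; it determines a
  partial isomorphism between the finite rings generated by the blocks.
\<close>

definition stage :: "('a set \<times> 'b set) set \<Rightarrow> bool" where
  "stage Z \<longleftrightarrow> finite Z \<and> (\<forall>s\<in>Z. E (fst s) (snd s)) \<and>
     (\<forall>s\<in>Z. \<forall>t\<in>Z. s \<noteq> t \<longrightarrow> fst s \<inter> fst t = {} \<and> snd s \<inter> snd t = {}) \<and>
     K \<subseteq> \<Union>(fst ` Z) \<and> L \<subseteq> \<Union>(snd ` Z)"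

definition span :: "('a set \<times> 'b set) set \<Rightarrow> ('a set \<times> 'b set) set" where
  "span Z = {(\<Union>(fst ` T), \<Union>(snd ` T)) | T. T \<subseteq> Z}"

lemma E_empty: "E {} {}"
  using E_split[OF E_start, of "{}"] E_empty_iff R by (auto simp: set_ring_def)

lemma E_stage:
  assumes "stage Z" "T \<subseteq> Z"
  shows "E (\<Union>(fst ` T)) (\<Union>(snd ` T))"
proof -
  have "finite T"
    using assms by (auto simp: stage_def intro: finite_subset)
  then show ?thesis
    using assms(2)
  proof (induction T rule: finite_induct)
    case (insert s T)
    have "fst s \<inter> fst t = {} \<and> snd s \<inter> snd t = {}" if t: "t \<in> T" for t
    proof -
      have "s \<in> Z" "t \<in> Z" "s \<noteq> t"
        using insert t by auto
      then show ?thesis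
        using assms(1) unfolding stage_def by blast
    qed
    then have "fst s \<inter> \<Union>(fst ` T) = {}" "snd s \<inter> \<Union>(snd ` T) = {}"
      by blast+
    moreover have "E (fst s) (snd s)"
      using insert assms(1) by (auto simp: stage_def)
    ultimately show ?case
      using E_Un insert by simp
  qed (simp add: E_empty)
qed

lemma span_E: "stage Z \<Longrightarrow> (A, B) \<in> span Z \<Longrightarrow> E A B"
  using E_stage by (auto simp: span_def)

lemma span_Un:
  assumes "(A, B) \<in> span Z" "(C, D) \<in> span Z"
  shows "(A \<union> C, B \<union> D) \<in> span Z"
proof -
  obtain T T' where "T \<subseteq> Z" "A = \<Union>(fst ` T)" "B = \<Union>(snd ` T)"
      "T' \<subseteq> Z" "C = \<Union>(fst ` T')" "D = \<Union>(snd ` T')"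
    using assms by (auto simp: span_def)
  then have "T \<union> T' \<subseteq> Z" "A \<union> C = \<Union>(fst ` (T \<union> T'))" "B \<union> D = \<Union>(snd ` (T \<union> T'))"
    by auto
  then show ?thesis unfolding span_def by blast
qed

lemma span_Diff:
  assumes Z: "stage Z" and "(A, B) \<in> span Z" "(C, D) \<in> span Z"
  shows "(A - C, B - D) \<in> span Z"
proof -
  obtain T T' where T: "T \<subseteq> Z" "A = \<Union>(fst ` T)" "B = \<Union>(snd ` T)"
      "T' \<subseteq> Z" "C = \<Union>(fst ` T')" "D = \<Union>(snd ` T')"
    using assms by (auto simp: span_def)
  have disj: "fst s \<inter> fst t = {} \<and> snd s \<inter> snd t = {}" if "s \<in> T - T'" "t \<in> T'" for s t
    using Z T that unfolding stage_def by (metis DiffD1 DiffD2 subsetD)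
  have "A - C = \<Union>(fst ` (T - T'))" "B - D = \<Union>(snd ` (T - T'))"
    unfolding T using disj by blast+
  then show ?thesis
    using T(1) unfolding span_def by blast
qed

text \<open>
  Every block is cut along \<open>C\<close>, and the part of \<open>C\<close> outside all blocks
  becomes a new block. An old block is the union of its two parts, so the partial isomorphism is
  extended.
\<close>

lemma extend_stage_left:
  assumes Z: "stage Z" and C: "C \<in> R"
  shows "\<exists>Z'. stage Z' \<and> span Z \<subseteq> span Z' \<and> C \<in> fst ` span Z'"
proof -
  have "\<exists>D\<subseteq>snd s. E (fst s \<inter> C) D \<and> E (fst s - C) (snd s - D)" if "s \<in> Z" for s
  proof -
    have s: "E (fst s) (snd s)"
      using Z that by (auto simp: stage_def)
    then have "fst s \<inter> C \<in> R"
      using E_mem R C set_ring_Int by blast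
    then show ?thesis
      using E_split[OF s, of "fst s \<inter> C"] by (simp add: Diff_Int_distrib Diff_Int)
  qed
  then obtain d where d: "d s \<subseteq> snd s" "E (fst s \<inter> C) (d s)" "E (fst s - C) (snd s - d s)"
    if "s \<in> Z" for s by metis
  define U where "U = \<Union>(fst ` Z)"
  define V where "V = \<Union>(snd ` Z)"
  have UV: "E U V" "K \<subseteq> U" "L \<subseteq> V"
    using E_stage[OF Z] Z by (auto simp: U_def V_def stage_def)
  then have "C - U \<in> R"
    using E_mem R C by (auto simp: set_ring_def)
  then obtain B where B: "B \<inter> V = {}" "E (C - U) B"
    using E_extend[OF UV] by blast
  define f where "f = (\<lambda>s. (fst s \<inter> C, d s))"
  define g where "g = (\<lambda>s. (fst s - C, snd s - d s))"
  define Z' where "Z' = f ` Z \<union> g ` Z \<union> {(C - U, B)}"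
  have sub: "fst (f s) \<subseteq> fst s" "fst (g s) \<subseteq> fst s" "snd (f s) \<subseteq> snd s" "snd (g s) \<subseteq> snd s"
      "fst (f s) \<inter> fst (g s) = {}" "snd (f s) \<inter> snd (g s) = {}"
      "fst s \<inter> (C - U) = {}" "snd s \<inter> B = {}" "fst (f s) \<union> fst (g s) = fst s" "snd (f s) \<union> snd (g s) = snd s"
    if "s \<in> Z" for s
    using d(1)[OF that] B(1) that by (auto simp: f_def g_def U_def V_def)
  have disjZ: "fst s \<inter> fst t = {} \<and> snd s \<inter> snd t = {}" if "s \<in> Z" "t \<in> Z" "s \<noteq> t" for s t
    using Z that unfolding stage_def by blast
  have fg: "fst (h s) \<inter> fst (h' t) = {} \<and> snd (h s) \<inter> snd (h' t) = {}"
    if "s \<in> Z" "t \<in> Z" "h = f \<or> h = g" "h' = f \<or> h' = g" "h s \<noteq> h' t" for s t h h'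
  proof (cases "s = t")
    case True
    then show ?thesis
      using that(3-5) sub(5,6)[OF that(1)] by (metis Int_commute)
  next
    case False
    have "fst (h s) \<subseteq> fst s" "fst (h' t) \<subseteq> fst t" "snd (h s) \<subseteq> snd s" "snd (h' t) \<subseteq> snd t"
      using sub(1-4)[OF that(1)] sub(1-4)[OF that(2)] that(3,4) by auto
    then show ?thesis using disjZ[OF that(1,2) False] by blast
  qed
  have new: "fst (h s) \<inter> (C - U) = {} \<and> snd (h s) \<inter> B = {}" if "s \<in> Z" "h = f \<or> h = g" for s h
    using sub[OF that(1)] that(2) by blast
  have "stage Z'"
    unfolding stage_def
  proof (intro conjI ballI impI)
    show "finite Z'" using Z by (simp add: Z'_def stage_def)
    show "E (fst s) (snd s)" if "s \<in> Z'" for s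
      using that d B by (auto simp: Z'_def f_def g_def)
    have rep: "(\<exists>u\<in>Z. \<exists>h. (h = f \<or> h = g) \<and> s = h u) \<or> s = (C - U, B)" if "s \<in> Z'" for s
      using that by (auto simp: Z'_def)
    show "fst s \<inter> fst t = {}" "snd s \<inter> snd t = {}" if "s \<in> Z'" "t \<in> Z'" "s \<noteq> t" for s t
      using rep[OF that(1)] rep[OF that(2)] that(3) fg new by (metis Int_commute fst_conv snd_conv)+
    have "U \<subseteq> \<Union>(fst ` Z')" "V \<subseteq> \<Union>(snd ` Z')"
      using sub(9,10) unfolding Z'_def U_def V_def by fastforce+
    then show "K \<subseteq> \<Union>(fst ` Z')" "L \<subseteq> \<Union>(snd ` Z')"
      using UV by blast+
  qed
  moreover have "span Z \<subseteq> span Z'"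
  proof
    fix p assume "p \<in> span Z"
    then obtain T where T: "T \<subseteq> Z" "p = (\<Union>(fst ` T), \<Union>(snd ` T))"
      by (auto simp: span_def)
    have "\<Union>(fst ` (f ` T \<union> g ` T)) = (\<Union>s\<in>T. fst (f s) \<union> fst (g s))" by blast
    also have "\<dots> = (\<Union>s\<in>T. fst s)"
      using sub(9) T(1) by (intro SUP_cong refl) blast
    finally have fst_eq: "\<Union>(fst ` (f ` T \<union> g ` T)) = \<Union>(fst ` T)" .
    have "\<Union>(snd ` (f ` T \<union> g ` T)) = (\<Union>s\<in>T. snd (f s) \<union> snd (g s))" by blast
    also have "\<dots> = (\<Union>s\<in>T. snd s)"
      using sub(10) T(1) by (intro SUP_cong refl) blast
    finally have "p = (\<Union>(fst ` (f ` T \<union> g ` T)), \<Union>(snd ` (f ` T \<union> g ` T)))"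
      using T(2) fst_eq by simp
    moreover have "f ` T \<union> g ` T \<subseteq> Z'"
      using T(1) by (auto simp: Z'_def)
    ultimately show "p \<in> span Z'" unfolding span_def by blast
  qed
  moreover have "C = \<Union>(fst ` (f ` Z \<union> {(C - U, B)}))"
    by (auto simp: f_def U_def)
  then have "C \<in> fst ` span Z'"
    unfolding span_def Z'_def by (auto simp: image_iff intro!: exI[of _ "f ` Z \<union> {(C - U, B)}"])
  ultimately show ?thesis by blast
qed

end

lemma back_and_forth_swap:
  assumes "back_and_forth R S E K L"
  shows "back_and_forth S R (\<lambda>B A. E A B) L K"
proof -
  interpret back_and_forth R S E K L by fact
  show ?thesis
  proof
    show "B \<in> S \<and> A \<in> R" if "E A B" for B A
      using E_mem[OF that] by simp
    show "B = {} \<longleftrightarrow> A = {}" if "E A B" for B A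
      using E_empty_iff[OF that] by simp
    show "E (A \<union> C) (B \<union> D)" if "E A B" "E C D" "B \<inter> D = {}" "A \<inter> C = {}" for B A D C
      using E_Un that by simp
    show "\<exists>C\<subseteq>A. E C D \<and> E (A - C) (B - D)" if "E A B" "D \<in> S" "D \<subseteq> B" for B A D
      using E_split' that by simp
    show "\<exists>D\<subseteq>B. E C D \<and> E (A - C) (B - D)" if "E A B" "C \<in> R" "C \<subseteq> A" for B A C
      using E_split that by simp
    show "\<exists>A. A \<inter> U = {} \<and> E A B"
      if "E U V" "L \<subseteq> V" "K \<subseteq> U" "B \<in> S" "B \<inter> V = {}" for V U B
      using E_extend' that by simp
    show "\<exists>B. B \<inter> V = {} \<and> E A B"
      if "E U V" "L \<subseteq> V" "K \<subseteq> U" "A \<in> R" "A \<inter> U = {}" for V U A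
      using E_extend that by simp
  qed (rule R S E_start)+
qed

context back_and_forth
begin

lemma extend_stage_right:
  assumes Z: "stage Z" and D: "D \<in> S"
  shows "\<exists>Z'. stage Z' \<and> span Z \<subseteq> span Z' \<and> D \<in> snd ` span Z'"
proof -
  interpret swap: back_and_forth S R "\<lambda>B A. E A B" L K
    by (rule back_and_forth_swap) (rule back_and_forth_axioms)
  have swap_eq: "prod.swap s = prod.swap t \<longleftrightarrow> s = t" for s t :: "'a set \<times> 'b set"
    by (auto simp: prod_eq_iff)
  have st: "swap.stage (prod.swap ` Y) \<longleftrightarrow> stage Y" for Y
    unfolding swap.stage_def stage_def
    by (simp add: image_image finite_image_iff inj_on_def swap_eq conj_ac)
  have sp: "swap.span (prod.swap ` Y) = prod.swap ` span Y" for Y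
  proof -
    have 1: "p \<in> prod.swap ` local.span Y" if p: "p \<in> swap.span (prod.swap ` Y)" for p
    proof -
      obtain T where "T \<subseteq> prod.swap ` Y" "p = (\<Union>(fst ` T), \<Union>(snd ` T))"
        using p by (auto simp: swap.span_def)
      then obtain T' where T': "T' \<subseteq> Y" "p = (\<Union>(fst ` prod.swap ` T'), \<Union>(snd ` prod.swap ` T'))"
        by (auto simp: subset_image_iff)
      then have "p = prod.swap (\<Union>(fst ` T'), \<Union>(snd ` T'))"
        by (simp add: image_image)
      then show ?thesis
        using T'(1) unfolding span_def by blast
    qed
    have 2: "p \<in> swap.span (prod.swap ` Y)" if p: "p \<in> prod.swap ` local.span Y" for p
    proof -
      obtain T where T: "T \<subseteq> Y" "p = prod.swap (\<Union>(fst ` T), \<Union>(snd ` T))"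
        using p by (auto simp: span_def)
      then have "p = (\<Union>(fst ` prod.swap ` T), \<Union>(snd ` prod.swap ` T))"
        by (simp add: image_image)
      then show ?thesis
        using T(1) unfolding swap.span_def by blast
    qed
    show ?thesis
      using 1 2 by blast
  qed
  obtain Y where Y: "swap.stage Y" "swap.span (prod.swap ` Z) \<subseteq> swap.span Y" "D \<in> fst ` swap.span Y"
    using swap.extend_stage_left[of "prod.swap ` Z" D] Z D st by blast
  define Z' where "Z' = prod.swap ` Y"
  have "Y = prod.swap ` Z'"
    by (simp add: Z'_def image_image)
  then have "stage Z'" "prod.swap ` span Z \<subseteq> prod.swap ` span Z'" "D \<in> fst ` prod.swap ` span Z'"
    using Y st sp by auto
  then show ?thesis
    by (auto simp: inj_image_subset_iff image_image intro!: exI[of _ Z'])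
qed

text \<open>
  Alternating the two extensions along enumerations of both rings exhausts them. The union of the
  partial isomorphisms is closed under differences, and \<open>E\<close> matches the empty set only
  with itself; hence the union is a bijection.
\<close>

theorem set_ring_iso_exists: "\<exists>\<phi>. set_ring_iso \<phi> R S"
proof -
  define r where "r = from_nat_into R"
  define s where "s = from_nat_into S"
  have ne: "R \<noteq> {}" "S \<noteq> {}"
    using R S by (auto simp: set_ring_def)
  have rs: "r n \<in> R" "s n \<in> S" for n
    using ne by (auto simp: r_def s_def from_nat_into)
  have "\<exists>G. stage (G 0) \<and> (\<forall>n. stage (G n) \<and> (span (G n) \<subseteq> span (G (Suc n)) \<and>
      r n \<in> fst ` span (G (Suc n)) \<and> s n \<in> snd ` span (G (Suc n))))"
  proof -
    have base: "stage {(K, L)}"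
      using E_start by (auto simp: stage_def)
    have step: "\<exists>Y. stage Y \<and> (span Z \<subseteq> span Y \<and> r n \<in> fst ` span Y \<and> s n \<in> snd ` span Y)"
      if Z: "stage Z" for Z n
    proof -
      obtain Z1 where Z1: "stage Z1" "span Z \<subseteq> span Z1" "r n \<in> fst ` span Z1"
        using extend_stage_left[OF Z rs(1)] by blast
      obtain Z2 where "stage Z2" "span Z1 \<subseteq> span Z2" "s n \<in> snd ` span Z2"
        using extend_stage_right[OF Z1(1) rs(2)] by blast
      then show ?thesis
        using Z1 by (intro exI[of _ Z2]) blast
    qed
    obtain G where "\<And>n. stage (G n)" "\<And>n. span (G n) \<subseteq> span (G (Suc n)) \<and>
      r n \<in> fst ` span (G (Suc n)) \<and> s n \<in> snd ` span (G (Suc n))"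
      using dependent_nat_choice[of "\<lambda>n. stage"
        "\<lambda>n Z Y. span Z \<subseteq> span Y \<and> r n \<in> fst ` span Y \<and> s n \<in> snd ` span Y"] base step by blast
    then show ?thesis by blast
  qed
  then obtain G where G: "\<And>n. stage (G n)" "\<And>n. span (G n) \<subseteq> span (G (Suc n))"
    "\<And>n. r n \<in> fst ` span (G (Suc n))" "\<And>n. s n \<in> snd ` span (G (Suc n))"
    by blast
  have mono: "span (G m) \<subseteq> span (G n)" if "m \<le> n" for m n
    using G(2) that by (rule lift_Suc_mono_le)
  define M where "M = (\<Union>n. span (G n))"
  have M_E: "E A B" if "(A, B) \<in> M" for A B
    using that G(1) span_E by (auto simp: M_def)
  have M_common: "\<exists>n. (A, B) \<in> span (G n) \<and> (C, D) \<in> span (G n)"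
    if AB: "(A, B) \<in> M" and CD: "(C, D) \<in> M" for A B C D
  proof -
    obtain m n where "(A, B) \<in> span (G m)" "(C, D) \<in> span (G n)"
      using AB CD by (auto simp: M_def)
    then show ?thesis
      using mono[of m "max m n"] mono[of n "max m n"] by (auto intro!: exI[of _ "max m n"])
  qed
  have M_Un: "(A \<union> C, B \<union> D) \<in> M" and M_Diff: "(A - C, B - D) \<in> M"
    if AB: "(A, B) \<in> M" "(C, D) \<in> M" for A B C D
  proof -
    obtain n where n: "(A, B) \<in> span (G n)" "(C, D) \<in> span (G n)"
      using M_common[OF AB] by blast
    have "(A \<union> C, B \<union> D) \<in> span (G n)" "(A - C, B - D) \<in> span (G n)"
      using span_Un[OF n] span_Diff[OF G(1) n] .
    then show "(A \<union> C, B \<union> D) \<in> M" "(A - C, B - D) \<in> M"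
      by (simp_all add: M_def exI[of _ n])
  qed
  have M_eq: "A = C \<longleftrightarrow> B = D" if "(A, B) \<in> M" "(C, D) \<in> M" for A B C D
  proof -
    have "A - C = {} \<longleftrightarrow> B - D = {}" "C - A = {} \<longleftrightarrow> D - B = {}"
      using E_empty_iff[OF M_E[OF M_Diff[OF that]]] E_empty_iff[OF M_E[OF M_Diff[OF that(2,1)]]] .
    then show ?thesis by blast
  qed
  have M_total: "\<exists>B. (A, B) \<in> M" if A: "A \<in> R" for A
  proof -
    obtain n where "A = r n"
      using from_nat_into_surj[OF R(2) A] by (auto simp: r_def)
    then show ?thesis using G(3)[of n] by (force simp: M_def)
  qed
  have M_onto: "\<exists>A. (A, B) \<in> M" if B: "B \<in> S" for B
  proof -
    obtain n where "B = s n"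
      using from_nat_into_surj[OF S(2) B] by (auto simp: s_def)
    then show ?thesis using G(4)[of n] by (force simp: M_def)
  qed
  obtain \<phi> where \<phi>: "(A, \<phi> A) \<in> M" if "A \<in> R" for A
    using M_total by metis
  have \<phi>_eq: "\<phi> A = B" if "(A, B) \<in> M" for A B
    using M_eq[OF that \<phi>] M_E[OF that] E_mem by blast
  have "inj_on \<phi> R"
    using M_eq[OF \<phi> \<phi>] by (simp add: inj_on_def)
  moreover have "\<phi> A \<in> S" if "A \<in> R" for A
    using E_mem[OF M_E[OF \<phi>[OF that]]] by simp
  moreover have "B \<in> \<phi> ` R" if B: "B \<in> S" for B
  proof -
    obtain A where A: "(A, B) \<in> M"
      using M_onto[OF B] by blast
    then have "A \<in> R" "\<phi> A = B"
      using E_mem[OF M_E[OF A]] \<phi>_eq by auto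
    then show ?thesis by blast
  qed
  ultimately have "bij_betw \<phi> R S"
    unfolding bij_betw_def by blast
  moreover have "\<phi> (A \<union> B) = \<phi> A \<union> \<phi> B \<and> \<phi> (A - B) = \<phi> A - \<phi> B" if "A \<in> R" "B \<in> R" for A B
    using \<phi>_eq[OF M_Un[OF \<phi>[OF that(1)] \<phi>[OF that(2)]]] \<phi>_eq[OF M_Diff[OF \<phi>[OF that(1)] \<phi>[OF that(2)]]]
    by simp
  ultimately show ?thesis
    unfolding set_ring_iso_def by blast
qed

end


section \<open>Stone duality\<close>

text \<open>
  The sets \<open>\<phi> A\<close> with \<open>x \<in> A\<close> form a proper filter. A common
  point \<open>y\<close> of theirs lies in no other \<open>\<phi> A\<close>: if \<open>x \<notin>
  A\<close> and \<open>x \<in> A0\<close>, then \<open>y\<close> lies in \<open>\<phi> (A0 -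
  A)\<close>.
\<close>

lemma Stone_duality_point:
  assumes W: "stone W" and W': "stone W'" and iso: "set_ring_iso \<phi> (Co W) (Co W')"
    and x: "x \<in> topspace W"
  shows "\<exists>y\<in>topspace W'. \<forall>A\<in>Co W. y \<in> \<phi> A \<longleftrightarrow> x \<in> A"
proof -
  interpret W: stone W by fact
  interpret W': stone W' by fact
  note ring = W.set_ring_Co
  define F where "F = \<phi> ` {A \<in> Co W. x \<in> A}"
  obtain A0 where A0: "A0 \<in> Co W" "x \<in> A0"
    using W.Co_base[OF openin_topspace x] .
  have "\<exists>C\<in>F. C \<subseteq> B \<inter> B'" if BB: "B \<in> F" "B' \<in> F" for B B'
  proof -
    obtain A A' where "A \<in> Co W" "x \<in> A" "B = \<phi> A" "A' \<in> Co W" "x \<in> A'" "B' = \<phi> A'"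
      using BB by (auto simp: F_def)
    then show ?thesis
      using set_ring_iso_Int[OF ring iso, of A A'] unfolding F_def
      by (intro bexI[of _ "\<phi> (A \<inter> A')"]) auto
  qed
  moreover have "{} \<notin> F"
  proof
    assume "{} \<in> F"
    then obtain A where A: "A \<in> Co W" "x \<in> A" "\<phi> A = {}" by (auto simp: F_def)
    then show False
      using set_ring_iso_subset_iff[OF ring iso A(1), of "{}"] by auto
  qed
  moreover have "F \<subseteq> Co W'" "F \<noteq> {}"
    using set_ring_iso_mem[OF iso] A0 by (auto simp: F_def)
  ultimately obtain y where y: "y \<in> topspace W'" "\<And>B. B \<in> F \<Longrightarrow> y \<in> B"
    using W'.filter_has_point[of F] by metis
  have "y \<in> \<phi> A \<longleftrightarrow> x \<in> A" if A: "A \<in> Co W" for A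
  proof
    assume "y \<in> \<phi> A"
    show "x \<in> A"
    proof (rule ccontr)
      assume "x \<notin> A"
      then have "\<phi> (A0 - A) \<in> F"
        using A A0 by (auto simp: F_def)
      then have "y \<in> \<phi> A0 - \<phi> A"
        using y(2) set_ring_iso_Diff[OF iso A0(1) A] by auto
      then show False
        using \<open>y \<in> \<phi> A\<close> by auto
    qed
  qed (use A y(2) in \<open>auto simp: F_def\<close>)
  then show ?thesis
    using y(1) by blast
qed

text \<open>
  The points given by the previous lemma define a map that takes each compact open \<open>A\<close>
  onto \<open>\<phi> A\<close>, and the compact open sets are bases of both topologies.
\<close>

theorem Stone_duality:
  assumes W: "stone W" and W': "stone W'" and iso: "set_ring_iso \<phi> (Co W) (Co W')"
  shows "W homeomorphic_space W'"
proof -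
  interpret W: stone W by fact
  interpret W': stone W' by fact
  have "\<forall>x\<in>topspace W. \<exists>y. y \<in> topspace W' \<and> (\<forall>A\<in>Co W. y \<in> \<phi> A \<longleftrightarrow> x \<in> A)"
    using Stone_duality_point[OF W W' iso] by blast
  then obtain h where "\<forall>x\<in>topspace W. h x \<in> topspace W' \<and> (\<forall>A\<in>Co W. h x \<in> \<phi> A \<longleftrightarrow> x \<in> A)"
    by (rule bchoice[THEN exE])
  then have h: "h x \<in> topspace W'" "\<And>A. A \<in> Co W \<Longrightarrow> h x \<in> \<phi> A \<longleftrightarrow> x \<in> A"
    if "x \<in> topspace W" for x
    using that by auto
  have inv: "set_ring_iso (inv_into (Co W) \<phi>) (Co W') (Co W)"
    using set_ring_iso_inv[OF W.set_ring_Co iso] .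
  have im: "h ` A = \<phi> A" if A: "A \<in> Co W" for A
  proof (intro subset_antisym subsetI)
    fix y assume "y \<in> h ` A"
    then show "y \<in> \<phi> A"
      using h(2) A Co_subset_topspace by blast
  next
    fix y assume y: "y \<in> \<phi> A"
    have yt: "y \<in> topspace W'"
      using y set_ring_iso_mem[OF iso A] Co_subset_topspace by blast
    obtain x where x: "x \<in> topspace W" "\<forall>B\<in>Co W'. x \<in> inv_into (Co W) \<phi> B \<longleftrightarrow> y \<in> B"
      using Stone_duality_point[OF W' W inv yt] by blast
    have x': "x \<in> C \<longleftrightarrow> y \<in> \<phi> C" if "C \<in> Co W" for C
      using x(2) set_ring_iso_mem[OF iso that] iso that
      by (metis set_ring_iso_def bij_betw_inv_into_left)
    have "h x = y"
    proof (rule ccontr)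
      assume "h x \<noteq> y"
      then obtain B where B: "B \<in> Co W'" "h x \<in> B" "y \<notin> B"
        using W'.Co_separates h(1) x(1) yt by metis
      then obtain C where "C \<in> Co W" "\<phi> C = B"
        using set_ring_iso_surj[OF iso] by blast
      then show False
        using B h(2)[OF x(1)] x' by blast
    qed
    then show "y \<in> h ` A"
      using x' y A by blast
  qed
  have surj: "h ` topspace W = topspace W'"
  proof -
    have "h ` topspace W = (\<Union>A\<in>Co W. \<phi> A)"
      using im unfolding W.topspace_eq_Union_Co by (simp add: image_Union)
    also have "\<dots> = \<Union>(Co W')"
      using iso by (auto simp: set_ring_iso_def bij_betw_def)
    finally show ?thesis
      using W'.topspace_eq_Union_Co by simp
  qed
  have inj: "inj_on h (topspace W)"
  proof (rule inj_onI, rule ccontr)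
    fix x y assume xy: "x \<in> topspace W" "y \<in> topspace W" "h x = h y" "x \<noteq> y"
    then obtain A where "A \<in> Co W" "x \<in> A" "y \<notin> A"
      using W.Co_separates by metis
    then show False
      using h(2) xy by metis
  qed
  have "open_map W W' h"
    unfolding open_map_def
  proof (intro allI impI)
    fix U assume U: "openin W U"
    show "openin W' (h ` U)"
    proof (subst openin_subopen, intro ballI)
      fix y assume "y \<in> h ` U"
      then obtain x where x: "x \<in> U" "y = h x" by blast
      obtain A where A: "A \<in> Co W" "x \<in> A" "A \<subseteq> U"
        using W.Co_base[OF U x(1)] .
      have "openin W' (h ` A)"
        using im[OF A(1)] Co_openin[OF set_ring_iso_mem[OF iso A(1)]] by simp
      moreover have "y \<in> h ` A" "h ` A \<subseteq> h ` U"
        using x A by auto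
      ultimately show "\<exists>T. openin W' T \<and> y \<in> T \<and> T \<subseteq> h ` U"
        by blast
    qed
  qed
  moreover have "continuous_map W W' h"
    unfolding continuous_map
  proof (intro conjI allI impI)
    fix V assume V: "openin W' V"
    show "openin W {x \<in> topspace W. h x \<in> V}"
    proof (subst openin_subopen, intro ballI)
      fix x assume x: "x \<in> {x \<in> topspace W. h x \<in> V}"
      then obtain B where B: "B \<in> Co W'" "h x \<in> B" "B \<subseteq> V"
        using W'.Co_base[OF V, of "h x"] by auto
      then obtain A where A: "A \<in> Co W" "\<phi> A = B"
        using set_ring_iso_surj[OF iso] by blast
      have "A \<subseteq> {x \<in> topspace W. h x \<in> V}"
        using im[OF A(1)] A B Co_subset_topspace by blast
      moreover have "x \<in> A"
        using h(2) A B x by blast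
      ultimately show "\<exists>T. openin W T \<and> x \<in> T \<and> T \<subseteq> {x \<in> topspace W. h x \<in> V}"
        using A Co_openin by blast
    qed
  qed (use surj in auto)
  ultimately have "homeomorphic_map W W' h"
    using surj inj by (intro bijective_open_imp_homeomorphic_map) auto
  then show ?thesis
    by (metis homeomorphic_map_imp_homeomorphic_space)
qed

section \<open>Labelled Stone spaces\<close>

text \<open>
  \<open>decomp trim A M\<close> means that \<open>A\<close> is a disjoint union of sets that carry
  the labels in \<open>M\<close>. Recording the labels as a multiset makes decompositions of sets in
  different spaces comparable.
\<close>

inductive decomp :: "('a set \<Rightarrow> 'p \<Rightarrow> bool) \<Rightarrow> 'a set \<Rightarrow> 'p multiset \<Rightarrow> bool"
  for trim :: "'a set \<Rightarrow> 'p \<Rightarrow> bool" where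
  decomp_empty: "decomp trim {} {#}"
| decomp_insert: "trim X p \<Longrightarrow> decomp trim A M \<Longrightarrow> X \<inter> A = {} \<Longrightarrow> decomp trim (X \<union> A) (add_mset p M)"

lemma decomp_single: "trim X p \<Longrightarrow> decomp trim X {#p#}"
  using decomp_insert[OF _ decomp_empty, of trim X p] by simp

lemma decomp_Un:
  "decomp trim A M \<Longrightarrow> decomp trim B N \<Longrightarrow> A \<inter> B = {} \<Longrightarrow> decomp trim (A \<union> B) (M + N)"
proof (induction rule: decomp.induct)
  case (decomp_insert X p A M)
  then have "decomp trim (X \<union> (A \<union> B)) (add_mset p (M + N))"
    by (intro decomp.decomp_insert) auto
  then show ?case by (simp add: Un_assoc)
qed simp

lemma decomp_pick:
  "decomp trim A M \<Longrightarrow> p \<in># M \<Longrightarrow> \<exists>X\<subseteq>A. trim X p \<and> decomp trim (A - X) (M - {#p#})"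
proof (induction rule: decomp.induct)
  case (decomp_insert X q A M)
  show ?case
  proof (cases "p = q")
    case True
    moreover have "X \<union> A - X = A"
      using decomp_insert by auto
    ultimately show ?thesis
      using decomp_insert by (intro exI[of _ X]) auto
  next
    case False
    then obtain Y where Y: "Y \<subseteq> A" "trim Y p" "decomp trim (A - Y) (M - {#p#})"
      using decomp_insert by auto
    have "decomp trim (X \<union> (A - Y)) (add_mset q (M - {#p#}))"
      using decomp_insert Y by (intro decomp.decomp_insert) auto
    moreover have "X \<union> (A - Y) = X \<union> A - Y"
      using decomp_insert Y by auto
    ultimately show ?thesis
      using Y False by (intro exI[of _ Y]) auto
  qed
qed simp

lemma decomp_mem: "decomp trim A M \<Longrightarrow> p \<in># M \<Longrightarrow> \<exists>X\<subseteq>A. trim X p"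
  using decomp_pick[of trim A M p] by auto

lemma decomp_Union:
  assumes "finite F" "disjoint F" "\<And>X. X \<in> F \<Longrightarrow> \<exists>p. trim X p"
  shows "\<exists>M. decomp trim (\<Union>F) M"
  using assms
proof (induction F rule: finite_induct)
  case empty
  show ?case using decomp_empty by auto
next
  case (insert X F)
  obtain p where p: "trim X p"
    using insert(5) by blast
  have "disjoint F" "\<And>Y. Y \<in> F \<Longrightarrow> \<exists>p. trim Y p"
    using insert(4,5) by (auto simp: pairwise_insert)
  then obtain M where M: "decomp trim (\<Union>F) M"
    using insert(3) by blast
  have "X \<inter> \<Union>F = {}"
    using insert by (auto simp: pairwise_insert disjnt_def)
  then show ?case
    using decomp_insert[OF p M] by auto
qed

lemma decomp_family:
  "decomp trim A M \<Longrightarrow> \<exists>F. finite F \<and> disjoint F \<and> \<Union>F = A \<and> (\<forall>X\<in>F. \<exists>p. trim X p)"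
proof (induction rule: decomp.induct)
  case (decomp_insert X p A M)
  then obtain F where F: "finite F" "disjoint F" "\<Union>F = A" "\<forall>X\<in>F. \<exists>p. trim X p"
    by blast
  moreover have "disjoint (insert X F)"
    using F decomp_insert by (auto simp: pairwise_insert disjnt_def)
  ultimately show ?case
    using decomp_insert by (intro exI[of _ "insert X F"]) auto
qed (auto intro: exI[of _ "{}"])

text \<open>
  The labels generalise isomorphism types of pseudo-indecomposable sets, and \<open>trim A p\<close>
  says that \<open>A\<close> carries the label \<open>p\<close>. When a set is cut in two, its label
  survives on one side and all labels on the other side are strictly above it
  (\<open>trim_split\<close>); conversely, everything strictly above the label can be cut off
  without changing it (\<open>trim_absorb\<close>). A reflexive label is strictly above itself and
  can therefore occur on both sides. These conditions suffice for the label to determine the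
  isomorphism type.
\<close>

locale labelled = stone W for W :: "'a topology" +
  fixes P :: "'p po_system" and trim :: "'a set \<Rightarrow> 'p \<Rightarrow> bool"
  assumes countable_Co: "countable (Co W)"
    and po: "po_system P"
    and trim_Co: "trim A p \<Longrightarrow> A \<in> Co W"
    and trim_ne: "trim A p \<Longrightarrow> A \<noteq> {}"
    and trim_point: "trim A p \<Longrightarrow> p \<in> points P"
    and trim_unique: "trim A p \<Longrightarrow> trim A q \<Longrightarrow> p = q"
    and decomposable: "A \<in> Co W \<Longrightarrow> \<exists>M. decomp trim A M"
    and trim_split: "trim A p \<Longrightarrow> B \<in> Co W \<Longrightarrow> B \<subseteq> A \<Longrightarrow>
      trim B p \<and> (\<forall>D q. trim D q \<longrightarrow> D \<subseteq> A - B \<longrightarrow> (p, q) \<in> less_rel P) \<or>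
      trim (A - B) p \<and> (\<forall>D q. trim D q \<longrightarrow> D \<subseteq> B \<longrightarrow> (p, q) \<in> less_rel P)"
    and trim_absorb: "trim A p \<Longrightarrow> (p, q) \<in> less_rel P \<Longrightarrow> \<exists>B\<subseteq>A. trim B q \<and> trim (A - B) p"
begin

abbreviation less (infix \<open>\<prec>\<^sub>P\<close> 50) where "p \<prec>\<^sub>P q \<equiv> (p, q) \<in> less_rel P"
abbreviation leq (infix \<open>\<preceq>\<^sub>P\<close> 50) where "p \<preceq>\<^sub>P q \<equiv> po_le P p q"

lemma less_trans: "p \<prec>\<^sub>P q \<Longrightarrow> q \<prec>\<^sub>P r \<Longrightarrow> p \<prec>\<^sub>P r"
  using po unfolding po_system_def trans_def by blast

lemma leq_refl: "p \<preceq>\<^sub>P p"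
  by (simp add: po_le_def)

lemma leq_less_trans: "p \<preceq>\<^sub>P q \<Longrightarrow> q \<prec>\<^sub>P r \<Longrightarrow> p \<prec>\<^sub>P r"
  unfolding po_le_def using less_trans by blast

lemma leq_trans: "p \<preceq>\<^sub>P q \<Longrightarrow> q \<preceq>\<^sub>P r \<Longrightarrow> p \<preceq>\<^sub>P r"
  unfolding po_le_def using less_trans by blast

lemma leq_antisym: "p \<preceq>\<^sub>P q \<Longrightarrow> q \<preceq>\<^sub>P p \<Longrightarrow> p = q"
  using po unfolding po_system_def antisym_def po_le_def by blast

lemma decomp_Co: "decomp trim A M \<Longrightarrow> A \<in> Co W"
  by (induction rule: decomp.induct) (auto simp: trim_Co)

lemma decomp_empty_iff: "decomp trim A M \<Longrightarrow> A = {} \<longleftrightarrow> M = {#}"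
  by (induction rule: decomp.induct) (auto dest: trim_ne)

lemma decomp_labels: "decomp trim A M \<Longrightarrow> p \<in># M \<Longrightarrow> p \<in> points P"
  using decomp_mem[of trim A M p] trim_point by auto

lemma trim_split_cases:
  assumes "trim A p" "B \<in> Co W"
  shows "trim (A \<inter> B) p \<or> trim (A - B) p"
proof -
  have "A - A \<inter> B = A - B" by auto
  then show ?thesis
    using trim_split[OF assms(1), of "A \<inter> B"] trim_Co[OF assms(1)] assms(2) by auto
qed

lemma label_mono:
  assumes A: "trim A p" and B: "trim B q" and sub: "B \<subseteq> A"
  shows "p \<preceq>\<^sub>P q"
  using trim_split[OF A trim_Co[OF B] sub]
proof (elim disjE conjE)
  assume "trim B p"
  then show ?thesis
    using trim_unique[OF _ B] by (simp add: po_le_def)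
next
  assume "\<forall>D q. trim D q \<longrightarrow> D \<subseteq> B \<longrightarrow> p \<prec>\<^sub>P q"
  then show ?thesis
    using B by (simp add: po_le_def)
qed

text \<open>Cutting off one copy leaves only labels strictly above \<open>p\<close>, and \<open>p\<close> is not among them.\<close>

lemma irrefl_label_once:
  assumes "trim A p" "\<not> p \<prec>\<^sub>P p" "trim B p" "B \<subseteq> A" "trim C p" "C \<subseteq> A"
  shows "B \<inter> C \<noteq> {}"
proof
  assume "B \<inter> C = {}"
  then have "C \<subseteq> A - B"
    using assms(6) by auto
  with trim_split[OF assms(1) trim_Co[OF assms(3)] assms(4)] show False
  proof (elim disjE conjE)
    assume "\<forall>D q. trim D q \<longrightarrow> D \<subseteq> A - B \<longrightarrow> p \<prec>\<^sub>P q"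
    then show False
      using \<open>C \<subseteq> A - B\<close> assms(2,5) by simp
  next
    assume "\<forall>D q. trim D q \<longrightarrow> D \<subseteq> B \<longrightarrow> p \<prec>\<^sub>P q"
    then show False
      using assms(2,3) by simp
  qed
qed

text \<open>
  If \<open>B\<close> is cut along the pieces of \<open>A\<close> in turn, its label survives in one
  of the intersections.
\<close>

lemma decomp_label_below:
  "decomp trim A M \<Longrightarrow> trim B p \<Longrightarrow> B \<subseteq> A \<Longrightarrow> \<exists>q\<in>#M. q \<preceq>\<^sub>P p"
proof (induction arbitrary: B rule: decomp.induct)
  case decomp_empty
  then show ?case using trim_ne by auto
next
  case (decomp_insert X q A M)
  from trim_split_cases[OF decomp_insert(5) trim_Co[OF decomp_insert(1)]]
  show ?case
  proof
    assume "trim (B \<inter> X) p"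
    then show ?case
      using label_mono[OF decomp_insert(1), of "B \<inter> X" p] by auto
  next
    assume "trim (B - X) p"
    moreover have "B - X \<subseteq> A"
      using decomp_insert by auto
    ultimately obtain r where "r \<in># M" "r \<preceq>\<^sub>P p"
      using decomp_insert(4) by blast
    then show ?case by auto
  qed
qed

text \<open>
  Labels above \<open>p\<close> are cut off one after the other, since the rest carries
  \<open>p\<close> again.
\<close>

lemma absorb_labels:
  assumes "trim A p" "\<forall>q\<in>#M. p \<prec>\<^sub>P q"
  shows "\<exists>B\<subseteq>A. decomp trim B M \<and> trim (A - B) p"
  using assms(2)
proof (induction M)
  case empty
  show ?case using assms(1) decomp_empty by (intro exI[of _ "{}"]) auto
next
  case (add q M)
  then obtain B where B: "B \<subseteq> A" "decomp trim B M" "trim (A - B) p"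
    by auto
  then obtain C where C: "C \<subseteq> A - B" "trim C q" "trim (A - B - C) p"
    using trim_absorb[of "A - B" p q] add by auto
  have "decomp trim (C \<union> B) (add_mset q M)"
    using C B by (intro decomp_insert) auto
  moreover have "A - (C \<union> B) = A - B - C"
    by auto
  ultimately show ?case
    using B C by (intro exI[of _ "C \<union> B"]) auto
qed

end

subsection \<open>Two spaces with the same labels\<close>

locale labelled_pair =
  left: labelled W P trim + right: labelled W' P trim'
  for W :: "'a topology" and W' :: "'b topology" and P :: "'p po_system" and trim trim'
begin

text \<open>
  The relation to be used for the back-and-forth construction.
\<close>

definition common :: "'a set \<Rightarrow> 'b set \<Rightarrow> bool" where
  "common A B \<longleftrightarrow> (\<exists>M. decomp trim A M \<and> decomp trim' B M)"

lemma common_empty: "common {} {}"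
  unfolding common_def using decomp_empty[of trim] decomp_empty[of trim'] by auto

lemma common_single: "trim X p \<Longrightarrow> trim' Y p \<Longrightarrow> common X Y"
  unfolding common_def using decomp_single[of trim X p] decomp_single[of trim' Y p] by auto

lemma common_Co: "common A B \<Longrightarrow> A \<in> Co W \<and> B \<in> Co W'"
  using left.decomp_Co right.decomp_Co by (auto simp: common_def)

lemma common_empty_iff: "common A B \<Longrightarrow> A = {} \<longleftrightarrow> B = {}"
  unfolding common_def by (metis left.decomp_empty_iff right.decomp_empty_iff)

lemma common_Un:
  assumes "common A B" "common C D" and disj: "A \<inter> C = {}" "B \<inter> D = {}"
  shows "common (A \<union> C) (B \<union> D)"
proof -
  obtain M N where "decomp trim A M" "decomp trim' B M" "decomp trim C N" "decomp trim' D N"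
    using assms(1,2) by (auto simp: common_def)
  then have "decomp trim (A \<union> C) (M + N)" "decomp trim' (B \<union> D) (M + N)"
    using disj by (simp_all add: decomp_Un)
  then show ?thesis by (auto simp: common_def)
qed

text \<open>
  The part of \<open>X\<close> that loses the label is decomposed into labels above
  \<open>p\<close>; these are cut off from \<open>Y\<close>, and what remains of \<open>Y\<close>
  matches the part of \<open>X\<close> that keeps the label.
\<close>

lemma common_split_trim:
  assumes X: "trim X p" and Y: "trim' Y p" and C: "C \<in> Co W" "C \<subseteq> X"
  shows "\<exists>D\<subseteq>Y. common C D \<and> common (X - C) (Y - D)"
proof -
  have transfer: "\<exists>D\<subseteq>Y. common Z D \<and> trim' (Y - D) p"
    if Z: "Z \<in> Co W" "\<forall>D q. trim D q \<longrightarrow> D \<subseteq> Z \<longrightarrow> (p, q) \<in> less_rel P" for Z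
  proof -
    obtain M where M: "decomp trim Z M"
      using left.decomposable[OF Z(1)] by auto
    then have "\<forall>q\<in>#M. (p, q) \<in> less_rel P"
      using Z(2) decomp_mem[OF M] by metis
    then show ?thesis
      using right.absorb_labels[OF Y, of M] M unfolding common_def by blast
  qed
  from left.trim_split[OF X C] show ?thesis
  proof (elim disjE conjE)
    assume *: "trim C p" "\<forall>D q. trim D q \<longrightarrow> D \<subseteq> X - C \<longrightarrow> (p, q) \<in> less_rel P"
    then obtain D where D: "D \<subseteq> Y" "common (X - C) D" "trim' (Y - D) p"
      using transfer[of "X - C"] left.trim_Co[OF X] C by auto
    moreover have "Y - (Y - D) = D"
      using D by auto
    ultimately show ?thesis
      using common_single[OF *(1) D(3)] by (intro exI[of _ "Y - D"]) auto
  next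
    assume *: "trim (X - C) p" "\<forall>D q. trim D q \<longrightarrow> D \<subseteq> C \<longrightarrow> (p, q) \<in> less_rel P"
    then obtain D where "D \<subseteq> Y" "common C D" "trim' (Y - D) p"
      using transfer[of C] C by auto
    then show ?thesis
      using common_single[OF *(1), of "Y - D"] by (intro exI[of _ D]) auto
  qed
qed

lemma common_split:
  assumes "common A B" "C \<in> Co W" "C \<subseteq> A"
  shows "\<exists>D\<subseteq>B. common C D \<and> common (A - C) (B - D)"
proof -
  obtain M where "decomp trim A M" "decomp trim' B M"
    using assms(1) by (auto simp: common_def)
  then show ?thesis
    using assms(2,3)
  proof (induction arbitrary: B C rule: decomp.induct)
    case decomp_empty
    then have "B = {}" using right.decomp_empty_iff[of B "{#}"] by simp
    then show ?case using decomp_empty common_empty by auto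
  next
    case (decomp_insert X p A M)
    then obtain Y where Y: "Y \<subseteq> B" "trim' Y p" "decomp trim' (B - Y) M"
      using decomp_pick[of trim' B "add_mset p M" p] by auto
    have Co: "C \<inter> X \<in> Co W" "C \<inter> A \<in> Co W"
      using decomp_insert left.trim_Co left.decomp_Co by auto
    obtain D1 where D1: "D1 \<subseteq> Y" "common (C \<inter> X) D1" "common (X - C \<inter> X) (Y - D1)"
      using common_split_trim[OF decomp_insert(1) Y(2) Co(1)] by auto
    obtain D2 where D2: "D2 \<subseteq> B - Y" "common (C \<inter> A) D2" "common (A - C \<inter> A) (B - Y - D2)"
      using decomp_insert(4)[OF Y(3) Co(2)] by auto
    have "common (C \<inter> X \<union> C \<inter> A) (D1 \<union> D2)"
      using common_Un[OF D1(2) D2(2)] D1 D2 decomp_insert(3) by auto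
    moreover have "C \<inter> X \<union> C \<inter> A = C"
      using decomp_insert by auto
    moreover have "common ((X - C \<inter> X) \<union> (A - C \<inter> A)) ((Y - D1) \<union> (B - Y - D2))"
      using common_Un[OF D1(3) D2(3)] D1 D2 decomp_insert(3) by auto
    moreover have "(X - C \<inter> X) \<union> (A - C \<inter> A) = (X \<union> A) - C"
      by auto
    moreover have "(Y - D1) \<union> (B - Y - D2) = B - (D1 \<union> D2)"
      using D1 D2 Y by auto
    ultimately show ?case
      using D1 D2 Y by (intro exI[of _ "D1 \<union> D2"]) auto
  qed
qed

end

lemma labelled_pair_swap:
  assumes "labelled_pair W W' P trim trim'"
  shows "labelled_pair W' W P trim' trim"
  using assms by (simp add: labelled_pair_def)

context labelled_pair
begin

lemma common_split':
  assumes "common A B" "D \<in> Co W'" "D \<subseteq> B"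
  shows "\<exists>C\<subseteq>A. common C D \<and> common (A - C) (B - D)"
proof -
  interpret swap: labelled_pair W' W P trim' trim
    by (rule labelled_pair_swap) (rule labelled_pair_axioms)
  have "swap.common Y X \<longleftrightarrow> common X Y" for X Y
    by (auto simp: common_def swap.common_def)
  then show ?thesis
    using swap.common_split[of B A D] assms by simp
qed

text \<open>
  Within \<open>A\<close> and \<open>B\<close> the initial pair is already everything, so only
  cutting is involved.
\<close>

lemma common_iso:
  assumes "common A B"
  shows "\<exists>\<phi>. set_ring_iso \<phi> (Co_below W A) (Co_below W' B)"
proof -
  define E where "E = (\<lambda>X Y. X \<subseteq> A \<and> Y \<subseteq> B \<and> common X Y)"
  interpret back_and_forth "Co_below W A" "Co_below W' B" E A B
  proof
    show "set_ring (Co_below W A)" "set_ring (Co_below W' B)"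
      by (rule left.set_ring_Co_below, rule right.set_ring_Co_below)
    show "countable (Co_below W A)" "countable (Co_below W' B)"
      using left.countable_Co right.countable_Co
      by (auto intro: countable_subset[of _ "Co W"] countable_subset[of _ "Co W'"] simp: Co_below_def)
    show "X \<in> Co_below W A \<and> Y \<in> Co_below W' B" if "E X Y" for X Y
      using that common_Co by (auto simp: E_def Co_below_def)
    show "X = {} \<longleftrightarrow> Y = {}" if "E X Y" for X Y
      using that common_empty_iff by (auto simp: E_def)
    show "E (X \<union> X') (Y \<union> Y')" if "E X Y" "E X' Y'" "X \<inter> X' = {}" "Y \<inter> Y' = {}" for X Y X' Y'
      using that common_Un by (auto simp: E_def)
    show "\<exists>D\<subseteq>Y. E C D \<and> E (X - C) (Y - D)" if XY: "E X Y" "C \<in> Co_below W A" "C \<subseteq> X" for X Y C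
    proof -
      obtain D where "D \<subseteq> Y" "common C D \<and> common (X - C) (Y - D)"
        using common_split[of X Y C] XY by (auto simp: E_def Co_below_def)
      then show ?thesis using XY by (intro exI[of _ D]) (auto simp: E_def)
    qed
    show "\<exists>C\<subseteq>X. E C D \<and> E (X - C) (Y - D)" if XY: "E X Y" "D \<in> Co_below W' B" "D \<subseteq> Y" for X Y D
    proof -
      obtain C where "C \<subseteq> X" "common C D \<and> common (X - C) (Y - D)"
        using common_split'[of X Y D] XY by (auto simp: E_def Co_below_def)
      then show ?thesis using XY by (intro exI[of _ C]) (auto simp: E_def)
    qed
    show "E A B" using assms by (simp add: E_def)
    show "\<exists>Y. Y \<inter> V = {} \<and> E X Y"
      if "A \<subseteq> U" "X \<in> Co_below W A" "X \<inter> U = {}" for U V X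
    proof -
      have "X = {}"
        using that by (auto simp: Co_below_def)
      then show ?thesis
        using common_empty by (intro exI[of _ "{}"]) (simp add: E_def)
    qed
    show "\<exists>X. X \<inter> U = {} \<and> E X Y"
      if "B \<subseteq> V" "Y \<in> Co_below W' B" "Y \<inter> V = {}" for U V Y
    proof -
      have "Y = {}"
        using that by (auto simp: Co_below_def)
      then show ?thesis
        using common_empty by (intro exI[of _ "{}"]) (simp add: E_def)
    qed
  qed
  show ?thesis by (rule set_ring_iso_exists)
qed

end

context stone
begin

lemma PI_iff:
  "pseudo_indecomposable W A \<longleftrightarrow>
    A \<in> Co W \<and> A \<noteq> {} \<and> (\<forall>B\<in>Co W. B \<subseteq> A \<longrightarrow> B \<sim> A \<or> A - B \<sim> A)"
  unfolding pseudo_indecomposable_def using Co_ring_iso_iff by (metis Co_Diff)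

end

context labelled
begin

theorem decomp_equiv:
  assumes "decomp trim A M" "decomp trim B M"
  shows "A \<sim> B"
proof -
  interpret labelled_pair W W P trim trim
    by unfold_locales
  show ?thesis
    using common_iso[of A B] assms decomp_Co by (auto simp: common_def co_equiv_def)
qed

lemma trim_equiv: "trim A p \<Longrightarrow> trim B p \<Longrightarrow> A \<sim> B"
  using decomp_equiv[OF decomp_single decomp_single, of A p B] by simp

lemma trim_PI: "trim A p \<Longrightarrow> pseudo_indecomposable W A"
  unfolding PI_iff using trim_Co trim_ne trim_split trim_equiv by metis

end

section \<open>Points carrying a label\<close>

context labelled
begin

definition label_points :: "'p \<Rightarrow> 'a set" where
  "label_points p = {x \<in> topspace W. neighbourhood_base_at x (\<lambda>A. trim A p) W}"

definition compact_labels :: "'p set" where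
  "compact_labels = {p \<in> points P. compactin W (W closure_of label_points p)}"

definition label_count :: "'p \<Rightarrow> nat" where
  "label_count p = card (label_points p)"

lemma label_points_topspace: "label_points p \<subseteq> topspace W"
  by (auto simp: label_points_def)

lemma label_pointsD:
  assumes "x \<in> label_points p" "openin W U" "x \<in> U"
  shows "\<exists>A. trim A p \<and> x \<in> A \<and> A \<subseteq> U"
  using assms unfolding label_points_def neighbourhood_base_at_def by blast

lemma label_pointsI:
  assumes "x \<in> topspace W" "\<And>U. openin W U \<Longrightarrow> x \<in> U \<Longrightarrow> \<exists>A. trim A p \<and> x \<in> A \<and> A \<subseteq> U"
  shows "x \<in> label_points p"
  unfolding label_points_def neighbourhood_base_at_def
proof (intro CollectI conjI allI impI)
  fix U assume "openin W U \<and> x \<in> U"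
  then obtain A where "trim A p" "x \<in> A" "A \<subseteq> U"
    using assms(2) by auto
  then show "\<exists>V A. openin W V \<and> trim A p \<and> x \<in> V \<and> V \<subseteq> A \<and> A \<subseteq> U"
    using Co_openin[OF trim_Co] by (intro exI[of _ A]) auto
qed (rule assms(1))

text \<open>
  For each compact open \<open>C\<close> the label survives on \<open>C\<close> or on its
  complement. Deciding all \<open>C\<close> in turn, which is possible since there are countably
  many, gives a decreasing sequence of sets with label \<open>p\<close> that shrinks to a point.
\<close>

lemma trim_has_label_point:
  assumes A: "trim A p"
  shows "\<exists>x\<in>A. x \<in> label_points p"
proof -
  define e where "e = from_nat_into (Co W)"
  have ne: "Co W \<noteq> {}"
    using trim_Co[OF A] by auto
  have e: "e n \<in> Co W" for n
    using from_nat_into[OF ne] by (simp add: e_def)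
  \<comment> \<open>\<open>S (Suc n)\<close> decides the \<open>n\<close>-th compact open set.\<close>
  define S where "S = rec_nat A (\<lambda>n X. if trim (X \<inter> e n) p then X \<inter> e n else X - e n)"
  have S0: "S 0 = A" and SSuc: "S (Suc n) = (if trim (S n \<inter> e n) p then S n \<inter> e n else S n - e n)" for n
    by (simp_all add: S_def)
  have S: "trim (S n) p" for n
  proof (induction n)
    case (Suc n)
    then show ?case
      using trim_split_cases[OF Suc e[of n]] by (auto simp: SSuc)
  qed (simp add: S0 A)
  have dec: "S (n + k) \<subseteq> S n" for n k
    by (induction k) (auto simp: SSuc)
  have "\<exists>C\<in>range S. C \<subseteq> X \<inter> Y" if XY: "X \<in> range S" "Y \<in> range S" for X Y
  proof -
    obtain m n where "X = S m" "Y = S n"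
      using XY by auto
    then show ?thesis
      using dec[of m n] dec[of n m] by (intro bexI[of _ "S (m + n)"]) (auto simp: add.commute)
  qed
  moreover have "range S \<subseteq> Co W" "range S \<noteq> {}" "{} \<notin> range S"
    using trim_Co[OF S] trim_ne[OF S] by auto
  ultimately obtain x where x: "x \<in> topspace W" "\<And>X. X \<in> range S \<Longrightarrow> x \<in> X"
    using filter_has_point[of "range S"] by metis
  have "x \<in> label_points p"
  proof (rule label_pointsI[OF x(1)])
    fix U assume U: "openin W U" "x \<in> U"
    obtain C where C: "C \<in> Co W" "x \<in> C" "C \<subseteq> U"
      using Co_base[OF U] .
    obtain n where n: "C = e n"
      using from_nat_into_surj[OF countable_Co C(1)] by (auto simp: e_def)
    have "x \<in> S (Suc n)" using x(2) by auto
    then have "S (Suc n) \<subseteq> C"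
      using C(2) n by (auto simp: SSuc split: if_splits)
    then show "\<exists>A. trim A p \<and> x \<in> A \<and> A \<subseteq> U"
      using S[of "Suc n"] \<open>x \<in> S (Suc n)\<close> C(3) by blast
  qed
  moreover have "x \<in> A"
    using x(2)[of "S 0"] S0 by auto
  ultimately show ?thesis by blast
qed

text \<open>
  Since every set with label \<open>p\<close> contains a point with this label, statements about the
  closure of the label points become statements about the labelled sets. This is how compactness and
  boundedness are treated from here on.
\<close>

lemma label_points_subset_iff:
  assumes K: "K \<in> Co W"
  shows "label_points p \<subseteq> K \<longleftrightarrow> (\<forall>A. trim A p \<longrightarrow> A \<inter> K \<noteq> {})"
proof
  assume *: "label_points p \<subseteq> K"
  show "\<forall>A. trim A p \<longrightarrow> A \<inter> K \<noteq> {}"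
  proof (intro allI impI)
    fix A assume "trim A p"
    then obtain x where "x \<in> A" "x \<in> label_points p"
      using trim_has_label_point by auto
    then show "A \<inter> K \<noteq> {}" using * by auto
  qed
next
  assume *: "\<forall>A. trim A p \<longrightarrow> A \<inter> K \<noteq> {}"
  show "label_points p \<subseteq> K"
  proof (rule subsetI, rule ccontr)
    fix x assume x: "x \<in> label_points p" "x \<notin> K"
    have "openin W (topspace W - K)" "x \<in> topspace W - K"
      using x label_points_topspace Co_closedin[OF K] by auto
    then obtain A where "trim A p" "A \<subseteq> topspace W - K"
      using label_pointsD[OF x(1)] by metis
    then show False
      using * by auto
  qed
qed

lemma compact_labels_iff:
  "p \<in> compact_labels \<longleftrightarrow> p \<in> points P \<and> (\<exists>K\<in>Co W. \<forall>A. trim A p \<longrightarrow> A \<inter> K \<noteq> {})"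
  by (simp add: compact_labels_def compactin_closure_iff[OF label_points_topspace]
      label_points_subset_iff cong: bex_cong)

definition bounded_labels :: bool where
  "bounded_labels \<longleftrightarrow> (\<exists>K\<in>Co W. \<forall>p\<in>compact_labels. \<forall>A. trim A p \<longrightarrow> A \<inter> K \<noteq> {})"

lemma bounded_labels_iff:
  "bounded_labels \<longleftrightarrow> compactin W (W closure_of (\<Union>p\<in>compact_labels. label_points p))"
proof -
  have "(\<Union>p\<in>compact_labels. label_points p) \<subseteq> topspace W"
    using label_points_topspace by auto
  moreover have "(\<Union>p\<in>compact_labels. label_points p) \<subseteq> K \<longleftrightarrow>
      (\<forall>p\<in>compact_labels. \<forall>A. trim A p \<longrightarrow> A \<inter> K \<noteq> {})" if "K \<in> Co W" for K
    by (simp add: UN_subset_iff label_points_subset_iff[OF that])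
  ultimately show ?thesis
    unfolding bounded_labels_def by (simp add: compactin_closure_iff)
qed

lemma trim_contains_above:
  assumes "trim A q" "q \<preceq>\<^sub>P p"
  shows "\<exists>B\<subseteq>A. trim B p"
proof (cases "q = p")
  case True
  then show ?thesis using assms(1) by auto
next
  case False
  then have "q \<prec>\<^sub>P p" using assms(2) by (simp add: po_le_def)
  then show ?thesis using trim_absorb[OF assms(1)] by metis
qed

text \<open>
  Otherwise \<open>A - K\<close> would carry \<open>q\<close> and hence contain a set with label
  \<open>p\<close> that misses \<open>K\<close>.
\<close>

lemma trim_Int_confining:
  assumes K: "K \<in> Co W" "\<forall>A. trim A p \<longrightarrow> A \<inter> K \<noteq> {}" and A: "trim A q" "q \<preceq>\<^sub>P p"
  shows "trim (A \<inter> K) q"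
proof (rule ccontr)
  assume "\<not> trim (A \<inter> K) q"
  then have "trim (A - K) q"
    using trim_split_cases[OF A(1) K(1)] by simp
  then obtain B where "B \<subseteq> A - K" "trim B p"
    using trim_contains_above[OF _ A(2), of "A - K"] by auto
  then show False
    using K(2) by auto
qed

lemma compact_labels_lower:
  assumes "p \<in> compact_labels" "q \<in> points P" "q \<preceq>\<^sub>P p"
  shows "q \<in> compact_labels"
proof -
  obtain K where K: "K \<in> Co W" "\<forall>A. trim A p \<longrightarrow> A \<inter> K \<noteq> {}"
    using assms(1) by (auto simp: compact_labels_iff)
  have "A \<inter> K \<noteq> {}" if "trim A q" for A
    using trim_ne[OF trim_Int_confining[OF K that assms(3)]] .
  then show ?thesis
    using K(1) assms(2) by (auto simp: compact_labels_iff)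
qed

text \<open>
  Two distinct points with label \<open>p\<close> in \<open>X\<close> would have disjoint
  neighbourhoods with label \<open>p\<close>, which is impossible for an irreflexive label.
\<close>

lemma label_points_Int_trim:
  assumes X: "trim X r" and p: "\<not> p \<prec>\<^sub>P p" and r: "r \<preceq>\<^sub>P p \<Longrightarrow> r = p"
  shows "finite (label_points p \<inter> X) \<and> card (label_points p \<inter> X) = (if r = p then 1 else 0)"
proof (cases "r = p")
  case False
  have "label_points p \<inter> X = {}"
  proof (rule equals0I)
    fix x assume "x \<in> label_points p \<inter> X"
    then obtain B where "trim B p" "B \<subseteq> X"
      using label_pointsD[OF _ Co_openin[OF trim_Co[OF X]], of x p] by auto
    then show False
      using label_mono[OF X] r False by auto
  qed
  then show ?thesis using False by simp
next
  case True
  obtain x where x: "x \<in> X" "x \<in> label_points p"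
    using trim_has_label_point X True by auto
  have "y = x" if y: "y \<in> X" "y \<in> label_points p" for y
  proof (rule ccontr)
    assume "y \<noteq> x"
    then obtain C where C: "C \<in> Co W" "x \<in> C" "y \<notin> C"
      using Co_separates x(2) y(2) label_points_topspace by (metis subsetD)
    obtain B where B: "trim B p" "B \<subseteq> X \<inter> C"
      using label_pointsD[OF x(2) Co_openin, of "X \<inter> C"] x C trim_Co[OF X] by auto
    obtain D where D: "trim D p" "D \<subseteq> X - C"
      using label_pointsD[OF y(2) Co_openin, of "X - C"] y C trim_Co[OF X] by auto
    have "B \<inter> D \<noteq> {}"
      using irrefl_label_once[of X p B D] X True p B D by auto
    then show False
      using B D by auto
  qed
  then have "label_points p \<inter> X = {x}"
    using x by blast
  then show ?thesis using True by simp
qed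

lemma card_label_points_Int:
  assumes "decomp trim A M" "\<not> p \<prec>\<^sub>P p" "\<forall>r\<in>#M. r \<preceq>\<^sub>P p \<longrightarrow> r = p"
  shows "finite (label_points p \<inter> A) \<and> card (label_points p \<inter> A) = count M p"
  using assms
proof (induction rule: decomp.induct)
  case (decomp_insert X r A M)
  have X: "finite (label_points p \<inter> X) \<and> card (label_points p \<inter> X) = (if r = p then 1 else 0)"
    using label_points_Int_trim[OF decomp_insert(1,5)] decomp_insert(6) by auto
  have A: "finite (label_points p \<inter> A) \<and> card (label_points p \<inter> A) = count M p"
    using decomp_insert by auto
  have "label_points p \<inter> (X \<union> A) = (label_points p \<inter> X) \<union> (label_points p \<inter> A)"
    by auto
  moreover have "(label_points p \<inter> X) \<inter> (label_points p \<inter> A) = {}"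
    using decomp_insert(3) by auto
  ultimately show ?case
    using X A by (simp add: card_Un_disjoint)
qed simp

text \<open>
  For a minimal irreflexive label the number of points is the number of pieces with this label in
  any decomposition of a set that meets all its occurrences. So the weight \<open>f\<close> of the
  classification can be read off from decompositions.
\<close>

lemma label_count_eq:
  assumes K: "decomp trim K M" "\<forall>A. trim A p \<longrightarrow> A \<inter> K \<noteq> {}"
    and p: "\<not> p \<prec>\<^sub>P p" "\<forall>r\<in>#M. r \<preceq>\<^sub>P p \<longrightarrow> r = p"
  shows "label_count p = count M p" "finite (label_points p)"
proof -
  have "label_points p \<inter> K = label_points p"
    using label_points_subset_iff[OF decomp_Co[OF K(1)]] K(2) by auto
  then show "label_count p = count M p" "finite (label_points p)"
    using card_label_points_Int[OF K(1) p] by (simp_all add: label_count_def)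
qed

lemma minimal_irrefl_iff:
  "p \<in> minimal_irrefl_points P compact_labels \<longleftrightarrow>
    p \<in> compact_labels \<and> \<not> p \<prec>\<^sub>P p \<and> (\<forall>r\<in>points P. r \<preceq>\<^sub>P p \<longrightarrow> r = p)"
proof -
  have "(\<forall>r\<in>compact_labels. r \<preceq>\<^sub>P p \<longrightarrow> r = p) \<longleftrightarrow> (\<forall>r\<in>points P. r \<preceq>\<^sub>P p \<longrightarrow> r = p)"
    if "p \<in> compact_labels"
    using compact_labels_lower[OF that] compact_labels_iff by metis
  moreover have "compact_labels \<subseteq> points P"
    using compact_labels_iff by auto
  ultimately show ?thesis
    unfolding minimal_irrefl_points_def minimal_points_def irrefl_points_def by auto
qed

end

subsection \<open>Every label occurs\<close>

locale labelled_full = labelled +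
  assumes label_occurs: "p \<in> points P \<Longrightarrow> \<exists>A. trim A p"
begin

lemma compact_labels_lower_subset: "lower_subset P compact_labels"
proof -
  have sub: "compact_labels \<subseteq> points P"
    by (auto simp: compact_labels_iff)
  moreover have "compact_labels \<subseteq> down_set P compact_labels"
    using sub leq_refl by (auto simp: down_set_def)
  moreover have "down_set P compact_labels \<subseteq> compact_labels"
    using compact_labels_lower by (auto simp: down_set_def)
  ultimately show ?thesis
    by (auto simp: lower_subset_def)
qed

text \<open>
  Every label below \<open>S\<close> already occurs inside \<open>K\<close>, hence lies above one of
  the finitely many labels of a decomposition of \<open>K\<close>.
\<close>

lemma finite_foundation_of_confining:
  assumes S: "S \<subseteq> points P" and K: "decomp trim K M" "\<forall>p\<in>S. \<forall>A. trim A p \<longrightarrow> A \<inter> K \<noteq> {}"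
  shows "finite_foundation P {r \<in> set_mset M. r \<in> down_set P S} S"
  unfolding finite_foundation_def
proof (intro conjI subsetI)
  fix q assume q: "q \<in> down_set P S"
  then obtain p where p: "p \<in> S" "q \<preceq>\<^sub>P p" and qP: "q \<in> points P"
    by (auto simp: down_set_def)
  obtain A where A: "trim A q"
    using label_occurs[OF qP] by auto
  have "trim (A \<inter> K) q"
    using trim_Int_confining[OF decomp_Co[OF K(1)] _ A p(2)] K(2) p(1) by auto
  then obtain r where r: "r \<in># M" "r \<preceq>\<^sub>P q"
    using decomp_label_below[OF K(1), of "A \<inter> K" q] by auto
  then have "r \<in> down_set P S"
    using decomp_labels[OF K(1)] leq_trans[OF r(2) p(2)] p(1) by (auto simp: down_set_def)
  then show "q \<in> up_set P {r \<in> set_mset M. r \<in> down_set P S}"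
    using r qP by (auto simp: up_set_def)
qed auto

lemma compact_labels_Delta: "compact_labels \<subseteq> Delta_points P"
proof
  fix p assume p: "p \<in> compact_labels"
  then obtain K where K: "K \<in> Co W" "\<forall>A. trim A p \<longrightarrow> A \<inter> K \<noteq> {}" and pP: "p \<in> points P"
    by (auto simp: compact_labels_iff)
  obtain M where "decomp trim K M"
    using decomposable[OF K(1)] by auto
  then have "has_finite_foundation P {p}"
    unfolding has_finite_foundation_def
    using finite_foundation_of_confining[of "{p}" K M] K(2) pP by auto
  then show "p \<in> Delta_points P"
    using pP by (simp add: Delta_points_def)
qed

lemma label_count_pos: "pos_weight P compact_labels label_count"
  unfolding pos_weight_def
proof
  fix p assume "p \<in> minimal_irrefl_points P compact_labels"
  then have p: "p \<in> compact_labels" "\<not> p \<prec>\<^sub>P p" "\<forall>r\<in>points P. r \<preceq>\<^sub>P p \<longrightarrow> r = p"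
    by (auto simp: minimal_irrefl_iff)
  then obtain K where K: "K \<in> Co W" "\<forall>A. trim A p \<longrightarrow> A \<inter> K \<noteq> {}" and pP: "p \<in> points P"
    by (auto simp: compact_labels_iff)
  obtain M where M: "decomp trim K M"
    using decomposable[OF K(1)] by auto
  have "\<forall>r\<in>#M. r \<preceq>\<^sub>P p \<longrightarrow> r = p"
    using p(3) decomp_labels[OF M] by auto
  then have "finite (label_points p)"
    using label_count_eq(2)[OF M K(2) p(2)] by simp
  moreover have "label_points p \<noteq> {}"
    using label_occurs[OF pP] trim_has_label_point by blast
  ultimately show "label_count p > 0"
    by (simp add: label_count_def card_gt_0_iff)
qed

theorem extended: "extended_po_system P compact_labels label_count"
  unfolding extended_po_system_def
  using po compact_labels_lower_subset compact_labels_Delta label_count_pos by auto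

lemma bounded_labels_foundation:
  assumes "bounded_labels"
  shows "has_finite_foundation P compact_labels"
proof -
  obtain K where K: "K \<in> Co W" "\<forall>p\<in>compact_labels. \<forall>A. trim A p \<longrightarrow> A \<inter> K \<noteq> {}"
    using assms by (auto simp: bounded_labels_def)
  obtain M where "decomp trim K M"
    using decomposable[OF K(1)] by auto
  then show ?thesis
    unfolding has_finite_foundation_def
    using finite_foundation_of_confining[of compact_labels K M] K(2) compact_labels_iff by auto
qed

lemma finite_labels_bounded:
  assumes "finite (points P)"
  shows "bounded_labels"
proof -
  have fin: "finite compact_labels"
    using assms by (rule finite_subset[rotated]) (auto simp: compact_labels_iff)
  obtain K where K: "\<forall>p\<in>compact_labels. K p \<in> Co W \<and> (\<forall>A. trim A p \<longrightarrow> A \<inter> K p \<noteq> {})"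
    using compact_labels_iff by metis
  have "\<Union>(K ` compact_labels) \<in> Co W"
    using fin K by (intro Co_Union) auto
  moreover have "A \<inter> \<Union>(K ` compact_labels) \<noteq> {}" if "p \<in> compact_labels" "trim A p" for p A
    using K that by blast
  ultimately show ?thesis
    unfolding bounded_labels_def by blast
qed

lemma compact_labels_of_compact:
  assumes "compact_space W"
  shows "compact_labels = points P" "bounded_labels"
proof -
  have top: "topspace W \<in> Co W"
    using assms by (simp add: Co_def compact_space_def)
  have "A \<inter> topspace W \<noteq> {}" if "trim A p" for A p
    using trim_ne[OF that] Co_subset_topspace[OF trim_Co[OF that]] by auto
  then have *: "\<exists>K\<in>Co W. \<forall>p A. trim A p \<longrightarrow> A \<inter> K \<noteq> {}"
    using top by blast
  then show "bounded_labels"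
    unfolding bounded_labels_def by blast
  show "compact_labels = points P"
    using * compact_labels_iff by blast
qed

text \<open>
  A point outside \<open>K\<close> would have a neighbourhood that misses \<open>K\<close> and
  contains a labelled set.
\<close>

lemma compact_of_bounded:
  assumes "bounded_labels" "compact_labels = points P"
  shows "compact_space W"
proof -
  obtain K where K: "K \<in> Co W" "\<forall>p\<in>points P. \<forall>A. trim A p \<longrightarrow> A \<inter> K \<noteq> {}"
    using assms by (auto simp: bounded_labels_def)
  have "topspace W \<subseteq> K"
  proof (rule subsetI, rule ccontr)
    fix x assume x: "x \<in> topspace W" "x \<notin> K"
    then have "openin W (topspace W - K)" "x \<in> topspace W - K"
      using Co_closedin[OF K(1)] by auto
    then obtain C where C: "C \<in> Co W" "x \<in> C" "C \<subseteq> topspace W - K"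
      by (rule Co_base)
    obtain M where M: "decomp trim C M"
      using decomposable[OF C(1)] by auto
    then have "M \<noteq> {#}"
      using decomp_empty_iff[OF M] C(2) by auto
    then obtain p B where "B \<subseteq> C" "trim B p"
      using decomp_mem[OF M] by (meson multiset_nonemptyE)
    then show False
      using K(2) trim_point C(3) by blast
  qed
  then show ?thesis
    using Co_compactin[OF K(1)] Co_subset_topspace[OF K(1)]
    by (metis compact_space_def subset_antisym)
qed

end

section \<open>Changing the labels\<close>

lemma decomp_image:
  "decomp trim A M \<Longrightarrow> decomp (\<lambda>A q. \<exists>p. trim A p \<and> q = \<beta> p) A (image_mset \<beta> M)"
proof (induction rule: decomp.induct)
  case (decomp_insert X p A M)
  have "\<exists>p'. trim X p' \<and> \<beta> p = \<beta> p'"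
    using decomp_insert(1) by auto
  then show ?case
    using decomp.decomp_insert[of "\<lambda>A q. \<exists>p. trim A p \<and> q = \<beta> p" X "\<beta> p" A "image_mset \<beta> M"]
      decomp_insert by simp
qed (simp add: decomp_empty)

text \<open>
  A morphism preserves the relation, as \<open>trim_split\<close> requires, and lifts relations in
  the image back to \<open>P\<close>, as \<open>trim_absorb\<close> requires.
\<close>

lemma (in labelled) labelled_image:
  assumes Q: "po_system Q" and \<beta>: "po_morphism \<beta> P Q"
  shows "labelled W Q (\<lambda>A q. \<exists>p. trim A p \<and> q = \<beta> p)"
proof
  have mem: "\<beta> p \<in> points Q" if "p \<in> points P" for p
    using \<beta> that by (auto simp: po_morphism_def)
  have img: "\<beta> ` {r \<in> points P. p \<prec>\<^sub>P r} = {q \<in> points Q. (\<beta> p, q) \<in> less_rel Q}" if "p \<in> points P" for p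
    using \<beta> that by (auto simp: po_morphism_def)
  have mono: "(\<beta> p, \<beta> r) \<in> less_rel Q" if "p \<prec>\<^sub>P r" for p r
  proof -
    have "p \<in> points P" "r \<in> points P"
      using po that by (auto simp: po_system_def)
    then show ?thesis
      using img[of p] that by auto
  qed
  show "countable (Co W)" by (rule countable_Co)
  show "po_system Q" by (rule Q)
  show "A \<in> Co W" "A \<noteq> {}" "q \<in> points Q" if "\<exists>p. trim A p \<and> q = \<beta> p" for A q
    using that trim_Co trim_ne trim_point mem by auto
  show "q = q'" if "\<exists>p. trim A p \<and> q = \<beta> p" "\<exists>p. trim A p \<and> q' = \<beta> p" for A q q'
    using that trim_unique by blast
  show "\<exists>M. decomp (\<lambda>A q. \<exists>p. trim A p \<and> q = \<beta> p) A M" if "A \<in> Co W" for A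
    using decomposable[OF that] decomp_image by blast
  show "(\<exists>p. trim B p \<and> q = \<beta> p) \<and>
      (\<forall>D r. (\<exists>p. trim D p \<and> r = \<beta> p) \<longrightarrow> D \<subseteq> A - B \<longrightarrow> (q, r) \<in> less_rel Q) \<or>
      (\<exists>p. trim (A - B) p \<and> q = \<beta> p) \<and>
      (\<forall>D r. (\<exists>p. trim D p \<and> r = \<beta> p) \<longrightarrow> D \<subseteq> B \<longrightarrow> (q, r) \<in> less_rel Q)"
    if A: "\<exists>p. trim A p \<and> q = \<beta> p" and B: "B \<in> Co W" "B \<subseteq> A" for A q B
  proof -
    obtain p where p: "trim A p" "q = \<beta> p"
      using A by auto
    show ?thesis
      using trim_split[OF p(1) B] p(2) mono by metis
  qed
  show "\<exists>B\<subseteq>A. (\<exists>p. trim B p \<and> r = \<beta> p) \<and> (\<exists>p. trim (A - B) p \<and> q = \<beta> p)"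
    if A: "\<exists>p. trim A p \<and> q = \<beta> p" and r: "(q, r) \<in> less_rel Q" for A q r
  proof -
    obtain p where p: "trim A p" "q = \<beta> p"
      using A by auto
    have "r \<in> points Q"
      using Q r by (auto simp: po_system_def)
    then obtain s where "p \<prec>\<^sub>P s" "r = \<beta> s"
      using img[OF trim_point[OF p(1)]] r p(2) by auto
    then show ?thesis
      using trim_absorb[OF p(1)] p(2) by metis
  qed
qed

text \<open>
  Sets whose labels are identified by a morphism carry the same label after pushing forward, so they
  are isomorphic and had the same label from the start.
\<close>

theorem (in labelled_full) simple_if_separated:
  assumes sep: "\<And>A B p q. trim A p \<Longrightarrow> trim B q \<Longrightarrow> A \<sim> B \<Longrightarrow> p = q"
  shows "simple_po P"
  unfolding simple_po_def
proof (intro conjI allI impI)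
  show "po_system P" by (rule po)
  fix Q :: "'b po_system" and \<beta> assume *: "po_system Q \<and> po_morphism \<beta> P Q"
  interpret image: labelled W Q "\<lambda>A q. \<exists>p. trim A p \<and> q = \<beta> p"
    using labelled_image * by blast
  show "inj_on \<beta> (points P)"
  proof (rule inj_onI)
    fix p q assume pq: "p \<in> points P" "q \<in> points P" "\<beta> p = \<beta> q"
    obtain A B where AB: "trim A p" "trim B q"
      using label_occurs[OF pq(1)] label_occurs[OF pq(2)] by auto
    then have "\<exists>p. trim A p \<and> \<beta> q = \<beta> p" "\<exists>p. trim B p \<and> \<beta> q = \<beta> p"
      using pq(3) by metis+
    then have "A \<sim> B"
      by (rule image.trim_equiv)
    then show "p = q"
      using sep[OF AB] by simp
  qed
qed

section \<open>Pseudo-indecomposable sets as labels\<close>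

context stone
begin

abbreviation PI where "PI \<equiv> pseudo_indecomposable W"

lemma PI_Co: "PI A \<Longrightarrow> A \<in> Co W"
  by (simp add: PI_iff)

lemma equiv_empty: "A \<sim> {} \<Longrightarrow> A = {}"
proof -
  assume "A \<sim> {}"
  then obtain \<phi> where A: "A \<in> Co W" and "bij_betw \<phi> (Co_below W A) (Co_below W {})"
    by (auto simp: co_equiv_def set_ring_iso_def)
  then have "inj_on \<phi> (Co_below W A)" "\<phi> ` Co_below W A = {{}}"
    by (auto simp: bij_betw_def Co_below_def)
  moreover have "A \<in> Co_below W A" "{} \<in> Co_below W A"
    using A by (auto simp: Co_below_def)
  ultimately show "A = {}"
    by (metis imageI inj_onD singletonD)
qed

lemma PI_equiv:
  assumes A: "PI A" and AB: "A \<sim> B"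
  shows "PI B"
  unfolding PI_iff
proof (intro conjI ballI impI)
  show "B \<in> Co W"
    using equiv_Co(2)[OF AB] .
  show "B \<noteq> {}"
    using equiv_empty[of A] A AB by (auto simp: PI_iff)
  fix C assume C: "C \<in> Co W" "C \<subseteq> B"
  obtain D where D: "D \<in> Co W" "D \<subseteq> A" "C \<sim> D" "B - C \<sim> A - D"
    using equiv_split[OF equiv_sym[OF AB] C] .
  have "D \<sim> A \<or> A - D \<sim> A"
    using A D(1,2) by (simp add: PI_iff)
  then show "C \<sim> B \<or> B - C \<sim> B"
    using D(3,4) AB equiv_trans by blast
qed

lemma PI_Int_or_Diff:
  assumes "PI A" "B \<in> Co W"
  shows "A \<inter> B \<sim> A \<or> A - B \<sim> A"
proof -
  have "A - A \<inter> B = A - B" "A \<inter> B \<in> Co W" "A \<inter> B \<subseteq> A"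
    using assms PI_Co by auto
  then show ?thesis
    using assms(1) unfolding PI_iff by metis
qed

text \<open>
  Of the two parts of a pseudo-indecomposable set one is isomorphic to the whole. Splitting off the
  pieces one by one therefore reaches a piece isomorphic to the whole.
\<close>

lemma PI_decomp:
  "decomp t A M \<Longrightarrow> PI A \<Longrightarrow> \<forall>X p. t X p \<longrightarrow> X \<in> Co W \<Longrightarrow> \<exists>X p. p \<in># M \<and> t X p \<and> X \<subseteq> A \<and> X \<sim> A"
proof (induction rule: decomp.induct)
  case decomp_empty
  then show ?case by (simp add: PI_iff)
next
  case (decomp_insert X p A M)
  have "X \<union> A - X = A" "(X \<union> A) \<inter> X = X"
    using decomp_insert(3) by auto
  then have "X \<sim> X \<union> A \<or> A \<sim> X \<union> A"
    using PI_Int_or_Diff[OF decomp_insert(5), of X] decomp_insert(1,6) by auto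
  then show ?case
  proof
    assume "X \<sim> X \<union> A"
    then show ?case
      using decomp_insert(1) by (intro exI[of _ X] exI[of _ p]) auto
  next
    assume eq: "A \<sim> X \<union> A"
    then obtain Y q where "q \<in># M" "t Y q" "Y \<subseteq> A" "Y \<sim> A"
      using decomp_insert(4)[OF PI_equiv[OF decomp_insert(5) equiv_sym[OF eq]] decomp_insert(6)] by auto
    then show ?case
      using equiv_trans[OF _ eq] by (intro exI[of _ Y] exI[of _ q]) auto
  qed
qed

lemma absorbs_equiv:
  assumes "absorbs A B" "A \<sim> A'" "B \<sim> B'"
  shows "absorbs A' B'"
proof -
  obtain C where C: "C \<in> Co W" "C \<subseteq> A" "C \<sim> B" "A - C \<sim> A"
    using assms(1) by (auto simp: absorbs_def)
  obtain D where D: "D \<in> Co W" "D \<subseteq> A'" "C \<sim> D" "A - C \<sim> A' - D"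
    using equiv_split[OF assms(2) C(1,2)] .
  have "D \<sim> B'"
    using equiv_trans[OF equiv_sym[OF D(3)] equiv_trans[OF C(3) assms(3)]] .
  moreover have "A' - D \<sim> A'"
    using equiv_trans[OF equiv_sym[OF D(4)] equiv_trans[OF C(4) assms(2)]] .
  ultimately show ?thesis
    using D(1,2) by (auto simp: absorbs_def)
qed

lemma absorbs_trans:
  assumes "absorbs A B" "absorbs B C"
  shows "absorbs A C"
proof -
  obtain B' where B': "B' \<in> Co W" "B' \<subseteq> A" "B' \<sim> B" "A - B' \<sim> A"
    using assms(1) by (auto simp: absorbs_def)
  have "C \<sim> C"
    using assms(2) equiv_Co equiv_refl by (auto simp: absorbs_def)
  then have "absorbs B' C"
    using absorbs_equiv[OF assms(2) equiv_sym[OF B'(3)]] by simp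
  then obtain C' where C': "C' \<in> Co W" "C' \<subseteq> B'" "C' \<sim> C" "B' - C' \<sim> B'"
    by (auto simp: absorbs_def)
  have A: "A \<in> Co W" using equiv_Co(2)[OF B'(4)] .
  have "(A - B') \<union> (B' - C') \<sim> (A - B') \<union> B'"
    using A B' C' by (intro equiv_join equiv_refl) auto
  moreover have "(A - B') \<union> (B' - C') = A - C'" "(A - B') \<union> B' = A"
    using B'(2) C'(2) by auto
  ultimately show ?thesis
    using C' B' unfolding absorbs_def by (intro bexI[of _ C']) auto
qed

text \<open>
  Both \<open>A\<close> and \<open>B\<close> are the disjoint union of a copy of \<open>A\<close>
  and a copy of \<open>B\<close>.
\<close>

lemma absorbs_antisym:
  assumes "absorbs A B" "absorbs B A"
  shows "A \<sim> B"
proof -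
  obtain B' where B': "B' \<in> Co W" "B' \<subseteq> A" "B' \<sim> B" "A - B' \<sim> A"
    using assms(1) by (auto simp: absorbs_def)
  obtain A' where A': "A' \<in> Co W" "A' \<subseteq> B" "A' \<sim> A" "B - A' \<sim> B"
    using assms(2) by (auto simp: absorbs_def)
  have "(A - B') \<union> B' \<sim> A' \<union> (B - A')"
    using equiv_trans[OF B'(4) equiv_sym[OF A'(3)]] equiv_trans[OF B'(3) equiv_sym[OF A'(4)]]
    by (intro equiv_join) auto
  moreover have "(A - B') \<union> B' = A" "A' \<union> (B - A') = B"
    using B'(2) A'(2) by auto
  ultimately show ?thesis by simp
qed

lemma PI_subset:
  assumes "PI A" "D \<in> Co W" "D \<subseteq> A"
  shows "D \<sim> A \<or> absorbs A D"
proof -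
  have "D \<sim> A \<or> A - D \<sim> A"
    using assms by (simp add: PI_iff)
  then show ?thesis
    using assms(2,3) equiv_refl[OF assms(2)] unfolding absorbs_def by blast
qed

end

text \<open>
  The function \<open>c\<close> names the isomorphism types of pseudo-indecomposable sets. Names from an arbitrary
  type make the invariants of spaces over different point types comparable.
\<close>

locale coded_primitive = stone W for W :: "'a topology" +
  fixes c :: "'a set \<Rightarrow> 'q"
  assumes countable_Co: "countable (Co W)" and primitive: "primitive_space W"
    and code: "PI A \<Longrightarrow> PI B \<Longrightarrow> c A = c B \<longleftrightarrow> A \<sim> B"
begin

definition code_po :: "'q po_system" where
  "code_po = \<lparr>points = c ` {A. PI A}, less_rel = {(c A, c B) | A B. PI A \<and> PI B \<and> absorbs A B}\<rparr>"

lemma points_code_po: "points code_po = c ` {A. PI A}"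
  by (simp add: code_po_def)

lemma code_less_iff: "PI A \<Longrightarrow> PI B \<Longrightarrow> (c A, c B) \<in> less_rel code_po \<longleftrightarrow> absorbs A B"
proof
  assume AB: "PI A" "PI B" and "(c A, c B) \<in> less_rel code_po"
  then obtain A' B' where "PI A'" "PI B'" "absorbs A' B'" "c A = c A'" "c B = c B'"
    by (auto simp: code_po_def)
  then show "absorbs A B"
    using code[of A' A] code[of B' B] AB absorbs_equiv by auto
qed (auto simp: code_po_def)

lemma code_lessE:
  assumes "(p, q) \<in> less_rel code_po"
  obtains A B where "PI A" "PI B" "c A = p" "c B = q" "absorbs A B"
  using assms by (auto simp: code_po_def)

lemma po_code_po: "po_system code_po"
  unfolding po_system_def
proof (intro conjI)
  show "less_rel code_po \<subseteq> points code_po \<times> points code_po"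
    by (auto simp: code_po_def)
  show "antisym (less_rel code_po)"
  proof (rule antisymI)
    fix p q assume pq: "(p, q) \<in> less_rel code_po" "(q, p) \<in> less_rel code_po"
    obtain A B where AB: "PI A" "PI B" "c A = p" "c B = q" "absorbs A B"
      using code_lessE[OF pq(1)] .
    then have "absorbs B A"
      using pq(2) code_less_iff[of B A] by simp
    then show "p = q"
      using absorbs_antisym[OF AB(5)] code[OF AB(1,2)] AB(3,4) by simp
  qed
  show "trans (less_rel code_po)"
  proof (rule transI)
    fix p q r assume pq: "(p, q) \<in> less_rel code_po" and qr: "(q, r) \<in> less_rel code_po"
    obtain A B where AB: "PI A" "PI B" "c A = p" "c B = q" "absorbs A B"
      using code_lessE[OF pq] .
    obtain C where C: "PI C" "c C = r"
      using code_lessE[OF qr] by metis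
    have "absorbs B C"
      using qr code_less_iff[OF AB(2) C(1)] AB(4) C(2) by simp
    then show "(p, r) \<in> less_rel code_po"
      using code_less_iff[OF AB(1) C(1)] absorbs_trans[OF AB(5)] AB(3) C(2) by simp
  qed
qed

lemma PI_subset_code:
  assumes "PI A" "PI D" "D \<subseteq> A"
  shows "po_le code_po (c A) (c D)"
  using PI_subset[OF assms(1) PI_Co[OF assms(2)] assms(3)] code[OF assms(2,1)] code_less_iff[OF assms(1,2)]
  by (auto simp: po_le_def)

lemma primitive_decomp:
  assumes t: "\<And>X. PI X \<Longrightarrow> t X (c X)" and A: "A \<in> Co W"
  shows "\<exists>M. decomp t A M"
proof -
  obtain F where "finite F" "\<forall>B\<in>F. PI B" "disjoint F" "\<Union>F = A"
    using primitive A unfolding primitive_space_def by metis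
  then show ?thesis
    using decomp_Union[of F t] t by metis
qed

subsection \<open>Sets containing two copies of themselves\<close>

text \<open>
  The type of a set that contains two disjoint copies of itself has to be a reflexive label, but it
  is not evident that such a set absorbs itself. So these types are declared reflexive in an auxiliary
  order, and a set may carry a reflexive label \<open>p\<close> if it contains a copy of \<open>p\<close> and otherwise only types
  above \<open>p\<close>. This condition survives the cutting off of a copy, which is not clear for
  pseudo-indecomposability.
\<close>

definition self_split :: "'a set \<Rightarrow> bool" where
  "self_split A \<longleftrightarrow> (\<exists>B C. B \<in> Co W \<and> C \<in> Co W \<and> B \<subseteq> A \<and> C \<subseteq> A \<and> B \<inter> C = {} \<and> B \<sim> A \<and> C \<sim> A)"

lemma self_split_equiv:
  assumes "self_split A" "A \<sim> A'"
  shows "self_split A'"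
proof -
  obtain B C where BC: "B \<in> Co W" "C \<in> Co W" "B \<subseteq> A" "C \<subseteq> A" "B \<inter> C = {}" "B \<sim> A" "C \<sim> A"
    using assms(1) by (auto simp: self_split_def)
  obtain B' where B': "B' \<in> Co W" "B' \<subseteq> A'" "B \<sim> B'" "A - B \<sim> A' - B'"
    using equiv_split[OF assms(2) BC(1,3)] .
  have "C \<subseteq> A - B" using BC by auto
  then obtain C' where C': "C' \<in> Co W" "C' \<subseteq> A' - B'" "C \<sim> C'"
    using equiv_split[OF B'(4) BC(2)] by metis
  have "B' \<sim> A'" "C' \<sim> A'"
    using equiv_trans[OF equiv_sym[OF B'(3)] equiv_trans[OF BC(6) assms(2)]]
      equiv_trans[OF equiv_sym[OF C'(3)] equiv_trans[OF BC(7) assms(2)]] .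
  then show ?thesis
    unfolding self_split_def using B'(1,2) C'(1,2) by (intro exI[of _ B'] exI[of _ C']) auto
qed

definition split_po :: "'q po_system" where
  "split_po = \<lparr>points = points code_po,
     less_rel = less_rel code_po \<union> {(c A, c A) | A. PI A \<and> self_split A}\<rparr>"

definition split_trim :: "'a set \<Rightarrow> 'q \<Rightarrow> bool" where
  "split_trim A p \<longleftrightarrow> A \<in> Co W \<and> (\<exists>D\<subseteq>A. PI D \<and> c D = p) \<and>
     (\<forall>D\<subseteq>A. PI D \<longrightarrow> po_le code_po p (c D)) \<and>
     ((p, p) \<in> less_rel split_po \<or> PI A \<and> c A = p)"

lemma split_less_refl_iff:
  assumes "PI A"
  shows "(c A, c A) \<in> less_rel split_po \<longleftrightarrow> absorbs A A \<or> self_split A"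
proof
  assume "(c A, c A) \<in> less_rel split_po"
  then have "(c A, c A) \<in> less_rel code_po \<or> (\<exists>B. c A = c B \<and> PI B \<and> self_split B)"
    by (auto simp: split_po_def)
  then show "absorbs A A \<or> self_split A"
    using code_less_iff[OF assms assms] code[OF _ assms] self_split_equiv by metis
qed (use code_less_iff[OF assms assms] assms in \<open>auto simp: split_po_def\<close>)

lemma split_less_iff:
  "p \<noteq> q \<Longrightarrow> (p, q) \<in> less_rel split_po \<longleftrightarrow> (p, q) \<in> less_rel code_po"
  by (auto simp: split_po_def)

lemma split_leI: "po_le code_po p q \<Longrightarrow> (p, p) \<in> less_rel split_po \<Longrightarrow> (p, q) \<in> less_rel split_po"
  by (auto simp: split_po_def po_le_def)

lemma split_trim_PI: "PI A \<Longrightarrow> split_trim A (c A)"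
  unfolding split_trim_def using PI_subset_code PI_Co by blast

lemma po_split_po: "po_system split_po"
  unfolding po_system_def
proof (intro conjI)
  have po: "less_rel code_po \<subseteq> points code_po \<times> points code_po" "antisym (less_rel code_po)"
      "trans (less_rel code_po)"
    using po_code_po by (auto simp: po_system_def)
  show "less_rel split_po \<subseteq> points split_po \<times> points split_po"
    using po(1) by (auto simp: split_po_def points_code_po)
  show "antisym (less_rel split_po)"
    using po(2) unfolding split_po_def antisym_def by auto
  show "trans (less_rel split_po)"
    using po(3) unfolding split_po_def trans_def by auto
qed

lemma split_trim_subset:
  assumes A: "split_trim A p" "(p, p) \<in> less_rel split_po" and B: "B \<in> Co W" "B \<subseteq> A"
    and D: "D \<subseteq> B" "PI D" "c D = p"
  shows "split_trim B p"
proof -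
  have "po_le code_po p (c E)" if "E \<subseteq> B" "PI E" for E
    using A(1) B(2) that by (auto simp: split_trim_def)
  then show ?thesis
    unfolding split_trim_def using A(2) B(1) D by blast
qed

text \<open>
  For a label that is irreflexive even in \<open>split_po\<close>, a set carrying it is
  pseudo-indecomposable and contains no two disjoint copies of itself; for a reflexive label both
  sides of a cut may carry it.
\<close>

lemma labelled_split: "labelled W split_po split_trim"
proof
  show "countable (Co W)" by (rule countable_Co)
  show "po_system split_po" by (rule po_split_po)
  show "A \<in> Co W" "A \<noteq> {}" "p \<in> points split_po" if "split_trim A p" for A p
    using that by (auto simp: split_trim_def PI_iff split_po_def points_code_po)
  show "p = q" if "split_trim A p" "split_trim A q" for A p q
  proof -
    have "po_le code_po p q" "po_le code_po q p"
      using that unfolding split_trim_def by metis+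
    then show ?thesis
      using po_code_po unfolding po_system_def antisym_def po_le_def by metis
  qed
  show "\<exists>M. decomp split_trim A M" if "A \<in> Co W" for A
    using primitive_decomp[where t = split_trim, OF split_trim_PI that] .
  have above: "po_le code_po p q" if "split_trim A p" "split_trim E q" "E \<subseteq> A" for A E p q
  proof -
    obtain D where "D \<subseteq> E" "PI D" "c D = q"
      using \<open>split_trim E q\<close> unfolding split_trim_def by metis
    then show ?thesis
      using \<open>split_trim A p\<close> \<open>E \<subseteq> A\<close> unfolding split_trim_def by (metis subset_trans)
  qed
  show "split_trim B p \<and> (\<forall>E q. split_trim E q \<longrightarrow> E \<subseteq> A - B \<longrightarrow> (p, q) \<in> less_rel split_po) \<or>
      split_trim (A - B) p \<and> (\<forall>E q. split_trim E q \<longrightarrow> E \<subseteq> B \<longrightarrow> (p, q) \<in> less_rel split_po)"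
    if A: "split_trim A p" and B: "B \<in> Co W" "B \<subseteq> A" for A p B
  proof (cases "(p, p) \<in> less_rel split_po")
    case True
    have AB: "A - B \<in> Co W" "A - B \<subseteq> A"
      using A B by (auto simp: split_trim_def)
    have above': "(p, q) \<in> less_rel split_po" if "split_trim E q" "E \<subseteq> A" for E q
      using split_leI[OF above[OF A that] True] .
    obtain D where D: "D \<subseteq> A" "PI D" "c D = p"
      using A unfolding split_trim_def by metis
    from PI_Int_or_Diff[OF D(2) B(1)] show ?thesis
    proof
      assume *: "D \<inter> B \<sim> D"
      then have PI: "PI (D \<inter> B)"
        using PI_equiv[OF D(2) equiv_sym] by blast
      then have "split_trim B p"
        using split_trim_subset[OF A True B, of "D \<inter> B"] code[OF PI D(2)] * D(3) by auto
      then show ?thesis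
        using above' by blast
    next
      assume *: "D - B \<sim> D"
      then have PI: "PI (D - B)"
        using PI_equiv[OF D(2) equiv_sym] by blast
      then have "split_trim (A - B) p"
        using split_trim_subset[OF A True AB, of "D - B"] code[OF PI D(2)] * D(1,3) by auto
      then show ?thesis
        using above' B(2) by blast
    qed
  next
    case False
    then have PI: "PI A" "c A = p"
      using A by (auto simp: split_trim_def)
    have part: "split_trim B p \<and> (\<forall>E q. split_trim E q \<longrightarrow> E \<subseteq> A - B \<longrightarrow> (p, q) \<in> less_rel split_po)"
      if B: "B \<in> Co W" "B \<subseteq> A" and eq: "B \<sim> A" for B
    proof (intro conjI allI impI)
      have PIB: "PI B"
        using PI_equiv[OF PI(1) equiv_sym[OF eq]] .
      have cB: "c B = p"
        using code[OF PIB PI(1)] eq PI(2) by simp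
      show "split_trim B p"
        using split_trim_PI[OF PIB] cB by simp
      fix E q assume E: "split_trim E q" "E \<subseteq> A - B"
      then have le: "po_le code_po p q"
        using above[OF A E(1)] by auto
      obtain D where D: "D \<subseteq> E" "PI D" "c D = q"
        using E(1) unfolding split_trim_def by metis
      have "p \<noteq> q"
      proof
        assume "p = q"
        then have "D \<sim> A"
          using code[OF D(2) PI(1)] D(3) PI(2) by simp
        then have "self_split A"
          unfolding self_split_def using B eq D E(2) PI_Co[OF D(2)] by (intro exI[of _ B] exI[of _ D]) auto
        then show False
          using split_less_refl_iff[OF PI(1)] PI(2) False by simp
      qed
      then show "(p, q) \<in> less_rel split_po"
        using le by (auto simp: po_le_def split_po_def)
    qed
    have "B \<sim> A \<or> A - B \<sim> A"
      using PI(1) B by (simp add: PI_iff)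
    then show ?thesis
    proof
      assume "B \<sim> A"
      then show ?thesis using part[OF B] by blast
    next
      assume *: "A - B \<sim> A"
      have "A - (A - B) = B"
        using B(2) by auto
      then show ?thesis
        using part[of "A - B"] * B PI_Co[OF PI(1)] by auto
    qed
  qed
  show "\<exists>B\<subseteq>A. split_trim B q \<and> split_trim (A - B) p"
    if A: "split_trim A p" and less: "(p, q) \<in> less_rel split_po" for A p q
  proof (cases "(p, q) \<in> less_rel code_po")
    case True
    obtain E where E: "PI E" "c E = q"
      using code_lessE[OF True] by metis
    \<comment> \<open>For an irreflexive \<open>p\<close> take \<open>D = A\<close>, so that \<open>A - C\<close> is a copy of \<open>A\<close>.\<close>
    have "\<exists>D\<subseteq>A. PI D \<and> c D = p \<and> ((p, p) \<in> less_rel split_po \<or> D = A)"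
      using A unfolding split_trim_def by (metis order_refl)
    then obtain D where D: "D \<subseteq> A" "PI D" "c D = p" "(p, p) \<in> less_rel split_po \<or> D = A"
      by metis
    have "absorbs D E"
      using True code_less_iff[OF D(2) E(1)] D(3) E(2) by simp
    then obtain C where C: "C \<in> Co W" "C \<subseteq> D" "C \<sim> E" "D - C \<sim> D"
      by (auto simp: absorbs_def)
    have PI: "PI C" "PI (D - C)"
      using PI_equiv[OF E(1) equiv_sym[OF C(3)]] PI_equiv[OF D(2) equiv_sym[OF C(4)]] .
    have cc: "c C = q" "c (D - C) = p"
      using code[OF PI(1) E(1)] code[OF PI(2) D(2)] C(3,4) D(3) E(2) by auto
    have "split_trim C q"
      using split_trim_PI[OF PI(1)] cc(1) by simp
    moreover have "split_trim (A - C) p"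
      using D(4)
    proof
      assume "(p, p) \<in> less_rel split_po"
      then show ?thesis
        using split_trim_subset[OF A, of "A - C" "D - C"] C(1) A D(1) PI(2) cc(2)
        by (auto simp: split_trim_def)
    next
      assume "D = A"
      then show ?thesis
        using split_trim_PI[OF PI(2)] cc(2) by simp
    qed
    ultimately show ?thesis
      using C(2) D(1) by (intro exI[of _ C]) auto
  next
    case False
    then have pq: "p = q"
      using less split_less_iff by metis
    have refl: "(p, p) \<in> less_rel split_po"
      using less pq by simp
    obtain D where D: "D \<subseteq> A" "PI D" "c D = p"
      using A unfolding split_trim_def by metis
    have "self_split D"
      using split_less_refl_iff[OF D(2)] code_less_iff[OF D(2,2)] refl False D(3) pq by auto
    then obtain B C where BC: "B \<in> Co W" "C \<in> Co W" "B \<subseteq> D" "C \<subseteq> D" "B \<inter> C = {}" "B \<sim> D" "C \<sim> D"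
      by (auto simp: self_split_def)
    have PI: "PI B" "PI C"
      using PI_equiv[OF D(2) equiv_sym[OF BC(6)]] PI_equiv[OF D(2) equiv_sym[OF BC(7)]] .
    have cc: "c B = p" "c C = p"
      using code[OF PI(1) D(2)] code[OF PI(2) D(2)] BC(6,7) D(3) by auto
    have "split_trim B q"
      using split_trim_PI[OF PI(1)] cc(1) pq by simp
    moreover have "A - B \<in> Co W" "A - B \<subseteq> A" "C \<subseteq> A - B"
      using A BC D(1) by (auto simp: split_trim_def)
    then have "split_trim (A - B) p"
      using split_trim_subset[OF A refl _ _ _ PI(2) cc(2)] by simp
    ultimately show ?thesis
      using BC(3) D(1) by (intro exI[of _ B]) auto
  qed
qed

text \<open>
  By back and forth, sets with the same label are isomorphic; so the larger class of sets admitted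
  for reflexive labels consists of the pseudo-indecomposable ones after all.
\<close>

lemma split_trim_iff: "split_trim A p \<longleftrightarrow> PI A \<and> c A = p"
proof
  interpret labelled W split_po split_trim
    by (rule labelled_split)
  assume A: "split_trim A p"
  then obtain D where D: "D \<subseteq> A" "PI D" "c D = p"
    unfolding split_trim_def by metis
  then have "A \<sim> D"
    using trim_equiv[OF A] split_trim_PI by blast
  then show "PI A \<and> c A = p"
    using trim_PI[OF A] code[OF trim_PI[OF A] D(2)] D(3) by simp
qed (use split_trim_PI in auto)

theorem labelled_full_split: "labelled_full W split_po split_trim"
proof -
  interpret labelled W split_po split_trim
    by (rule labelled_split)
  show ?thesis
    by unfold_locales (auto simp: split_po_def points_code_po split_trim_iff)
qed

text \<open>
  Different types are not isomorphic, so no morphism can identify them.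
\<close>

theorem simple_split_po: "simple_po split_po"
proof -
  interpret labelled_full W split_po split_trim
    by (rule labelled_full_split)
  show ?thesis
    using code by (intro simple_if_separated) (auto simp: split_trim_iff)
qed

end

text \<open>
  Every type is named after a chosen representative; there are only countably many representatives.
\<close>

lemma coded_primitive_exists:
  assumes W: "omega_Stone_space W" "primitive_space W" and inf: "infinite (UNIV :: 'q set)"
  shows "\<exists>c :: 'a set \<Rightarrow> 'q. coded_primitive W c"
proof -
  interpret stone W
    using W(1) by unfold_locales (simp add: omega_Stone_space_def)
  have ctb: "countable (Co W)"
    using W(1) by (simp add: omega_Stone_space_def)
  obtain f :: "nat \<Rightarrow> 'q" where f: "inj f"
    using inf infinite_countable_subset by blast
  define rep where "rep = (\<lambda>A. SOME B. A \<sim> B)"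
  define c where "c = (\<lambda>A. f (to_nat_on (Co W) (rep A)))"
  have rep: "A \<sim> rep A" if "A \<in> Co W" for A
    unfolding rep_def by (rule someI_ex) (use equiv_refl[OF that] in blast)
  have "c A = c B \<longleftrightarrow> A \<sim> B" if "A \<in> Co W" "B \<in> Co W" for A B
  proof
    assume "c A = c B"
    then have "rep A = rep B"
      using f ctb equiv_Co(2)[OF rep] that by (simp add: c_def inj_eq)
    then show "A \<sim> B"
      using rep[OF that(1)] equiv_sym[OF rep[OF that(2)]] equiv_trans by metis
  next
    assume "A \<sim> B"
    then have "(\<lambda>X. A \<sim> X) = (\<lambda>X. B \<sim> X)"
      using equiv_trans equiv_sym by blast
    then have "rep A = rep B"
      unfolding rep_def by (rule arg_cong)
    then show "c A = c B"
      by (simp add: c_def)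
  qed
  then have "coded_primitive W c"
    using ctb W(2) PI_Co by unfold_locales auto
  then show ?thesis by blast
qed

section \<open>Isomorphisms of extended PO systems\<close>

lemma po_isomorphism_minimal_irrefl:
  assumes \<alpha>: "po_isomorphism \<alpha> P Q" and L: "L \<subseteq> points P"
  shows "minimal_irrefl_points Q (\<alpha> ` L) = \<alpha> ` minimal_irrefl_points P L"
proof -
  have inj: "\<alpha> p = \<alpha> q \<longleftrightarrow> p = q" if "p \<in> points P" "q \<in> points P" for p q
    using \<alpha> that by (auto simp: po_isomorphism_def bij_betw_def inj_on_eq_iff)
  have less: "(\<alpha> p, \<alpha> q) \<in> less_rel Q \<longleftrightarrow> (p, q) \<in> less_rel P" if "p \<in> points P" "q \<in> points P" for p q
    using \<alpha> that by (auto simp: po_isomorphism_def)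
  have mem: "\<alpha> p \<in> points Q" if "p \<in> points P" for p
    using \<alpha> that by (auto simp: po_isomorphism_def bij_betw_def)
  have "\<alpha> p \<in> minimal_irrefl_points Q (\<alpha> ` L) \<longleftrightarrow> p \<in> minimal_irrefl_points P L" if p: "p \<in> L" for p
  proof -
    have pP: "p \<in> points P" using p L by auto
    have "(\<forall>q\<in>L. po_le Q (\<alpha> q) (\<alpha> p) \<longrightarrow> \<alpha> q = \<alpha> p) \<longleftrightarrow> (\<forall>q\<in>L. po_le P q p \<longrightarrow> q = p)"
      using L inj[OF _ pP] less[OF _ pP] by (auto simp: po_le_def subset_iff)
    then show ?thesis
      using p pP less[OF pP pP] mem[OF pP]
      by (auto simp: minimal_irrefl_points_def minimal_points_def irrefl_points_def)
  qed
  moreover have "minimal_irrefl_points Q (\<alpha> ` L) \<subseteq> \<alpha> ` L" "minimal_irrefl_points P L \<subseteq> L"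
    by (auto simp: minimal_irrefl_points_def minimal_points_def)
  ultimately show ?thesis by blast
qed

lemma ext_iso_trans:
  assumes "ext_iso P L f Q M g" "ext_iso Q M g R N h" and L: "L \<subseteq> points P"
  shows "ext_iso P L f R N h"
proof -
  obtain \<alpha> where \<alpha>: "po_isomorphism \<alpha> P Q" "\<alpha> ` L = M" "\<forall>p\<in>minimal_irrefl_points P L. g (\<alpha> p) = f p"
    using assms(1) by (auto simp: ext_iso_def)
  obtain \<beta> where \<beta>: "po_isomorphism \<beta> Q R" "\<beta> ` M = N" "\<forall>p\<in>minimal_irrefl_points Q M. h (\<beta> p) = g p"
    using assms(2) by (auto simp: ext_iso_def)
  have "minimal_irrefl_points Q M = \<alpha> ` minimal_irrefl_points P L"
    using po_isomorphism_minimal_irrefl[OF \<alpha>(1) L] \<alpha>(2) by simp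
  then have "\<forall>p\<in>minimal_irrefl_points P L. h ((\<beta> \<circ> \<alpha>) p) = f p"
    using \<alpha>(3) \<beta>(3) by simp
  moreover have "\<alpha> p \<in> points Q" if "p \<in> points P" for p
    using \<alpha>(1) that by (auto simp: po_isomorphism_def bij_betw_def)
  then have "po_isomorphism (\<beta> \<circ> \<alpha>) P R"
    using \<alpha>(1) \<beta>(1) unfolding po_isomorphism_def by (auto intro: bij_betw_trans)
  moreover have "(\<beta> \<circ> \<alpha>) ` L = N"
    using \<alpha>(2) \<beta>(2) by (metis image_comp)
  ultimately show ?thesis
    unfolding ext_iso_def by metis
qed

lemma ext_iso_sym:
  assumes "ext_iso P L f Q M g" and L: "L \<subseteq> points P"
  shows "ext_iso Q M g P L f"
proof -
  obtain \<alpha> where \<alpha>: "po_isomorphism \<alpha> P Q" "\<alpha> ` L = M" "\<forall>p\<in>minimal_irrefl_points P L. g (\<alpha> p) = f p"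
    using assms(1) by (auto simp: ext_iso_def)
  define \<beta> where "\<beta> = inv_into (points P) \<alpha>"
  have bij: "bij_betw \<alpha> (points P) (points Q)"
    using \<alpha>(1) by (simp add: po_isomorphism_def)
  have \<beta>\<alpha>: "\<beta> (\<alpha> p) = p" if "p \<in> points P" for p
    using bij that by (simp add: \<beta>_def bij_betw_inv_into_left)
  have onto: "\<exists>p\<in>points P. q = \<alpha> p" if "q \<in> points Q" for q
    using bij that by (auto simp: bij_betw_def)
  have "po_isomorphism \<beta> Q P"
    unfolding po_isomorphism_def
  proof (intro conjI ballI)
    show "bij_betw \<beta> (points Q) (points P)"
      using bij by (simp add: \<beta>_def bij_betw_inv_into)
    fix p q assume "p \<in> points Q" "q \<in> points Q"
    then show "((p, q) \<in> less_rel Q) = ((\<beta> p, \<beta> q) \<in> less_rel P)"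
      using onto[of p] onto[of q] \<alpha>(1) \<beta>\<alpha> by (auto simp: po_isomorphism_def)
  qed
  moreover have "\<beta> ` M = L"
    using \<alpha>(2) \<beta>\<alpha> L by (force simp: subset_iff)
  moreover have "f (\<beta> q) = g q" if q: "q \<in> minimal_irrefl_points Q M" for q
  proof -
    obtain p where p: "p \<in> minimal_irrefl_points P L" "q = \<alpha> p"
      using q po_isomorphism_minimal_irrefl[OF \<alpha>(1) L] \<alpha>(2) by auto
    then have "p \<in> points P"
      using L by (auto simp: minimal_irrefl_points_def minimal_points_def)
    then show ?thesis
      using \<alpha>(3) \<beta>\<alpha> p by simp
  qed
  ultimately show ?thesis
    unfolding ext_iso_def by metis
qed

lemma ext_iso_refl: "(\<forall>p\<in>minimal_irrefl_points P L. g p = f p) \<Longrightarrow> ext_iso P L f P L g"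
  unfolding ext_iso_def by (intro exI[of _ "\<lambda>p. p"]) (auto simp: po_isomorphism_def bij_betw_def)

lemma ext_class_eq:
  assumes iso: "ext_iso P L f Q M g" and L: "L \<subseteq> points P"
  shows "ext_class P L f = ext_class Q M g"
proof -
  have "M \<subseteq> points Q"
    using assms by (auto simp: ext_iso_def po_isomorphism_def bij_betw_def)
  then have "ext_iso P L f R N h \<longleftrightarrow> ext_iso Q M g R N h" for R :: "'c po_system" and N h
    using ext_iso_trans[OF iso _ L] ext_iso_trans[OF ext_iso_sym[OF iso L]] by blast
  then show ?thesis
    by (simp add: ext_class_def)
qed

lemma po_isomorphism_morphism:
  assumes \<alpha>: "po_isomorphism \<alpha> P Q"
  shows "po_morphism \<alpha> P Q"
  unfolding po_morphism_def
proof (intro conjI ballI)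
  have bij: "\<alpha> ` points P = points Q"
    using \<alpha> by (auto simp: po_isomorphism_def bij_betw_def)
  then show "\<alpha> \<in> points P \<rightarrow> points Q" by auto
  fix p assume p: "p \<in> points P"
  have less: "(\<alpha> p, \<alpha> r) \<in> less_rel Q \<longleftrightarrow> (p, r) \<in> less_rel P" if "r \<in> points P" for r
    using \<alpha> p that by (auto simp: po_isomorphism_def)
  show "\<alpha> ` {r \<in> points P. (p, r) \<in> less_rel P} = {q \<in> points Q. (\<alpha> p, q) \<in> less_rel Q}"
    using less unfolding bij[symmetric] by auto
qed


section \<open>The PO system of a labelled space\<close>

context labelled
begin

lemma primitive: "primitive_space W"
  unfolding primitive_space_def
proof (intro conjI ballI)
  fix A assume "A \<in> Co W"
  then obtain M where "decomp trim A M"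
    using decomposable by auto
  then obtain F where "finite F" "disjoint F" "\<Union>F = A" "\<forall>X\<in>F. \<exists>p. trim X p"
    using decomp_family by metis
  then show "\<exists>F. finite F \<and> (\<forall>B\<in>F. PI B) \<and> disjoint F \<and> \<Union>F = A"
    using trim_PI by metis
qed (rule Stone)

text \<open>
  Isomorphism classes are themselves admissible names for the types.
\<close>

lemma coded_class: "coded_primitive W (Co_class W)"
  by unfold_locales (simp_all add: countable_Co primitive Co_class_eq_iff PI_Co)

lemma PI_system_code: "PI_system W = coded_primitive.code_po W (Co_class W)"
proof -
  have "pseudo_indecomposable W A \<and> pseudo_indecomposable W B \<and>
        RDirProd (Co_ring W A) (Co_ring W B) \<simeq> Co_ring W A \<longleftrightarrow>
      PI A \<and> PI B \<and> absorbs A B" for A B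
    using RDirProd_iso_iff PI_Co by blast
  then show ?thesis
    unfolding PI_system_def coded_primitive.code_po_def[OF coded_class] by (simp add: setcompr_eq_image)
qed

definition label_class :: "'p \<Rightarrow> 'a set ring set" where
  "label_class p = Co_class W (SOME A. trim A p)"

lemma Co_class_trim: "trim A p \<Longrightarrow> Co_class W A = label_class p"
proof -
  assume A: "trim A p"
  then have "trim (SOME A. trim A p) p"
    by (rule someI)
  then show ?thesis
    using A Co_class_eq_iff trim_Co trim_equiv unfolding label_class_def by blast
qed

lemma PI_class:
  assumes "PI A"
  shows "\<exists>X r. X \<subseteq> A \<and> trim X r \<and> X \<sim> A \<and> Co_class W A = label_class r"
proof -
  obtain M where "decomp trim A M"
    using decomposable[OF PI_Co[OF assms]] by auto
  then obtain X r where X: "trim X r" "X \<subseteq> A" "X \<sim> A"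
    using PI_decomp[of trim A M] assms trim_Co by blast
  then have "Co_class W A = label_class r"
    using Co_class_eq_iff[OF equiv_Co[OF X(3)]] Co_class_trim[OF X(1)] by simp
  then show ?thesis using X by blast
qed

end

context labelled_full
begin

text \<open>
  That relations are preserved is \<open>trim_absorb\<close>. For the converse let \<open>A\<close>
  carry \<open>q\<close> and be cut into a copy \<open>C\<close> of \<open>B\<close> and a copy of
  \<open>A\<close>. If \<open>q\<close> survives outside \<open>C\<close>, the type of
  \<open>B\<close> is that of a label above \<open>q\<close> in \<open>C\<close>. If
  \<open>q\<close> survives on \<open>C\<close>, then \<open>B\<close> has the same type as
  \<open>A\<close>, and this type belongs to a label above \<open>q\<close> in the other part.
\<close>

lemma label_class_morphism: "po_morphism label_class P (PI_system W)"
proof -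
  interpret code: coded_primitive W "Co_class W"
    by (rule coded_class)
  note [simp] = PI_system_code
  show ?thesis
    unfolding po_morphism_def
  proof (intro conjI ballI)
    have "label_class p \<in> points (PI_system W)" if "p \<in> points P" for p
      using label_occurs[OF that] Co_class_trim trim_PI by (fastforce simp: code.points_code_po)
    then show "label_class \<in> points P \<rightarrow> points (PI_system W)" by auto
    fix q assume "q \<in> points P"
    then obtain A where A: "trim A q"
      using label_occurs by auto
    note PIA = trim_PI[OF A] and cA = Co_class_trim[OF A]
    show "label_class ` {r \<in> points P. q \<prec>\<^sub>P r} = {s \<in> points (PI_system W). (label_class q, s) \<in> less_rel (PI_system W)}"
    proof (intro equalityI subsetI)
      fix s assume "s \<in> label_class ` {r \<in> points P. q \<prec>\<^sub>P r}"
      then obtain r where r: "r \<in> points P" "q \<prec>\<^sub>P r" "s = label_class r" by auto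
      obtain B where B: "B \<subseteq> A" "trim B r" "trim (A - B) q"
        using trim_absorb[OF A r(2)] by auto
      have "absorbs A B"
        unfolding absorbs_def
        using trim_Co[OF B(2)] B(1) trim_equiv[OF B(3) A] equiv_refl by blast
      then have "(label_class q, s) \<in> less_rel (PI_system W)"
        using code.code_less_iff[OF PIA trim_PI[OF B(2)]] cA Co_class_trim[OF B(2)] r(3) by simp
      moreover have "s \<in> points (PI_system W)"
        using trim_PI[OF B(2)] Co_class_trim[OF B(2)] r(3) by (auto simp: code.points_code_po)
      ultimately show "s \<in> {s \<in> points (PI_system W). (label_class q, s) \<in> less_rel (PI_system W)}"
        by simp
    next
      fix s assume s: "s \<in> {s \<in> points (PI_system W). (label_class q, s) \<in> less_rel (PI_system W)}"
      then obtain B where B: "PI B" "s = Co_class W B"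
        by (auto simp: code.points_code_po)
      then have "absorbs A B"
        using s code.code_less_iff[OF PIA B(1)] cA by simp
      then obtain C where C: "C \<in> Co W" "C \<subseteq> A" "C \<sim> B" "A - C \<sim> A"
        by (auto simp: absorbs_def)
      have cC: "Co_class W C = s"
        using Co_class_eq_iff[OF equiv_Co[OF C(3)]] C(3) B(2) by simp
      have cAC: "Co_class W (A - C) = label_class q"
        using Co_class_eq_iff[OF equiv_Co[OF C(4)]] C(4) cA by simp
      obtain r where r: "q \<prec>\<^sub>P r" "s = label_class r"
        using trim_split[OF A C(1,2)]
      proof (elim disjE conjE)
        assume *: "trim C q" "\<forall>D r. trim D r \<longrightarrow> D \<subseteq> A - C \<longrightarrow> q \<prec>\<^sub>P r"
        obtain X r where X: "X \<subseteq> A - C" "trim X r" "Co_class W (A - C) = label_class r"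
          using PI_class[OF PI_equiv[OF PIA equiv_sym[OF C(4)]]] by blast
        then have "s = label_class r"
          using cC Co_class_trim[OF *(1)] cAC by simp
        then show thesis
          using X(1,2) *(2) that by blast
      next
        assume *: "\<forall>D r. trim D r \<longrightarrow> D \<subseteq> C \<longrightarrow> q \<prec>\<^sub>P r"
        obtain X r where X: "X \<subseteq> C" "trim X r" "Co_class W C = label_class r"
          using PI_class[OF PI_equiv[OF B(1) equiv_sym[OF C(3)]]] by blast
        then show thesis
          using * cC that by blast
      qed
      then show "s \<in> label_class ` {r \<in> points P. q \<prec>\<^sub>P r}"
        using po by (auto simp: po_system_def)
    qed
  qed
qed

end

text \<open>
  By simplicity the morphism to the PO system of the space is injective, so different labels have
  different types and the labelling computes all invariants.
\<close>

locale labelled_simple = labelled_full +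
  assumes simple: "simple_po P"
begin

lemma label_class_inj: "inj_on label_class (points P)"
proof -
  interpret code: coded_primitive W "Co_class W"
    by (rule coded_class)
  show ?thesis
    using simple_po_inj[OF simple _ label_class_morphism] code.po_code_po by (simp add: PI_system_code)
qed

lemma label_class_iso: "po_isomorphism label_class P (PI_system W)"
  unfolding po_isomorphism_def
proof (intro conjI ballI)
  interpret code: coded_primitive W "Co_class W"
    by (rule coded_class)
  have "label_class ` points P \<subseteq> points (PI_system W)"
    using label_class_morphism by (auto simp: po_morphism_def)
  moreover have "s \<in> label_class ` points P" if s: "s \<in> points (PI_system W)" for s
  proof -
    obtain A where "PI A" "s = Co_class W A"
      using s by (auto simp: PI_system_code code.points_code_po)
    then show ?thesis
      using PI_class trim_point by blast
  qed
  ultimately show "bij_betw label_class (points P) (points (PI_system W))"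
    using label_class_inj by (auto simp: bij_betw_def)
  fix p q assume pq: "p \<in> points P" "q \<in> points P"
  have img: "label_class ` {r \<in> points P. p \<prec>\<^sub>P r} = {s \<in> points (PI_system W). (label_class p, s) \<in> less_rel (PI_system W)}"
    using label_class_morphism pq(1) by (auto simp: po_morphism_def)
  show "p \<prec>\<^sub>P q \<longleftrightarrow> (label_class p, label_class q) \<in> less_rel (PI_system W)"
  proof
    assume "p \<prec>\<^sub>P q"
    then show "(label_class p, label_class q) \<in> less_rel (PI_system W)"
      using img pq(2) by blast
  next
    assume "(label_class p, label_class q) \<in> less_rel (PI_system W)"
    then have "label_class q \<in> label_class ` {r \<in> points P. p \<prec>\<^sub>P r}"
      using img pq(2) \<open>label_class ` points P \<subseteq> points (PI_system W)\<close> by blast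
    then obtain r where "r \<in> points P" "p \<prec>\<^sub>P r" "label_class q = label_class r" by auto
    then show "p \<prec>\<^sub>P q"
      using label_class_inj pq(2) by (auto dest: inj_onD)
  qed
qed

text \<open>
  A neighbourhood of \<open>x\<close> with the type of \<open>p\<close> need not carry the label
  \<open>p\<close>, but the piece of a decomposition of it that contains \<open>x\<close> does: its
  label is above \<open>p\<close> because it lies in a set of this type, and below \<open>p\<close>
  because it contains a smaller neighbourhood of \<open>x\<close> of this type.
\<close>

lemma type_points_label_class:
  assumes p: "p \<in> points P"
  shows "type_points W (label_class p) = label_points p"
proof (intro equalityI subsetI)
  fix x assume x: "x \<in> label_points p"
  show "x \<in> type_points W (label_class p)"
    unfolding type_points_def neighbourhood_base_at_def
  proof (intro CollectI conjI allI impI)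
    show "x \<in> topspace W"
      using x label_points_topspace by auto
    fix U assume "openin W U \<and> x \<in> U"
    then obtain A where A: "trim A p" "x \<in> A" "A \<subseteq> U"
      using label_pointsD[OF x] by metis
    then show "\<exists>V A. openin W V \<and> (A \<in> Co W \<and> Co_class W A = label_class p) \<and> x \<in> V \<and> V \<subseteq> A \<and> A \<subseteq> U"
      using Co_openin[OF trim_Co[OF A(1)]] trim_Co[OF A(1)] Co_class_trim[OF A(1)]
      by (intro exI[of _ A]) auto
  qed
next
  fix x assume x: "x \<in> type_points W (label_class p)"
  interpret code: coded_primitive W "Co_class W"
    by (rule coded_class)
  obtain A0 where A0: "trim A0 p"
    using label_occurs[OF p] by auto
  have nbhd: "\<exists>A. A \<in> Co W \<and> Co_class W A = label_class p \<and> PI A \<and> x \<in> A \<and> A \<subseteq> U"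
    if U: "openin W U" "x \<in> U" for U
  proof -
    obtain V A where A: "A \<in> Co W" "Co_class W A = label_class p" "x \<in> V" "V \<subseteq> A" "A \<subseteq> U"
      using x U unfolding type_points_def neighbourhood_base_at_def mem_Collect_eq by metis
    then have "A0 \<sim> A"
      using Co_class_eq_iff[OF trim_Co[OF A0] A(1)] Co_class_trim[OF A0] by simp
    then show ?thesis
      using PI_equiv[OF trim_PI[OF A0]] A by blast
  qed
  show "x \<in> label_points p"
  proof (rule label_pointsI)
    show "x \<in> topspace W"
      using x by (auto simp: type_points_def)
    fix U assume U: "openin W U" "x \<in> U"
    obtain A where A: "A \<in> Co W" "Co_class W A = label_class p" "PI A" "x \<in> A" "A \<subseteq> U"
      using nbhd[OF U] by blast
    obtain M where "decomp trim A M"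
      using decomposable[OF A(1)] by auto
    then obtain F where F: "\<Union>F = A" "\<forall>X\<in>F. \<exists>r. trim X r"
      using decomp_family by metis
    then obtain X r where X: "X \<in> F" "x \<in> X" "trim X r"
      using A(4) by blast
    have XA: "X \<subseteq> A"
      using F(1) X(1) by auto
    obtain A' where A': "Co_class W A' = label_class p" "PI A'" "A' \<subseteq> X"
      using nbhd[OF Co_openin[OF trim_Co[OF X(3)]] X(2)] by blast
    obtain Y s where Y: "Y \<subseteq> A'" "trim Y s" "label_class s = label_class p"
      using PI_class[OF A'(2)] A'(1) by metis
    have "s = p"
      using label_class_inj Y(3) trim_point[OF Y(2)] p by (auto dest: inj_onD)
    then have rp: "r \<preceq>\<^sub>P p"
      using label_mono[OF X(3) Y(2)] Y(1) A'(3) by auto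
    have rP: "r \<in> points P"
      using trim_point[OF X(3)] .
    have "r = p"
      using PI_subset[OF A(3) trim_Co[OF X(3)] XA]
    proof
      assume "X \<sim> A"
      then have "label_class r = label_class p"
        using Co_class_eq_iff[OF trim_Co[OF X(3)] A(1)] Co_class_trim[OF X(3)] A(2) by simp
      then show ?thesis
        using label_class_inj rP p by (auto dest: inj_onD)
    next
      assume "absorbs A X"
      then have "(label_class p, label_class r) \<in> less_rel (PI_system W)"
        using code.code_less_iff[OF A(3) trim_PI[OF X(3)]] A(2) Co_class_trim[OF X(3)]
        by (simp add: PI_system_code)
      then have "p \<prec>\<^sub>P r"
        using label_class_iso p rP by (auto simp: po_isomorphism_def)
      then show ?thesis
        using rp leq_antisym[of r p] by (simp add: po_le_def)
    qed
    then show "\<exists>A. trim A p \<and> x \<in> A \<and> A \<subseteq> U"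
      using X A(5) XA by blast
  qed
qed

lemma points_PI_system: "points (PI_system W) = label_class ` points P"
  using label_class_iso by (auto simp: po_isomorphism_def bij_betw_def)

lemma compact_types_eq: "compact_types W = label_class ` compact_labels"
  unfolding compact_types_def compact_labels_def points_PI_system using type_points_label_class by auto

lemma bounded_space_iff: "bounded_space W \<longleftrightarrow> bounded_labels"
proof -
  have "(\<Union>p\<in>compact_types W. type_points W p) = (\<Union>p\<in>compact_labels. label_points p)"
    unfolding compact_types_eq using type_points_label_class compact_labels_iff by simp
  then show ?thesis
    unfolding bounded_space_def bounded_labels_iff using primitive by simp
qed

lemma finitary_space_iff: "finitary_space W \<longleftrightarrow> finite (points P)"
  unfolding finitary_space_def points_PI_system
  using primitive finite_image_iff[OF label_class_inj] by simp

theorem theta_eq: "theta W = ext_class P compact_labels label_count"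
proof -
  have "type_count W (label_class p) = label_count p" if "p \<in> minimal_irrefl_points P compact_labels" for p
    using type_points_label_class[of p] that compact_labels_iff
    by (simp add: type_count_def label_count_def minimal_irrefl_iff)
  then have "ext_iso P compact_labels label_count (PI_system W) (compact_types W) (type_count W)"
    unfolding ext_iso_def using label_class_iso compact_types_eq by blast
  moreover have "compact_labels \<subseteq> points P"
    using compact_labels_iff by auto
  ultimately show ?thesis
    unfolding theta_def using ext_class_eq by metis
qed

end

section \<open>Bounded spaces are determined by their labels\<close>

lemma decomp_filter:
  "decomp trim A M \<Longrightarrow> \<exists>B\<subseteq>A. decomp trim B (filter_mset Q M) \<and> decomp trim (A - B) (filter_mset (\<lambda>p. \<not> Q p) M)"
proof (induction rule: decomp.induct)
  case decomp_empty
  show ?case using decomp.decomp_empty[of trim] by (intro exI[of _ "{}"]) auto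
next
  case (decomp_insert X p A M)
  then obtain B where B: "B \<subseteq> A" "decomp trim B (filter_mset Q M)"
      "decomp trim (A - B) (filter_mset (\<lambda>p. \<not> Q p) M)" by auto
  show ?case
  proof (cases "Q p")
    case True
    have "X \<union> A - (X \<union> B) = A - B"
      using decomp_insert(3) by auto
    moreover have "decomp trim (X \<union> B) (add_mset p (filter_mset Q M))"
      using decomp_insert B by (intro decomp.decomp_insert) auto
    ultimately show ?thesis
      using True B by (intro exI[of _ "X \<union> B"]) auto
  next
    case False
    have "X \<union> A - B = X \<union> (A - B)"
      using decomp_insert(3) B(1) by auto
    moreover have "decomp trim (X \<union> (A - B)) (add_mset p (filter_mset (\<lambda>p. \<not> Q p) M))"
      using decomp_insert B by (intro decomp.decomp_insert) auto
    ultimately show ?thesis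
      using False B by (intro exI[of _ B]) auto
  qed
qed

context labelled
begin

text \<open>
  Splitting off labels does not change the set that is decomposed. This is the device for making the
  decompositions of two given sets equal.
\<close>

lemma decomp_add_above:
  assumes M: "decomp trim A M" and N: "\<forall>q\<in>#N. \<exists>r\<in>#M. r \<prec>\<^sub>P q"
  shows "decomp trim A (N + M)"
  using N
proof (induction N)
  case (add q N)
  then have IH: "decomp trim A (N + M)" by simp
  obtain r where r: "r \<in># N + M" "r \<prec>\<^sub>P q"
    using add(2) by auto
  obtain X where X: "X \<subseteq> A" "trim X r" "decomp trim (A - X) (N + M - {#r#})"
    using decomp_pick[OF IH r(1)] by auto
  obtain B where B: "B \<subseteq> X" "trim B q" "trim (X - B) r"
    using trim_absorb[OF X(2) r(2)] by auto
  have "decomp trim ((X - B) \<union> (A - X)) (add_mset r (N + M - {#r#}))"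
    using B X by (intro decomp_insert) auto
  then have "decomp trim ((X - B) \<union> (A - X)) (N + M)"
    using r(1) by simp
  then have "decomp trim (B \<union> ((X - B) \<union> (A - X))) (add_mset q (N + M))"
    using B by (intro decomp_insert) auto
  moreover have "B \<union> ((X - B) \<union> (A - X)) = A"
    using B X by auto
  ultimately show ?case by simp
qed (use M in simp)

text \<open>
  A label that is not compact occurs outside every compact open set, hence infinitely often.
\<close>

lemma decomp_outside:
  assumes "\<forall>p\<in>#M. p \<in> points P \<and> p \<notin> compact_labels" and U: "U \<in> Co W"
  shows "\<exists>A. decomp trim A M \<and> A \<inter> U = {}"
  using assms(1)
proof (induction M)
  case empty
  show ?case using decomp_empty by (intro exI[of _ "{}"]) auto
next
  case (add p M)
  then obtain A where A: "decomp trim A M" "A \<inter> U = {}" by auto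
  have "U \<union> A \<in> Co W"
    using U decomp_Co[OF A(1)] by simp
  moreover have "p \<in> points P" "p \<notin> compact_labels"
    using add(2) by auto
  ultimately obtain B where B: "trim B p" "B \<inter> (U \<union> A) = {}"
    using compact_labels_iff by metis
  have "decomp trim (B \<union> A) (add_mset p M)"
    using A B by (intro decomp_insert) auto
  then show ?case
    using A B by (intro exI[of _ "B \<union> A"]) auto
qed

text \<open>
  Pieces with labels that are not compact can be left out of \<open>K\<close>, because no compact
  label occurs in them: the compact labels form a lower set.
\<close>

lemma bounded_core:
  assumes "bounded_labels"
  shows "\<exists>K M. decomp trim K M \<and> set_mset M \<subseteq> compact_labels \<and>
    (\<forall>p\<in>compact_labels. \<forall>A. trim A p \<longrightarrow> A \<inter> K \<noteq> {})"
proof -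
  obtain K where K: "K \<in> Co W" "\<forall>p\<in>compact_labels. \<forall>A. trim A p \<longrightarrow> A \<inter> K \<noteq> {}"
    using assms by (auto simp: bounded_labels_def)
  obtain M where M: "decomp trim K M"
    using decomposable[OF K(1)] by auto
  obtain B where B: "B \<subseteq> K" "decomp trim B (filter_mset (\<lambda>p. p \<in> compact_labels) M)"
      "decomp trim (K - B) (filter_mset (\<lambda>p. p \<notin> compact_labels) M)"
    using decomp_filter[OF M, of "\<lambda>p. p \<in> compact_labels"] by auto
  have "A \<inter> B \<noteq> {}" if p: "p \<in> compact_labels" and A: "trim A p" for p A
  proof
    assume "A \<inter> B = {}"
    then have "A \<inter> K \<subseteq> K - B" by auto
    moreover have "trim (A \<inter> K) p"
      using trim_Int_confining[OF K(1) _ A leq_refl] K(2) p by auto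
    ultimately obtain r where r: "r \<in># M" "r \<notin> compact_labels" "r \<preceq>\<^sub>P p"
      using decomp_label_below[OF B(3)] by fastforce
    then show False
      using compact_labels_lower[OF p decomp_labels[OF M r(1)] r(3)] by simp
  qed
  then show ?thesis
    using B(2) by (intro exI[of _ B] exI[of _ "filter_mset (\<lambda>p. p \<in> compact_labels) M"]) auto
qed

end

lemma (in labelled_full) core_label_below:
  assumes K: "decomp trim K M" "\<forall>p\<in>compact_labels. \<forall>A. trim A p \<longrightarrow> A \<inter> K \<noteq> {}"
    and q: "q \<in> compact_labels"
  shows "\<exists>r\<in>#M. r \<preceq>\<^sub>P q"
proof -
  obtain A where A: "trim A q"
    using label_occurs q compact_labels_iff by metis
  have "trim (A \<inter> K) q"
    using trim_Int_confining[OF decomp_Co[OF K(1)] _ A leq_refl] K(2) q by auto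
  then show ?thesis
    using decomp_label_below[OF K(1)] by auto
qed

text \<open>
  A reflexive label lies strictly above itself, and a label that is not minimal lies strictly above
  a smaller one. Hence every compact label except those counted by the weight can be added freely to
  a decomposition of the core.
\<close>

lemma (in labelled_full) core_label_strictly_below:
  assumes K: "decomp trim K M" "\<forall>p\<in>compact_labels. \<forall>A. trim A p \<longrightarrow> A \<inter> K \<noteq> {}"
    and q: "q \<in> compact_labels" "q \<notin> minimal_irrefl_points P compact_labels"
  shows "\<exists>r\<in>#M. r \<prec>\<^sub>P q"
proof (cases "q \<prec>\<^sub>P q")
  case True
  then show ?thesis
    using core_label_below[OF K q(1)] leq_less_trans by blast
next
  case False
  then obtain s where s: "s \<in> points P" "s \<preceq>\<^sub>P q" "s \<noteq> q"
    using q minimal_irrefl_iff by blast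
  then obtain r where "r \<in># M" "r \<preceq>\<^sub>P s"
    using core_label_below[OF K compact_labels_lower[OF q(1) s(1,2)]] by blast
  moreover have "s \<prec>\<^sub>P q"
    using s(2,3) by (simp add: po_le_def)
  ultimately show ?thesis
    using leq_less_trans by blast
qed

lemma (in labelled_full) core_count:
  assumes K: "decomp trim K M" "\<forall>p\<in>compact_labels. \<forall>A. trim A p \<longrightarrow> A \<inter> K \<noteq> {}"
    and p: "p \<in> minimal_irrefl_points P compact_labels"
  shows "label_count p = count M p"
proof (rule label_count_eq(1)[OF K(1)])
  have p': "p \<in> compact_labels" "\<not> p \<prec>\<^sub>P p" "\<forall>r\<in>points P. r \<preceq>\<^sub>P p \<longrightarrow> r = p"
    using p by (auto simp: minimal_irrefl_iff)
  show "\<forall>A. trim A p \<longrightarrow> A \<inter> K \<noteq> {}"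
    using K(2) p'(1) by simp
  show "\<not> p \<prec>\<^sub>P p"
    using p'(2) .
  show "\<forall>r\<in>#M. r \<preceq>\<^sub>P p \<longrightarrow> r = p"
    using p'(3) decomp_labels[OF K(1)] by simp
qed

lemma (in labelled_pair) common_outside:
  assumes UV: "common U V" and A: "A \<in> Co W" "A \<inter> U = {}"
    and U: "\<And>p X. p \<in> right.compact_labels \<Longrightarrow> trim X p \<Longrightarrow> X \<inter> U \<noteq> {}"
  shows "\<exists>B. B \<inter> V = {} \<and> common A B"
proof -
  obtain M where M: "decomp trim A M"
    using left.decomposable[OF A(1)] by auto
  have "p \<in> points P \<and> p \<notin> right.compact_labels" if p: "p \<in># M" for p
  proof -
    obtain X where "X \<subseteq> A" "trim X p"
      using decomp_mem[OF M p] by auto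
    then show ?thesis
      using U left.trim_point A(2) by blast
  qed
  then obtain B where "decomp trim' B M" "B \<inter> V = {}"
    using right.decomp_outside[of M V] common_Co[OF UV] by auto
  then show ?thesis
    using M unfolding common_def by blast
qed

lemma (in labelled_pair) common_outside':
  assumes "common U V" "B \<in> Co W'" "B \<inter> V = {}"
    and "\<And>p X. p \<in> left.compact_labels \<Longrightarrow> trim' X p \<Longrightarrow> X \<inter> V \<noteq> {}"
  shows "\<exists>A. A \<inter> U = {} \<and> common A B"
proof -
  interpret swap: labelled_pair W' W P trim' trim
    by (rule labelled_pair_swap) (rule labelled_pair_axioms)
  have "swap.common Y X \<longleftrightarrow> common X Y" for X Y
    by (auto simp: common_def swap.common_def)
  then show ?thesis
    using swap.common_outside[of V U B] assms by simp
qed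

locale labelled_full_pair =
  left: labelled_full W P trim + right: labelled_full W' P trim'
  for W :: "'a topology" and W' :: "'b topology" and P :: "'p po_system" and trim trim'
begin

sublocale labelled_pair ..

text \<open>
  The cores contain the minimal irreflexive compact labels equally often. All other compact labels
  can be split off from both cores, so suitable decompositions of the two cores agree. Outside the
  cores only labels remain that occur infinitely often on both sides, and the back-and-forth
  construction finds partners for them.
\<close>

theorem bounded_homeomorphic:
  assumes bounded: "left.bounded_labels" "right.bounded_labels"
    and L: "right.compact_labels = left.compact_labels"
    and f: "\<And>p. p \<in> minimal_irrefl_points P left.compact_labels \<Longrightarrow> right.label_count p = left.label_count p"
  shows "W homeomorphic_space W'"
proof -
  obtain K M where K: "decomp trim K M" "set_mset M \<subseteq> left.compact_labels"
      "\<forall>p\<in>left.compact_labels. \<forall>A. trim A p \<longrightarrow> A \<inter> K \<noteq> {}"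
    using left.bounded_core[OF bounded(1)] by auto
  obtain K' M' where K': "decomp trim' K' M'" "set_mset M' \<subseteq> left.compact_labels"
      "\<forall>p\<in>left.compact_labels. \<forall>A. trim' A p \<longrightarrow> A \<inter> K' \<noteq> {}"
    using right.bounded_core[OF bounded(2)] unfolding L by auto
  define I where "I = minimal_irrefl_points P left.compact_labels"
  let ?I = "filter_mset (\<lambda>p. p \<in> I)"
  let ?N = "filter_mset (\<lambda>p. p \<notin> I)"
  \<comment> \<open>\<open>?I M = ?I M'\<close> by counting points; adding to each side the remaining labels of the other makes them equal.\<close>
  have "decomp trim K (?N M' + M)"
    using K'(2) left.core_label_strictly_below[OF K(1,3)]
    by (intro left.decomp_add_above[OF K(1)]) (auto simp: I_def)
  moreover have "decomp trim' K' (?N M + M')"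
    using K(2) right.core_label_strictly_below[OF K'(1)] K'(3) L
    by (intro right.decomp_add_above[OF K'(1)]) (auto simp: I_def)
  moreover have "?N M' + M = ?N M + M'"
  proof -
    have eq: "?I M = ?I M'"
    proof (rule multiset_eqI)
      fix p show "count (?I M) p = count (?I M') p"
        using left.core_count[OF K(1,3)] right.core_count[OF K'(1)] K'(3) L f[of p]
        by (auto simp: I_def)
    qed
    have "?N M' + M = ?N M' + (?I M + ?N M)"
      using multiset_partition[of M "\<lambda>p. p \<in> I"] by simp
    also have "\<dots> = ?N M + (?I M' + ?N M')"
      using eq by (simp add: ac_simps)
    also have "\<dots> = ?N M + M'"
      using multiset_partition[of M' "\<lambda>p. p \<in> I"] by simp
    finally show ?thesis .
  qed
  ultimately have start: "common K K'"
    unfolding common_def by auto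
  interpret back_and_forth "Co W" "Co W'" common K K'
  proof
    show "set_ring (Co W)" "set_ring (Co W')"
      by (rule left.set_ring_Co, rule right.set_ring_Co)
    show "countable (Co W)" "countable (Co W')"
      by (rule left.countable_Co, rule right.countable_Co)
    show "common K K'" by (rule start)
    show "A \<in> Co W \<and> B \<in> Co W'" if "common A B" for A B
      using common_Co[OF that] .
    show "A = {} \<longleftrightarrow> B = {}" if "common A B" for A B
      using common_empty_iff[OF that] .
    show "common (A \<union> C) (B \<union> D)" if "common A B" "common C D" "A \<inter> C = {}" "B \<inter> D = {}" for A B C D
      using common_Un[OF that] .
    show "\<exists>D\<subseteq>B. common C D \<and> common (A - C) (B - D)" if "common A B" "C \<in> Co W" "C \<subseteq> A" for A B C
      using common_split[OF that] .
    show "\<exists>C\<subseteq>A. common C D \<and> common (A - C) (B - D)" if "common A B" "D \<in> Co W'" "D \<subseteq> B" for A B D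
      using common_split'[OF that] .
    show "\<exists>B. B \<inter> V = {} \<and> common A B"
      if "common U V" "K \<subseteq> U" "K' \<subseteq> V" "A \<in> Co W" "A \<inter> U = {}" for U V A
      using common_outside[OF that(1,4,5)] K(3) L that(2) by blast
    show "\<exists>A. A \<inter> U = {} \<and> common A B"
      if "common U V" "K \<subseteq> U" "K' \<subseteq> V" "B \<in> Co W'" "B \<inter> V = {}" for U V B
      using common_outside'[OF that(1,4,5)] K'(3) that(3) by blast
  qed
  obtain \<phi> where "set_ring_iso \<phi> (Co W) (Co W')"
    using set_ring_iso_exists by auto
  then show ?thesis
    by (rule Stone_duality[OF left.stone_axioms right.stone_axioms])
qed

end


section \<open>Homeomorphic copies\<close>

lemma Stone_spaceI:
  assumes "Hausdorff_space W"
    and base: "\<And>U x. openin W U \<Longrightarrow> x \<in> U \<Longrightarrow> \<exists>A\<in>Co W. x \<in> A \<and> A \<subseteq> U"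
  shows "Stone_space W"
  unfolding Stone_space_def
proof (intro conjI)
  show "locally_compact_space W"
    unfolding locally_compact_space_def
  proof (intro ballI)
    fix x assume "x \<in> topspace W"
    then obtain A where "A \<in> Co W" "x \<in> A"
      using base[OF openin_topspace] by auto
    then show "\<exists>U K. openin W U \<and> compactin W K \<and> x \<in> U \<and> U \<subseteq> K"
      using Co_openin Co_compactin by (intro exI[of _ A]) auto
  qed
  show "openin W = arbitrary union_of (\<lambda>A. A \<in> Co W)"
  proof (intro ext iffI)
    fix U assume U: "openin W U"
    have "U = \<Union>{A \<in> Co W. A \<subseteq> U}"
      using base[OF U] by blast
    then show "(arbitrary union_of (\<lambda>A. A \<in> Co W)) U"
      unfolding union_of_def arbitrary_def by (metis (no_types, lifting) mem_Collect_eq subsetI)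
  next
    fix U assume "(arbitrary union_of (\<lambda>A. A \<in> Co W)) U"
    then show "openin W U"
      using Co_openin by (auto simp: union_of_def)
  qed
qed (rule assms(1))

text \<open>
  A homeomorphism is used only through the isomorphism that it induces between the rings of compact
  open sets; a labelling is transported along any such isomorphism.
\<close>

lemma (in stone) homeomorphic_copy:
  fixes W' :: "'b topology"
  assumes homeo: "homeomorphic_map W W' h"
  shows "stone W'" "set_ring_iso ((`) h) (Co W) (Co W')"
proof -
  have inj: "inj_on h (topspace W)" and surj: "h ` topspace W = topspace W'"
    using homeo by (rule homeomorphic_imp_injective_map, rule homeomorphic_imp_surjective_map)
  have Co_iff: "h ` A \<in> Co W' \<longleftrightarrow> A \<in> Co W" if "A \<subseteq> topspace W" for A
    using homeomorphic_map_openness[OF homeo that] homeomorphic_map_compactness[OF homeo that]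
    by (simp add: Co_def)
  have "h ` A \<in> Co W'" if "A \<in> Co W" for A
    using Co_iff[OF Co_subset_topspace] that by simp
  moreover have "B \<in> (`) h ` Co W" if B: "B \<in> Co W'" for B
  proof -
    have "B \<subseteq> h ` topspace W"
      using Co_subset_topspace[OF B] surj by simp
    then obtain A where "A \<subseteq> topspace W" "B = h ` A"
      by (rule subset_imageE)
    then show ?thesis using Co_iff B by blast
  qed
  moreover have "inj_on ((`) h) (Co W)"
    using inj_on_image_eq_iff[OF inj] Co_subset_topspace by (metis inj_onI)
  moreover have "h ` (A - B) = h ` A - h ` B" if "A \<in> Co W" "B \<in> Co W" for A B
    using Co_subset_topspace that by (intro inj_on_image_set_diff[OF inj]) auto
  ultimately show iso: "set_ring_iso ((`) h) (Co W) (Co W')"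
    unfolding set_ring_iso_def bij_betw_def by (auto simp: image_Un)
  have "Hausdorff_space W'"
    using Hausdorff homeomorphic_map_imp_homeomorphic_space[OF homeo] homeomorphic_Hausdorff_space by blast
  then have "Stone_space W'"
  proof (rule Stone_spaceI)
    fix V y assume V: "openin W' V" "y \<in> V"
    then obtain x where x: "x \<in> topspace W" "y = h x"
      using surj openin_subset by blast
    have "openin W {x \<in> topspace W. h x \<in> V}"
      using homeomorphic_imp_continuous_map[OF homeo] V(1) by (simp add: continuous_map)
    then obtain A where A: "A \<in> Co W" "x \<in> A" "A \<subseteq> {x \<in> topspace W. h x \<in> V}"
      using Co_base[of "{x \<in> topspace W. h x \<in> V}" x] x V(2) by auto
    then show "\<exists>A\<in>Co W'. y \<in> A \<and> A \<subseteq> V"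
      using set_ring_iso_mem[OF iso A(1)] x by (intro bexI[of _ "h ` A"]) auto
  qed
  then show "stone W'" by unfold_locales
qed

locale labelled_copy = labelled_full W P trim + right: stone W'
  for W :: "'a topology" and P :: "'p po_system" and trim and W' :: "'b topology" +
  fixes \<phi> :: "'a set \<Rightarrow> 'b set"
  assumes iso: "set_ring_iso \<phi> (Co W) (Co W')"
begin

definition copy_trim :: "'b set \<Rightarrow> 'p \<Rightarrow> bool" where
  "copy_trim B p \<longleftrightarrow> (\<exists>A. trim A p \<and> B = \<phi> A)"

lemmas iso_mem = set_ring_iso_mem[OF iso]
  and iso_Diff = set_ring_iso_Diff[OF iso]
  and iso_subset_iff = set_ring_iso_subset_iff[OF set_ring_Co iso]

lemma iso_eq_iff: "A \<in> Co W \<Longrightarrow> B \<in> Co W \<Longrightarrow> \<phi> A = \<phi> B \<longleftrightarrow> A = B"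
  using iso_subset_iff by (metis subset_antisym order_refl)

lemma iso_empty: "\<phi> {} = {}"
  using iso_Diff[of "{}" "{}"] by simp

lemma iso_disjoint_iff: "A \<in> Co W \<Longrightarrow> B \<in> Co W \<Longrightarrow> \<phi> A \<inter> \<phi> B = {} \<longleftrightarrow> A \<inter> B = {}"
  using set_ring_iso_Int[OF set_ring_Co iso, of A B] iso_eq_iff[of "A \<inter> B" "{}"] iso_empty by simp

lemma decomp_copy: "decomp trim A M \<Longrightarrow> decomp copy_trim (\<phi> A) M"
proof (induction rule: decomp.induct)
  case (decomp_insert X p A M)
  have Co: "X \<in> Co W" "A \<in> Co W"
    using trim_Co[OF decomp_insert(1)] decomp_Co[OF decomp_insert(2)] .
  have "copy_trim (\<phi> X) p"
    using decomp_insert(1) by (auto simp: copy_trim_def)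
  then have "decomp copy_trim (\<phi> X \<union> \<phi> A) (add_mset p M)"
    using decomp_insert(3,4) iso_disjoint_iff[OF Co] by (intro decomp.decomp_insert) auto
  then show ?case
    using set_ring_iso_Un[OF iso Co] by simp
qed (simp add: iso_empty decomp_empty)

lemma labelled_full_copy: "labelled_full W' P copy_trim"
proof
  have "Co W' = \<phi> ` Co W"
    using iso by (simp add: set_ring_iso_def bij_betw_def)
  then show "countable (Co W')"
    using countable_Co by simp
  show "po_system P" by (rule po)
  show "B \<in> Co W'" "B \<noteq> {}" "p \<in> points P" if "copy_trim B p" for B p
    using that trim_Co iso_mem trim_ne[of _ p] trim_point iso_eq_iff[of _ "{}"] iso_empty
    by (auto simp: copy_trim_def)
  show "p = q" if "copy_trim B p" "copy_trim B q" for B p q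
  proof -
    obtain A A' where "trim A p" "trim A' q" "\<phi> A = \<phi> A'"
      using \<open>copy_trim B p\<close> \<open>copy_trim B q\<close> by (auto simp: copy_trim_def)
    moreover from this have "A = A'"
      using iso_eq_iff[OF trim_Co trim_Co] by blast
    ultimately show ?thesis
      using trim_unique by simp
  qed
  show "\<exists>M. decomp copy_trim B M" if B: "B \<in> Co W'" for B
  proof -
    obtain A where A: "A \<in> Co W" "\<phi> A = B"
      using set_ring_iso_surj[OF iso B] by auto
    obtain M where "decomp trim A M"
      using decomposable[OF A(1)] by auto
    then show ?thesis
      using decomp_copy A(2) by auto
  qed
  show "copy_trim D p \<and> (\<forall>E q. copy_trim E q \<longrightarrow> E \<subseteq> B - D \<longrightarrow> p \<prec>\<^sub>P q) \<or>
      copy_trim (B - D) p \<and> (\<forall>E q. copy_trim E q \<longrightarrow> E \<subseteq> D \<longrightarrow> p \<prec>\<^sub>P q)"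
    if B: "copy_trim B p" and D: "D \<in> Co W'" "D \<subseteq> B" for B p D
  proof -
    obtain A where A: "trim A p" "B = \<phi> A"
      using B by (auto simp: copy_trim_def)
    obtain C where C: "C \<in> Co W" "D = \<phi> C"
      using set_ring_iso_surj[OF iso D(1)] by auto
    note CoA = trim_Co[OF A(1)]
    have CA: "C \<subseteq> A"
      using iso_subset_iff[OF C(1) CoA] D(2) A(2) C(2) by simp
    have BD: "B - D = \<phi> (A - C)"
      using iso_Diff[OF CoA C(1)] A(2) C(2) by simp
    have sub: "E' \<subseteq> X" if "trim E' q" "\<phi> E' \<subseteq> \<phi> X" "X \<in> Co W" for E' q X
      using iso_subset_iff[OF trim_Co[OF that(1)] that(3)] that(2) by simp
    show ?thesis
      using trim_split[OF A(1) C(1) CA]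
    proof (elim disjE conjE)
      assume "trim C p" and *: "\<forall>D q. trim D q \<longrightarrow> D \<subseteq> A - C \<longrightarrow> p \<prec>\<^sub>P q"
      then have "copy_trim D p"
        using C(2) by (auto simp: copy_trim_def)
      moreover have "p \<prec>\<^sub>P q" if "copy_trim E q" "E \<subseteq> B - D" for E q
        using that * sub[of _ q "A - C"] CoA C(1) unfolding BD copy_trim_def by auto
      ultimately show ?thesis by blast
    next
      assume "trim (A - C) p" and *: "\<forall>D q. trim D q \<longrightarrow> D \<subseteq> C \<longrightarrow> p \<prec>\<^sub>P q"
      then have "copy_trim (B - D) p"
        using BD by (auto simp: copy_trim_def)
      moreover have "p \<prec>\<^sub>P q" if "copy_trim E q" "E \<subseteq> D" for E q
        using that * sub[of _ q C] C(1) unfolding C(2) copy_trim_def by auto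
      ultimately show ?thesis by blast
    qed
  qed
  show "\<exists>C\<subseteq>B. copy_trim C q \<and> copy_trim (B - C) p"
    if B: "copy_trim B p" and less: "p \<prec>\<^sub>P q" for B p q
  proof -
    obtain A where A: "trim A p" "B = \<phi> A"
      using B by (auto simp: copy_trim_def)
    obtain C where C: "C \<subseteq> A" "trim C q" "trim (A - C) p"
      using trim_absorb[OF A(1) less] by auto
    have "B - \<phi> C = \<phi> (A - C)" "\<phi> C \<subseteq> B"
      using iso_Diff[OF trim_Co[OF A(1)] trim_Co[OF C(2)]] C(1) A(2)
        iso_subset_iff[OF trim_Co[OF C(2)] trim_Co[OF A(1)]] by simp_all
    then show ?thesis
      using C A(2) unfolding copy_trim_def by (intro exI[of _ "\<phi> C"]) auto
  qed
  show "\<exists>B. copy_trim B p" if "p \<in> points P" for p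
    using label_occurs[OF that] by (auto simp: copy_trim_def)
qed

sublocale copied: labelled_full W' P copy_trim
  by (rule labelled_full_copy)

lemma meets_copy_iff:
  assumes K: "K \<in> Co W"
  shows "(\<forall>B. copy_trim B p \<longrightarrow> B \<inter> \<phi> K \<noteq> {}) \<longleftrightarrow> (\<forall>A. trim A p \<longrightarrow> A \<inter> K \<noteq> {})"
  using iso_disjoint_iff[OF trim_Co K] unfolding copy_trim_def by metis

lemma compact_labels_copy: "copied.compact_labels = compact_labels"
proof -
  have "(\<exists>K\<in>Co W'. \<forall>B. copy_trim B p \<longrightarrow> B \<inter> K \<noteq> {}) \<longleftrightarrow> (\<exists>K\<in>Co W. \<forall>A. trim A p \<longrightarrow> A \<inter> K \<noteq> {})" for p
    using meets_copy_iff[of _ p] set_ring_iso_surj[OF iso] iso_mem by metis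
  then show ?thesis
    using compact_labels_iff copied.compact_labels_iff by auto
qed

lemma bounded_labels_copy: "bounded_labels \<Longrightarrow> copied.bounded_labels"
  unfolding bounded_labels_def copied.bounded_labels_def compact_labels_copy
  using meets_copy_iff iso_mem by metis

text \<open>
  The points are counted through a decomposition, which the isomorphism of the rings transports.
\<close>

lemma label_count_copy:
  assumes "p \<in> minimal_irrefl_points P compact_labels"
  shows "copied.label_count p = label_count p"
proof -
  have p: "p \<in> compact_labels" "(p, p) \<notin> less_rel P" "\<forall>r\<in>points P. po_le P r p \<longrightarrow> r = p"
    using assms by (auto simp: minimal_irrefl_iff)
  obtain K where K: "K \<in> Co W" "\<forall>A. trim A p \<longrightarrow> A \<inter> K \<noteq> {}"
    using p(1) by (auto simp: compact_labels_iff)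
  obtain M where M: "decomp trim K M"
    using decomposable[OF K(1)] by auto
  have "\<forall>r\<in>#M. po_le P r p \<longrightarrow> r = p"
    using p(3) decomp_labels[OF M] by auto
  then show ?thesis
    using label_count_eq(1)[OF M K(2) p(2)] copied.label_count_eq(1)[OF decomp_copy[OF M] _ p(2)]
      K(2) meets_copy_iff[OF K(1)] by simp
qed

end

section \<open>Spaces of branches\<close>

text \<open>A word is a list of numbered labels, the most recent letter first.\<close>

type_synonym 'q word = "(nat \<times> 'q) list"

text \<open>
  The nodes of the forest are words of labels that increase along \<open>P\<close>, starting with a
  root. Each node with label \<open>p\<close> has infinitely many children for every
  \<open>q\<close> strictly above \<open>p\<close>, and a reflexive \<open>p\<close> has children
  with its own label. The points of the space are the finite and infinite branches, and the children
  of a node converge to the branch ending there; so the sets of branches through a node, with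
  finitely many children left out, are compact and carry the label of the node.
\<close>

locale forest =
  fixes P :: "'q po_system" and root :: "(nat \<times> 'q) set"
  assumes po: "po_system P" and countable_points: "countable (points P)"
    and root_points: "root \<subseteq> UNIV \<times> points P"
    and root_below: "p \<in> points P \<Longrightarrow> \<exists>r\<in>root. po_le P (snd r) p"
begin

fun adm :: "'q word \<Rightarrow> bool" where
  "adm [] \<longleftrightarrow> False"
| "adm [c] \<longleftrightarrow> c \<in> root"
| "adm (c # d # v) \<longleftrightarrow> (snd d, snd c) \<in> less_rel P \<and> adm (d # v)"

definition lab :: "'q word \<Rightarrow> 'q" where
  "lab w = snd (hd w)"

text \<open>
  A branch is represented by the predicate that holds for its nodes, and a finite branch by the
  nonempty suffixes of its last node, since the most recent letter stands first. The empty branch is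
  admitted here and is excluded from the space \<open>W\<close>; it is the limit of branches in
  infinitely many different trees.
\<close>

definition branch :: "('q word \<Rightarrow> bool) \<Rightarrow> bool" where
  "branch x \<longleftrightarrow> (\<forall>w. x w \<longrightarrow> adm w) \<and> (\<forall>v c. x (c # v) \<longrightarrow> v \<noteq> [] \<longrightarrow> x v) \<and>
     (\<forall>u v. x u \<longrightarrow> x v \<longrightarrow> suffix u v \<or> suffix v u)"

definition pt :: "'q word \<Rightarrow> 'q word \<Rightarrow> bool" where
  "pt w = (\<lambda>u. u \<noteq> [] \<and> suffix u w)"

definition Cantor :: "('q word \<Rightarrow> bool) topology" where
  "Cantor = product_topology (\<lambda>_. discrete_topology UNIV) UNIV"

definition W :: "('q word \<Rightarrow> bool) topology" where
  "W = subtopology Cantor {x. branch x \<and> (\<exists>w. x w)}"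

definition V :: "'q word \<Rightarrow> (nat \<times> 'q) set \<Rightarrow> ('q word \<Rightarrow> bool) set" where
  "V w F = {x. branch x \<and> x w \<and> (\<forall>c\<in>F. \<not> x (c # w))}"

lemma adm_not_Nil: "adm w \<Longrightarrow> w \<noteq> []"
  by auto

lemma adm_Cons: "w \<noteq> [] \<Longrightarrow> adm (c # w) \<longleftrightarrow> (lab w, snd c) \<in> less_rel P \<and> adm w"
  by (cases w) (auto simp: lab_def)

lemma adm_suffix: "adm v \<Longrightarrow> suffix u v \<Longrightarrow> u \<noteq> [] \<Longrightarrow> adm u"
proof (induction v)
  case (Cons c v)
  show ?case
  proof (cases "u = c # v")
    case False
    then have u: "suffix u v" using Cons(3) by (simp add: suffix_Cons)
    then have "v \<noteq> []" using Cons(4) by auto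
    then show ?thesis using Cons u adm_Cons by blast
  qed (use Cons in simp)
qed simp

lemma lab_suffix: "adm v \<Longrightarrow> suffix u v \<Longrightarrow> u \<noteq> [] \<Longrightarrow> u \<noteq> v \<Longrightarrow> (lab u, lab v) \<in> less_rel P"
proof (induction v)
  case (Cons c v)
  then have u: "suffix u v" by (simp add: suffix_Cons)
  then have v: "v \<noteq> []" using Cons(4) by auto
  then have less: "(lab v, lab (c # v)) \<in> less_rel P" and av: "adm v"
    using Cons(2) adm_Cons by (auto simp: lab_def)
  show ?case
  proof (cases "u = v")
    case False
    then have "(lab u, lab v) \<in> less_rel P"
      using Cons.IH[OF av u Cons(4)] by simp
    then show ?thesis
      using less po by (auto simp: po_system_def dest: transD)
  qed (use less in simp)
qed simp

lemma adm_last: "adm w \<Longrightarrow> last w \<in> root"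
  by (induction w rule: adm.induct) auto

lemma adm_letters: "adm w \<Longrightarrow> w \<in> lists (UNIV \<times> points P)"
proof (induction w rule: adm.induct)
  case (2 c)
  then show ?case using root_points by auto
next
  case (3 c d v)
  then have "snd c \<in> points P"
    using po by (auto simp: po_system_def)
  then show ?case using 3 by (auto simp: mem_Times_iff)
qed simp

lemma lab_points: "adm w \<Longrightarrow> lab w \<in> points P"
  using adm_letters[of w] by (cases w) (auto simp: lab_def)

lemma branchD: "branch x \<Longrightarrow> x w \<Longrightarrow> adm w"
  by (auto simp: branch_def)

lemma branch_suffix: "branch x \<Longrightarrow> x v \<Longrightarrow> suffix u v \<Longrightarrow> u \<noteq> [] \<Longrightarrow> x u"
proof (induction v)
  case (Cons c v)
  show ?case
  proof (cases "u = c # v")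
    case False
    then have u: "suffix u v" using Cons(4) by (simp add: suffix_Cons)
    then have "v \<noteq> []" using Cons(5) by auto
    then have "x v" using Cons(2,3) unfolding branch_def by blast
    then show ?thesis using Cons u by blast
  qed (use Cons in simp)
qed simp

lemma branch_comparable: "branch x \<Longrightarrow> x u \<Longrightarrow> x v \<Longrightarrow> suffix u v \<or> suffix v u"
  unfolding branch_def by blast

lemma branch_length_eq: "branch x \<Longrightarrow> x u \<Longrightarrow> x v \<Longrightarrow> length u = length v \<Longrightarrow> u = v"
  using branch_comparable[of x u v] by (auto simp: suffix_def)

lemma branch_child_unique: "branch x \<Longrightarrow> x (c # w) \<Longrightarrow> x (d # w) \<Longrightarrow> c = d"
  using branch_length_eq[of x "c # w" "d # w"] by simp

lemma branch_pt: "adm w \<Longrightarrow> branch (pt w)"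
  unfolding branch_def pt_def
proof (intro conjI allI impI)
  show "suffix u v \<or> suffix v u" if "u \<noteq> [] \<and> suffix u w" "v \<noteq> [] \<and> suffix v w" for u v
    using suffix_same_cases[of u w v] that by blast
qed (auto intro: adm_suffix dest: suffix_ConsD)

lemma pt_self: "adm w \<Longrightarrow> pt w w"
  using adm_not_Nil by (auto simp: pt_def)

lemma not_pt_child: "\<not> pt w (c # w)"
  by (auto simp: pt_def dest: suffix_length_le)

subsection \<open>The topology\<close>

lemma topspace_Cantor: "topspace Cantor = UNIV"
  by (simp add: Cantor_def)

lemma compact_Cantor: "compact_space Cantor"
  unfolding Cantor_def compact_space_product_topology
  by (simp add: compact_space_discrete_topology)

lemma Hausdorff_Cantor: "Hausdorff_space Cantor"
  by (simp add: Cantor_def Hausdorff_space_product_topology)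

lemma openin_coordinate: "openin Cantor {x. Q (x w)}"
proof -
  have "continuous_map Cantor (discrete_topology UNIV) (\<lambda>x. x w)"
    unfolding Cantor_def by (rule continuous_map_product_projection) simp
  then have "openin Cantor {x \<in> topspace Cantor. x w \<in> Collect Q}"
    by (rule openin_continuous_map_preimage) simp
  then show ?thesis by (simp add: topspace_Cantor)
qed

lemma closedin_coordinate: "closedin Cantor {x. Q (x w)}"
proof -
  have "topspace Cantor - {x. Q (x w)} = {x. \<not> Q (x w)}"
    by (auto simp: topspace_Cantor)
  then show ?thesis
    using openin_coordinate[of "\<lambda>b. \<not> Q b" w] by (simp add: closedin_def topspace_Cantor)
qed

lemma closedin_all:
  assumes "\<And>i. closedin Cantor {x. Q i x}"
  shows "closedin Cantor {x. \<forall>i. Q i x}"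
proof -
  have "closedin Cantor (\<Inter>i. {x. Q i x})"
    using assms by (intro closedin_Inter) auto
  moreover have "(\<Inter>i. {x. Q i x}) = {x. \<forall>i. Q i x}" by auto
  ultimately show ?thesis by simp
qed

lemma closedin_imp:
  assumes "closedin Cantor {x. Q x}"
  shows "closedin Cantor {x. x w \<longrightarrow> Q x}"
proof -
  have "{x. x w \<longrightarrow> Q x} = {x. \<not> x w} \<union> {x. Q x}" by auto
  then show ?thesis
    using closedin_coordinate[of Not w] assms by (simp add: closedin_Un)
qed

lemma closedin_const: "closedin Cantor {x. b}"
  using closedin_coordinate[of "\<lambda>_. b" undefined] by simp

text \<open>
  Each of the conditions on a branch involves only finitely many coordinates.
\<close>

lemma closedin_branches: "closedin Cantor {x. branch x}"
proof -
  have "closedin Cantor {x. \<forall>w. x w \<longrightarrow> adm w}"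
    by (intro closedin_all closedin_imp closedin_const)
  moreover have "closedin Cantor {x. \<forall>v c. x (c # v) \<longrightarrow> v \<noteq> [] \<longrightarrow> x v}"
    using closedin_coordinate[of "\<lambda>b. _ \<longrightarrow> b"] by (intro closedin_all closedin_imp) auto
  moreover have "closedin Cantor {x. \<forall>u v. x u \<longrightarrow> x v \<longrightarrow> suffix u v \<or> suffix v u}"
    by (intro closedin_all closedin_imp closedin_const)
  ultimately have "closedin Cantor ({x. \<forall>w. x w \<longrightarrow> adm w} \<inter>
      ({x. \<forall>v c. x (c # v) \<longrightarrow> v \<noteq> [] \<longrightarrow> x v} \<inter>
       {x. \<forall>u v. x u \<longrightarrow> x v \<longrightarrow> suffix u v \<or> suffix v u}))"
    by (intro closedin_Int)
  then show ?thesis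
    by (simp add: branch_def Collect_conj_eq)
qed

lemma V_subset: "V w F \<subseteq> {x. branch x \<and> (\<exists>w. x w)}"
  unfolding V_def by blast

lemma topspace_W: "topspace W = {x. branch x \<and> (\<exists>w. x w)}"
  unfolding W_def topspace_subtopology topspace_Cantor by simp

lemma V_Co:
  assumes "finite F"
  shows "V w F \<in> Co W"
proof -
  define B where "B = {x :: 'q word \<Rightarrow> bool. x w \<and> (\<forall>c\<in>F. \<not> x (c # w))}"
  have B_eq: "B = \<Inter>(insert {x. x w} ((\<lambda>c. {x. \<not> x (c # w)}) ` F))"
    by (auto simp: B_def)
  have op_B: "openin Cantor B"
    unfolding B_eq using assms openin_coordinate[of "\<lambda>b. b"] openin_coordinate[of Not]
    by (intro openin_Inter) auto
  have cl_B: "closedin Cantor B"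
    unfolding B_eq using closedin_coordinate[of "\<lambda>b. b"] closedin_coordinate[of Not]
    by (intro closedin_Inter) auto
  have V1: "V w F = {x. branch x} \<inter> B" and V2: "V w F = B \<inter> {x. branch x \<and> (\<exists>w. x w)}"
    unfolding V_def B_def by blast+
  have op: "openin W (V w F)"
    unfolding W_def openin_subtopology using V2 op_B by metis
  have "closedin Cantor (V w F)"
    unfolding V1 by (rule closedin_Int[OF closedin_branches cl_B])
  then have "compactin Cantor (V w F)"
    using closedin_compact_space[OF compact_Cantor] by simp
  then have "compactin W (V w F)"
    using V_subset by (simp add: W_def compactin_subtopology)
  then show ?thesis
    using op by (simp add: Co_def)
qed

text \<open>
  A basic open set constrains finitely many words \<open>Z\<close>. For \<open>w\<close> choose a
  node of the branch that is longer than all of them, or else the last node. The words in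
  \<open>Z\<close> that extend \<open>w\<close> without belonging to the branch are then excluded by
  leaving out the children of \<open>w\<close> below them.
\<close>

lemma V_base:
  assumes U: "openin W U" and x: "x \<in> U"
  obtains w F where "finite F" "x \<in> V w F" "V w F \<subseteq> U"
proof -
  obtain G where G: "openin Cantor G" "U = G \<inter> {x. branch x \<and> (\<exists>w. x w)}"
    using U by (auto simp: W_def openin_subtopology)
  have bx: "branch x" "\<exists>w. x w" "x \<in> G"
    using x G(2) by auto
  obtain H where H: "finite {i. H i \<noteq> UNIV}" "x \<in> Pi\<^sub>E UNIV H" "Pi\<^sub>E UNIV H \<subseteq> G"
    using G(1) bx(3) unfolding Cantor_def openin_product_topology_alt by auto
  define Z where "Z = {i. H i \<noteq> UNIV}"
  have Z: "finite Z" using H(1) by (simp add: Z_def)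
  have agree: "y \<in> G" if "\<And>z. z \<in> Z \<Longrightarrow> y z = x z" for y
  proof -
    have "y i \<in> H i" for i
      using that[of i] H(2) by (cases "i \<in> Z") (auto simp: Z_def PiE_iff)
    then show ?thesis
      using H(3) by (auto simp: PiE_iff)
  qed
  obtain N where N: "\<And>z. z \<in> Z \<Longrightarrow> length z \<le> N"
    using Z by (metis finite_imageI finite_nat_set_iff_bounded_le imageI)
  have "\<exists>w. x w \<and> (N < length w \<or> (\<forall>v. x v \<longrightarrow> length v \<le> length w))"
  proof (cases "\<exists>w. x w \<and> N < length w")
    case False
    obtain w0 where w0: "x w0" using bx(2) by (elim exE)
    have "\<forall>v. x v \<longrightarrow> length v < Suc N"
      using False by (simp add: not_less less_Suc_eq_le)
    from ex_has_greatest_nat[of x w0 length "Suc N", OF w0 this] show ?thesis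
      by (elim exE conjE) (intro exI conjI disjI2)
  next
    case True
    then show ?thesis
      by (elim exE conjE) (intro exI conjI disjI1)
  qed
  then obtain w where w: "x w" "N < length w \<or> (\<forall>v. x v \<longrightarrow> length v \<le> length w)"
    by (elim exE conjE)
  have w_ne: "w \<noteq> []"
    using branchD[OF bx(1) w(1)] adm_not_Nil by simp
  define F where "F = {c. \<not> x (c # w) \<and> (\<exists>z\<in>Z. suffix (c # w) z)}"
  have "F \<subseteq> (\<Union>z\<in>Z. set z)"
    by (auto simp: F_def suffix_def)
  then have "finite F"
    using Z by (meson finite_UN finite_set finite_subset)
  moreover have "x \<in> V w F"
    using bx(1) w(1) by (auto simp: V_def F_def)
  moreover have "V w F \<subseteq> U"
  proof
    fix y assume "y \<in> V w F"
    then have y: "branch y" "y w" "\<And>c. c \<in> F \<Longrightarrow> \<not> y (c # w)"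
      by (auto simp: V_def)
    have "y z = x z" if z: "z \<in> Z" for z
    proof
      assume yz: "y z"
      have zne: "z \<noteq> []"
        using branchD[OF y(1) yz] adm_not_Nil by simp
      show "x z"
      proof (cases "suffix z w")
        case True
        then show ?thesis using branch_suffix[OF bx(1) w(1) _ zne] by simp
      next
        case False
        then have "suffix w z"
          using branch_comparable[OF y(1) yz y(2)] by simp
        then obtain u where u: "z = u @ w" by (auto simp: suffix_def)
        with False have "u \<noteq> []" by auto
        then obtain u' c where "u = u' @ [c]" by (metis rev_exhaust)
        then have suf: "suffix (c # w) z"
          using u by (auto simp: suffix_def)
        have "y (c # w)"
          using branch_suffix[OF y(1) yz suf] by simp
        then have xc: "x (c # w)"
          using y(3)[of c] z suf unfolding F_def by blast
        then have "N < length w"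
          using w(2) by (metis Suc_n_not_le_n length_Cons)
        then show ?thesis
          using N[OF z] suffix_length_le[OF suf] by simp
      qed
    next
      assume xz: "x z"
      have "length z \<le> length w"
        using w(2) N[OF z] xz by auto
      then have "suffix z w"
        using branch_comparable[OF bx(1) xz w(1)] by (auto simp: suffix_def)
      then show "y z"
        using branch_suffix[OF y(1,2)] branchD[OF bx(1) xz] adm_not_Nil by auto
    qed
    then show "y \<in> U"
      using agree y G(2) by auto
  qed
  ultimately show ?thesis using that by blast
qed

lemma Stone_W: "Stone_space W"
proof (rule Stone_spaceI)
  show "Hausdorff_space W"
    unfolding W_def by (rule Hausdorff_space_subtopology[OF Hausdorff_Cantor])
  show "\<exists>A\<in>Co W. x \<in> A \<and> A \<subseteq> U" if U: "openin W U" "x \<in> U" for U x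
  proof -
    obtain w F where "finite F" "x \<in> V w F" "V w F \<subseteq> U"
      using V_base[OF U] .
    then show ?thesis
      using V_Co by (intro bexI[of _ "V w F"]) auto
  qed
qed

sublocale stone W
  using Stone_W by unfold_locales

lemma V_nested:
  assumes "x \<in> V w F" "x \<in> V w' F'" "suffix w w'" "w \<noteq> w'"
  shows "V w' F' \<subseteq> V w F"
proof -
  have x: "branch x" "x w" "x w'" "\<forall>c\<in>F. \<not> x (c # w)"
    using assms(1,2) by (auto simp: V_def)
  obtain u where "w' = u @ w" "u \<noteq> []"
    using assms(3,4) by (auto simp: suffix_def)
  then obtain u' c where "w' = u' @ c # w"
    by (metis append.assoc append_Cons append_Nil rev_exhaust)
  then have suf: "suffix (c # w) w'"
    by (auto simp: suffix_def)
  have wne: "w \<noteq> []"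
    using branchD[OF x(1,2)] adm_not_Nil by simp
  have "c \<notin> F"
    using branch_suffix[OF x(1,3) suf] x(4) by auto
  show ?thesis
  proof
    fix y assume "y \<in> V w' F'"
    then have y: "branch y" "y w'" by (auto simp: V_def)
    have yc: "y (c # w)"
      using branch_suffix[OF y suf] by simp
    have "y w"
      using branch_suffix[OF y assms(3) wne] .
    moreover have "\<not> y (d # w)" if "d \<in> F" for d
      using branch_child_unique[OF y(1) yc, of d] that \<open>c \<notin> F\<close> by auto
    ultimately show "y \<in> V w F"
      using y(1) by (auto simp: V_def)
  qed
qed

lemma V_Un_same: "V w F \<union> V w F' = V w (F \<inter> F')"
proof (intro equalityI subsetI)
  fix x assume x: "x \<in> V w (F \<inter> F')"
  then have bx: "branch x" "x w" by (auto simp: V_def)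
  show "x \<in> V w F \<union> V w F'"
  proof (cases "\<exists>c\<in>F. x (c # w)")
    case True
    then obtain c where c: "c \<in> F" "x (c # w)" by auto
    then have "c \<notin> F'" using x by (auto simp: V_def)
    then have "\<not> x (d # w)" if "d \<in> F'" for d
      using branch_child_unique[OF bx(1) c(2), of d] that by auto
    then show ?thesis using bx by (simp add: V_def)
  qed (use bx in \<open>simp add: V_def\<close>)
qed (auto simp: V_def)

definition letters :: "(nat \<times> 'q) set" where
  "letters = UNIV \<times> points P"

definition basics :: "('q word \<Rightarrow> bool) set set" where
  "basics = {V w F | w F. adm w \<and> finite F \<and> F \<subseteq> letters}"

lemma V_in_basics:
  assumes "finite F" "x \<in> V w F"
  shows "V w F \<in> basics"
proof -
  have "adm w"
    using assms(2) branchD by (auto simp: V_def)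
  have "c \<in> letters" if "branch y" "y (c # w)" for y c
    using adm_letters[OF branchD[OF that]] by (simp add: letters_def)
  then have "V w F = V w (F \<inter> letters)"
    by (auto simp: V_def)
  then show ?thesis
    using \<open>adm w\<close> assms(1) unfolding basics_def by blast
qed

lemma basics_Un:
  assumes "X \<in> basics" "Y \<in> basics" "X \<inter> Y \<noteq> {}"
  shows "X \<union> Y \<in> basics"
proof -
  obtain w F w' F' where w: "X = V w F" "Y = V w' F'" "finite F" "finite F'"
    using assms(1,2) by (auto simp: basics_def)
  obtain x where x: "x \<in> V w F" "x \<in> V w' F'"
    using assms(3) w by auto
  have "suffix w w' \<or> suffix w' w"
    using x branch_comparable by (auto simp: V_def)
  then consider "w = w'" | "suffix w w'" "w \<noteq> w'" | "suffix w' w" "w' \<noteq> w" by auto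
  then show ?thesis
  proof cases
    case 1
    then show ?thesis
      using V_Un_same[of w F F'] V_in_basics[of "F \<inter> F'" x w] x w by auto
  next
    case 2
    then show ?thesis
      using V_nested[OF x 2] assms(1) w by (simp add: Un_absorb2)
  next
    case 3
    then show ?thesis
      using V_nested[OF x(2,1) 3] assms(2) w by (simp add: Un_absorb1)
  qed
qed

text \<open>
  Two basic sets that meet have a basic union, so merging them makes the family smaller.
\<close>

lemma basics_disjoint_union:
  assumes "finite F" "F \<subseteq> basics"
  shows "\<exists>G\<subseteq>basics. finite G \<and> disjoint G \<and> \<Union>G = \<Union>F"
  using assms
proof (induction "card F" arbitrary: F rule: less_induct)
  case less
  show ?case
  proof (cases "disjoint F")
    case False
    then obtain X Y where XY: "X \<in> F" "Y \<in> F" "X \<noteq> Y" "X \<inter> Y \<noteq> {}"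
      unfolding pairwise_def disjnt_def by blast
    define F' where "F' = insert (X \<union> Y) (F - {X, Y})"
    have fin: "finite F" by fact
    have "card F' \<le> Suc (card (F - {X, Y}))"
      using fin by (simp add: F'_def card_insert_if)
    also have "card (F - {X, Y}) = card F - 2"
      using XY by (simp add: card_Diff_subset)
    finally have "card F' < card F"
      using XY(3) card_mono[OF fin, of "{X, Y}"] XY(1,2) by simp
    moreover have "F' \<subseteq> basics"
      using basics_Un XY less(3) by (auto simp: F'_def)
    ultimately have "\<exists>G\<subseteq>basics. finite G \<and> disjoint G \<and> \<Union>G = \<Union>F'"
      using less(1)[of F'] less(2) by (simp add: F'_def)
    moreover have "\<Union>F' = \<Union>F"
      using XY by (auto simp: F'_def)
    ultimately show ?thesis by simp
  qed (use less in blast)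
qed

lemma Co_basics:
  assumes A: "A \<in> Co W"
  shows "\<exists>G\<subseteq>basics. finite G \<and> disjoint G \<and> \<Union>G = A"
proof -
  define C where "C = {B \<in> basics. B \<subseteq> A}"
  have "A \<subseteq> \<Union>C"
  proof
    fix x assume x: "x \<in> A"
    obtain w F where wF: "finite F" "x \<in> V w F" "V w F \<subseteq> A"
      using V_base[OF Co_openin[OF A] x] .
    have "V w F \<in> C"
      using V_in_basics[OF wF(1,2)] wF(3) by (simp add: C_def)
    then show "x \<in> \<Union>C"
      using wF(2) by (rule UnionI)
  qed
  moreover have "openin W B" if "B \<in> C" for B
    using that V_Co Co_openin by (auto simp: C_def basics_def)
  ultimately obtain F where F: "finite F" "F \<subseteq> C" "A \<subseteq> \<Union>F"
    using compactinD[OF Co_compactin[OF A], of C] by auto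
  have "\<Union>F = A" "F \<subseteq> basics"
    using F(2,3) by (auto simp: C_def)
  then show ?thesis
    using basics_disjoint_union[OF F(1)] by simp
qed

lemma countable_Co_W: "countable (Co W)"
proof -
  have let_ctb: "countable letters"
    using countable_points by (simp add: letters_def)
  have "basics \<subseteq> (\<lambda>(w, F). V w F) ` (lists letters \<times> {F. finite F \<and> F \<subseteq> letters})"
    using adm_letters unfolding basics_def letters_def[symmetric] by auto
  moreover have "countable (lists letters \<times> {F. finite F \<and> F \<subseteq> letters})"
    using let_ctb by (intro countable_SIGMA countable_lists countable_Collect_finite_subset)
  ultimately have "countable basics"
    by (meson countable_image countable_subset)
  then have "countable {G. finite G \<and> G \<subseteq> basics}"
    by (rule countable_Collect_finite_subset)
  moreover have "Co W \<subseteq> \<Union> ` {G. finite G \<and> G \<subseteq> basics}"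
    using Co_basics by blast
  ultimately show ?thesis
    by (meson countable_image countable_subset)
qed

subsection \<open>The labelling\<close>

text \<open>
  The set contains the finite branch ending in some node labelled \<open>p\<close>, and all other
  finite branches in it have labels strictly above \<open>p\<close>. When the set is cut, the part
  containing this branch keeps the label.
\<close>

definition trim :: "('q word \<Rightarrow> bool) set \<Rightarrow> 'q \<Rightarrow> bool" where
  "trim A p \<longleftrightarrow> A \<in> Co W \<and> (\<exists>w. adm w \<and> pt w \<in> A \<and> lab w = p \<and>
     (\<forall>v. adm v \<longrightarrow> pt v \<in> A \<longrightarrow> v \<noteq> w \<longrightarrow> (p, lab v) \<in> less_rel P))"

lemma pt_in_V: "adm w \<Longrightarrow> pt w \<in> V w F"
  using branch_pt pt_self not_pt_child by (auto simp: V_def)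

lemma trim_V:
  assumes "adm w" "finite F"
  shows "trim (V w F) (lab w)"
proof -
  have "(lab w, lab v) \<in> less_rel P" if "adm v" "pt v \<in> V w F" "v \<noteq> w" for v
    using lab_suffix[OF that(1), of w] that adm_not_Nil[OF assms(1)] by (auto simp: V_def pt_def)
  then show ?thesis
    unfolding trim_def using V_Co[OF assms(2)] pt_in_V[OF assms(1)] assms(1) by blast
qed

lemma V_inside:
  assumes A: "A \<in> Co W" and w: "adm w" "pt w \<in> A"
  shows "\<exists>F. finite F \<and> V w F \<subseteq> A"
proof -
  obtain w' F' where V: "finite F'" "pt w \<in> V w' F'" "V w' F' \<subseteq> A"
    using V_base[OF Co_openin[OF A] w(2)] .
  have suf: "suffix w' w"
    using V(2) by (auto simp: V_def pt_def)
  show ?thesis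
  proof (cases "w' = w")
    case False
    then have "V w {} \<subseteq> V w' F'"
      using V_nested[OF V(2) pt_in_V[OF w(1)] suf] by simp
    then show ?thesis using V(3) by blast
  qed (use V in blast)
qed

theorem labelled_full_W: "labelled_full W P trim"
proof
  show "countable (Co W)" by (rule countable_Co_W)
  show "po_system P" by (rule po)
  show "A \<in> Co W" "A \<noteq> {}" "p \<in> points P" if "trim A p" for A p
    using that lab_points by (auto simp: trim_def)
  show "p = q" if A: "trim A p" "trim A q" for A p q
  proof -
    obtain w where w: "adm w" "pt w \<in> A" "lab w = p" "\<forall>v. adm v \<longrightarrow> pt v \<in> A \<longrightarrow> v \<noteq> w \<longrightarrow> (p, lab v) \<in> less_rel P"
      using A(1) unfolding trim_def by metis
    obtain v where v: "adm v" "pt v \<in> A" "lab v = q" "\<forall>w. adm w \<longrightarrow> pt w \<in> A \<longrightarrow> w \<noteq> v \<longrightarrow> (q, lab w) \<in> less_rel P"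
      using A(2) unfolding trim_def by metis
    show "p = q"
    proof (cases "v = w")
      case False
      then have "(p, q) \<in> less_rel P" "(q, p) \<in> less_rel P"
        using w v by metis+
      then show ?thesis
        using po by (auto simp: po_system_def dest: antisymD)
    qed (use w v in simp)
  qed
  show "\<exists>M. decomp trim A M" if A: "A \<in> Co W" for A
  proof -
    obtain G where G: "G \<subseteq> basics" "finite G" "disjoint G" "\<Union>G = A"
      using Co_basics[OF A] by auto
    have "\<exists>p. trim X p" if X: "X \<in> G" for X
    proof -
      obtain w F where "X = V w F" "adm w" "finite F"
        using X G(1) by (auto simp: basics_def)
      then show ?thesis
        using trim_V by blast
    qed
    then show ?thesis
      using decomp_Union[of G trim] G by simp
  qed
  show "trim B p \<and> (\<forall>D q. trim D q \<longrightarrow> D \<subseteq> A - B \<longrightarrow> (p, q) \<in> less_rel P) \<or>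
      trim (A - B) p \<and> (\<forall>D q. trim D q \<longrightarrow> D \<subseteq> B \<longrightarrow> (p, q) \<in> less_rel P)"
    if A: "trim A p" and B: "B \<in> Co W" "B \<subseteq> A" for A p B
  proof -
    obtain w where w: "adm w" "pt w \<in> A" "lab w = p" "\<forall>v. adm v \<longrightarrow> pt v \<in> A \<longrightarrow> v \<noteq> w \<longrightarrow> (p, lab v) \<in> less_rel P"
      using A unfolding trim_def by metis
    have in1: "trim X p" if "X \<in> Co W" "X \<subseteq> A" "pt w \<in> X" for X
      unfolding trim_def using that w by blast
    have out: "(p, q) \<in> less_rel P" if D: "trim D q" "D \<subseteq> A" "pt w \<notin> D" for D q
    proof -
      obtain v where "adm v" "pt v \<in> D" "lab v = q"
        using D(1) unfolding trim_def by metis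
      then show ?thesis using w(4) D(2,3) by blast
    qed
    have "A - B \<in> Co W"
      using A B by (simp add: trim_def)
    then show ?thesis
      using in1[of B] in1[of "A - B"] out B w(2) by (cases "pt w \<in> B") auto
  qed
  show "\<exists>B\<subseteq>A. trim B q \<and> trim (A - B) p"
    if A: "trim A p" and less: "(p, q) \<in> less_rel P" for A p q
  proof -
    obtain w where w: "adm w" "pt w \<in> A" "lab w = p" "\<forall>v. adm v \<longrightarrow> pt v \<in> A \<longrightarrow> v \<noteq> w \<longrightarrow> (p, lab v) \<in> less_rel P"
      using A unfolding trim_def by metis
    have CoA: "A \<in> Co W" using A by (simp add: trim_def)
    obtain F where F: "finite F" "V w F \<subseteq> A"
      using V_inside[OF CoA w(1,2)] by auto
    obtain n where "n \<notin> fst ` F"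
      using ex_new_if_finite[OF infinite_UNIV_nat finite_imageI[OF F(1)]] by auto
    then have n: "(n, q) \<notin> F" by force
    define B where "B = V ((n, q) # w) {}"
    have adm: "adm ((n, q) # w)"
      using adm_Cons[OF adm_not_Nil[OF w(1)]] w(1,3) less by simp
    have "B \<subseteq> V w F"
    proof
      fix y assume "y \<in> B"
      then have y: "branch y" "y ((n, q) # w)" by (auto simp: B_def V_def)
      have "suffix w ((n, q) # w)"
        by (simp add: suffix_Cons)
      then have "y w"
        using branch_suffix[OF y _ adm_not_Nil[OF w(1)]] by simp
      moreover have "\<not> y (d # w)" if "d \<in> F" for d
        using branch_child_unique[OF y, of d] n that by auto
      ultimately show "y \<in> V w F"
        using y(1) by (auto simp: V_def)
    qed
    then have BA: "B \<subseteq> A" using F(2) by auto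
    have trimB: "trim B q"
      using trim_V[OF adm, of "{}"] by (simp add: B_def lab_def)
    have "pt w \<notin> B"
      using not_pt_child by (auto simp: B_def V_def)
    moreover have "A - B \<in> Co W"
      using CoA V_Co[of "{}" "(n, q) # w"] by (simp add: B_def)
    ultimately have "trim (A - B) p"
      unfolding trim_def using w by blast
    then show ?thesis using BA trimB by blast
  qed
  show "\<exists>A. trim A p" if p: "p \<in> points P" for p
  proof -
    obtain r where r: "r \<in> root" "po_le P (snd r) p"
      using root_below[OF p] by auto
    show ?thesis
    proof (cases "snd r = p")
      case True
      then show ?thesis
        using trim_V[of "[r]" "{}"] r(1) by (auto simp: lab_def)
    next
      case False
      then have "adm [(0, p), r]"
        using r by (simp add: po_le_def)
      then show ?thesis
        using trim_V[of "[(0, p), r]" "{}"] by (auto simp: lab_def)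
    qed
  qed
qed

sublocale labelled_full W P trim
  by (rule labelled_full_W)

subsection \<open>Trees\<close>

definition tree :: "nat \<times> 'q \<Rightarrow> ('q word \<Rightarrow> bool) set" where
  "tree r = V [r] {}"

lemma tree_Co: "tree r \<in> Co W"
  by (simp add: tree_def V_Co)

lemma trim_tree: "r \<in> root \<Longrightarrow> trim (tree r) (snd r)"
  using trim_V[of "[r]" "{}"] by (simp add: tree_def lab_def)

lemma trees_disjoint: "r \<noteq> s \<Longrightarrow> tree r \<inter> tree s = {}"
  using branch_length_eq[of _ "[r]" "[s]"] by (auto simp: tree_def V_def)

text \<open>
  The finite branch that gives a set its label runs through a root, and labels increase along it.
\<close>

lemma trim_meets_tree:
  assumes "trim A p"
  shows "\<exists>r\<in>root. snd r \<preceq>\<^sub>P p \<and> A \<inter> tree r \<noteq> {}"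
proof -
  obtain w where w: "adm w" "pt w \<in> A" "lab w = p"
    using assms unfolding trim_def by metis
  have suf: "suffix [last w] w"
    using adm_not_Nil[OF w(1)] by (metis append_butlast_last_id suffix_def)
  then have "pt w \<in> tree (last w)"
    using branch_pt[OF w(1)] by (simp add: tree_def V_def pt_def)
  moreover have "snd (last w) \<preceq>\<^sub>P p"
  proof (cases "w = [last w]")
    case True
    then have "lab w = snd (last w)"
      by (metis lab_def list.sel(1))
    then show ?thesis using w(3) leq_refl by simp
  next
    case False
    then show ?thesis
      using lab_suffix[OF w(1) suf] w(3) by (auto simp: po_le_def lab_def)
  qed
  ultimately show ?thesis
    using adm_last[OF w(1)] w(2) by blast
qed

lemma Co_finite_trees:
  assumes "K \<in> Co W"
  shows "\<exists>R. finite R \<and> (\<forall>r. r \<notin> R \<longrightarrow> tree r \<inter> K = {})"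
proof -
  obtain G where G: "G \<subseteq> basics" "finite G" "\<Union>G = K"
    using Co_basics[OF assms] by auto
  have "\<exists>r. X \<subseteq> tree r" if X: "X \<in> G" for X
  proof -
    obtain w F where w: "X = V w F" "adm w"
      using G(1) X by (auto simp: basics_def)
    have "suffix [last w] w"
      using adm_not_Nil[OF w(2)] by (metis append_butlast_last_id suffix_def)
    then have "X \<subseteq> tree (last w)"
      using branch_suffix unfolding w(1) tree_def V_def by blast
    then show ?thesis by blast
  qed
  then obtain r where r: "X \<subseteq> tree (r X)" if "X \<in> G" for X by metis
  have "tree s \<inter> K = {}" if s: "s \<notin> r ` G" for s
  proof -
    have "tree s \<inter> X = {}" if "X \<in> G" for X
      using trees_disjoint[of s "r X"] r[OF that] s that by auto
    then show ?thesis using G(3) by auto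
  qed
  then show ?thesis
    using G(2) by (intro exI[of _ "r ` G"]) auto
qed

end

section \<open>Realising extended PO systems\<close>

lemma down_set_lower: "lower_subset P L \<Longrightarrow> S \<subseteq> L \<Longrightarrow> down_set P S \<subseteq> L"
  unfolding lower_subset_def down_set_def by blast

text \<open>
  A finite foundation of \<open>L\<close> restricts to one of each \<open>{p}\<close>, by keeping
  the elements below \<open>p\<close>.
\<close>

lemma Delta_of_foundation:
  assumes P: "po_system P" and L: "lower_subset P L" and F: "has_finite_foundation P L"
  shows "L \<subseteq> Delta_points P"
proof
  fix p assume p: "p \<in> L"
  have trans: "po_le P a c" if "po_le P a b" "po_le P b c" for a b c
    using that P unfolding po_system_def po_le_def trans_def by blast
  obtain F where F: "finite F" "F \<subseteq> down_set P L" "down_set P L \<subseteq> up_set P F"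
    using assms(3) by (auto simp: has_finite_foundation_def finite_foundation_def)
  have "down_set P {p} \<subseteq> up_set P {r \<in> F. r \<in> down_set P {p}}"
  proof
    fix q assume q: "q \<in> down_set P {p}"
    then have "q \<in> down_set P L"
      using p by (auto simp: down_set_def)
    then obtain r where r: "r \<in> F" "po_le P r q"
      using F(3) by (auto simp: up_set_def)
    then have "r \<in> down_set P {p}"
      using trans[OF r(2)] q F(2) by (auto simp: down_set_def)
    then show "q \<in> up_set P {r \<in> F. r \<in> down_set P {p}}"
      using r q by (auto simp: up_set_def down_set_def)
  qed
  then have "finite_foundation P {r \<in> F. r \<in> down_set P {p}} {p}"
    using F(1) by (auto simp: finite_foundation_def)
  moreover have "p \<in> points P"
    using p L by (auto simp: lower_subset_def)
  ultimately show "p \<in> Delta_points P"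
    by (auto simp: Delta_points_def has_finite_foundation_def)
qed

locale weighted_po =
  fixes P :: "'q po_system" and L :: "'q set" and f :: "'q \<Rightarrow> nat"
  assumes extended_P: "extended_po_system P L f" and countable_P: "countable (points P)"
begin

definition weight :: "'q \<Rightarrow> nat" where
  "weight p = (if p \<in> irrefl_points P then f p else 1)"

text \<open>
  A label outside \<open>L\<close> has to occur outside every compact set and gets infinitely many
  roots. Within \<open>L\<close> only the minimal labels get roots: finitely many, namely \<open>f
  p\<close> many for an irreflexive \<open>p\<close>, which are its only occurrences, and one for a
  reflexive \<open>p\<close>, which then occurs infinitely often by itself.
\<close>

definition roots :: "(nat \<times> 'q) set" where
  "roots = {(n, p). p \<in> points P \<and> (p \<in> L \<longrightarrow> p \<in> minimal_points P L \<and> n < weight p)}"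

lemma po_P: "po_system P" and lower_L: "lower_subset P L" and Delta_L: "L \<subseteq> Delta_points P"
    and pos_f: "pos_weight P L f"
  using extended_P by (auto simp: extended_po_system_def)

lemma L_points: "L \<subseteq> points P"
  using lower_L by (simp add: lower_subset_def)

lemma le_trans: "po_le P a b \<Longrightarrow> po_le P b c \<Longrightarrow> po_le P a c"
  using po_P unfolding po_system_def po_le_def trans_def by blast

lemma le_antisym: "po_le P a b \<Longrightarrow> po_le P b a \<Longrightarrow> a = b"
  using po_P unfolding po_system_def po_le_def antisym_def by blast

lemma L_lower: "p \<in> L \<Longrightarrow> q \<in> points P \<Longrightarrow> po_le P q p \<Longrightarrow> q \<in> L"
  using lower_L unfolding lower_subset_def down_set_def by blast

text \<open>
  This bounds the number of roots below a set that has a finite foundation.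
\<close>

lemma minimal_in_foundation:
  assumes S: "S \<subseteq> L" and F: "finite_foundation P F S"
    and m: "m \<in> minimal_points P L" "m \<in> down_set P S"
  shows "m \<in> F"
proof -
  obtain r where r: "r \<in> F" "po_le P r m"
    using F m(2) by (auto simp: finite_foundation_def up_set_def)
  moreover have "r \<in> L"
    using r(1) F down_set_lower[OF lower_L S] by (auto simp: finite_foundation_def)
  ultimately show ?thesis
    using m(1) by (auto simp: minimal_points_def)
qed

lemma finite_roots_below:
  assumes S: "S \<subseteq> L" and "has_finite_foundation P S"
  shows "finite {r \<in> roots. snd r \<in> down_set P S}"
proof -
  obtain F where F: "finite_foundation P F S"
    using assms(2) by (auto simp: has_finite_foundation_def)
  have "{r \<in> roots. snd r \<in> down_set P S} \<subseteq> (\<Union>m\<in>F. {..<weight m} \<times> {m})"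
  proof
    fix r assume r: "r \<in> {r \<in> roots. snd r \<in> down_set P S}"
    then have "snd r \<in> L"
      using down_set_lower[OF lower_L S] by auto
    then have "snd r \<in> minimal_points P L" "fst r < weight (snd r)"
      using r by (auto simp: roots_def)
    then show "r \<in> (\<Union>m\<in>F. {..<weight m} \<times> {m})"
      using minimal_in_foundation[OF S F] r by (auto simp: mem_Times_iff intro!: bexI[of _ "snd r"])
  qed
  then show ?thesis
    by (rule finite_subset) (use F in \<open>auto simp: finite_foundation_def\<close>)
qed

text \<open>
  A minimal element of a finite foundation of \<open>{p}\<close> is minimal in \<open>L\<close>,
  because everything below it lies above an element of the foundation.
\<close>

lemma minimal_below:
  assumes p: "p \<in> L"
  shows "\<exists>m\<in>minimal_points P L. po_le P m p"
proof -
  obtain F where F: "finite F" "F \<subseteq> down_set P {p}" "down_set P {p} \<subseteq> up_set P F"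
    using Delta_L p by (auto simp: Delta_points_def has_finite_foundation_def finite_foundation_def)
  have "p \<in> down_set P {p}"
    using p L_points by (auto simp: down_set_def po_le_def)
  then have "F \<noteq> {}"
    using F(3) by (auto simp: up_set_def)
  have "\<exists>m\<in>G. \<forall>x\<in>G. po_le P x m \<longrightarrow> x = m" if "finite G" "G \<noteq> {}" for G
    using that
  proof (induction rule: finite_ne_induct)
    case (insert a G)
    then obtain m where m: "m \<in> G" "\<forall>x\<in>G. po_le P x m \<longrightarrow> x = m" by auto
    show ?case
    proof (cases "po_le P a m")
      case True
      have "x = a" if "x \<in> insert a G" "po_le P x a" for x
      proof (cases "x = a")
        case False
        then have "x = m"
          using that m(2) le_trans[OF that(2) True] by auto
        then show ?thesis
          using le_antisym[OF that(2)] True by simp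
      qed
      then show ?thesis by blast
    qed (use m in auto)
  qed auto
  then obtain m where m: "m \<in> F" "\<forall>x\<in>F. po_le P x m \<longrightarrow> x = m"
    using F(1) \<open>F \<noteq> {}\<close> by metis
  have mp: "m \<in> points P" "po_le P m p"
    using F(2) m(1) by (auto simp: down_set_def)
  have "q = m" if q: "q \<in> L" "po_le P q m" for q
  proof -
    have "q \<in> down_set P {p}"
      using q L_points le_trans[OF q(2) mp(2)] by (auto simp: down_set_def)
    then obtain r where r: "r \<in> F" "po_le P r q"
      using F(3) by (auto simp: up_set_def)
    then have "r = m"
      using m(2) le_trans[OF r(2) q(2)] by simp
    then show ?thesis
      using le_antisym[OF q(2)] r(2) by simp
  qed
  then have "m \<in> minimal_points P L"
    using L_lower[OF p mp] by (auto simp: minimal_points_def)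
  then show ?thesis using mp(2) by blast
qed

lemma weight_pos: "m \<in> minimal_points P L \<Longrightarrow> 0 < weight m"
  using pos_f by (auto simp: weight_def pos_weight_def minimal_irrefl_points_def)

sublocale forest P roots
proof
  show "po_system P" by (rule po_P)
  show "countable (points P)" by (rule countable_P)
  show "roots \<subseteq> UNIV \<times> points P" by (auto simp: roots_def)
  show "\<exists>r\<in>roots. po_le P (snd r) p" if p: "p \<in> points P" for p
  proof (cases "p \<in> L")
    case True
    obtain m where m: "m \<in> minimal_points P L" "po_le P m p"
      using minimal_below[OF True] by auto
    then have "(0, m) \<in> roots"
      using L_points weight_pos[OF m(1)] by (auto simp: roots_def minimal_points_def)
    then show ?thesis
      using m(2) by force
  next
    case False
    then have "(0, p) \<in> roots" using p by (simp add: roots_def)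
    then show ?thesis by (force simp: po_le_def)
  qed
qed

lemma core_exists:
  assumes S: "S \<subseteq> L" "has_finite_foundation P S"
  shows "\<exists>K\<in>Co W. \<forall>p\<in>S. \<forall>A. trim A p \<longrightarrow> A \<inter> K \<noteq> {}"
proof -
  define K where "K = \<Union>(tree ` {r \<in> roots. snd r \<in> down_set P S})"
  have "K \<in> Co W"
    unfolding K_def using finite_roots_below[OF S] tree_Co by (intro Co_Union) auto
  moreover have "A \<inter> K \<noteq> {}" if p: "p \<in> S" and A: "trim A p" for p A
  proof -
    obtain r where r: "r \<in> roots" "snd r \<preceq>\<^sub>P p" "A \<inter> tree r \<noteq> {}"
      using trim_meets_tree[OF A] by auto
    have "snd r \<in> down_set P S"
      using r(1,2) p by (auto simp: down_set_def roots_def)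
    then have "tree r \<subseteq> K"
      using r(1) by (auto simp: K_def)
    then show ?thesis using r(3) by auto
  qed
  ultimately show ?thesis by blast
qed

lemma compact_labels_W: "compact_labels = L"
proof (intro equalityI subsetI)
  fix p assume p: "p \<in> L"
  then have "has_finite_foundation P {p}"
    using Delta_L by (auto simp: Delta_points_def)
  then obtain K where "K \<in> Co W" "\<forall>A. trim A p \<longrightarrow> A \<inter> K \<noteq> {}"
    using core_exists[of "{p}"] p by auto
  then show "p \<in> compact_labels"
    using p L_points by (auto simp: compact_labels_iff)
next
  fix p assume p: "p \<in> compact_labels"
  then obtain K where K: "K \<in> Co W" "\<forall>A. trim A p \<longrightarrow> A \<inter> K \<noteq> {}" and pP: "p \<in> points P"
    by (auto simp: compact_labels_iff)
  show "p \<in> L"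
  proof (rule ccontr)
    assume "p \<notin> L"
    then have root: "(n, p) \<in> roots" for n
      using pP by (simp add: roots_def)
    obtain R where R: "finite R" "\<forall>r. r \<notin> R \<longrightarrow> tree r \<inter> K = {}"
      using Co_finite_trees[OF K(1)] by auto
    obtain n where "n \<notin> fst ` R"
      using ex_new_if_finite[OF infinite_UNIV_nat finite_imageI[OF R(1)]] by auto
    then have "(n, p) \<notin> R" by force
    then have "tree (n, p) \<inter> K = {}"
      using R(2) by blast
    moreover have "tree (n, p) \<inter> K \<noteq> {}"
      using K(2) trim_tree[OF root[of n]] by simp
    ultimately show False by simp
  qed
qed

lemma bounded_W: "has_finite_foundation P L \<Longrightarrow> bounded_labels"
  using core_exists[of L] by (simp add: bounded_labels_def compact_labels_W)

lemma label_count_W: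
  assumes p: "p \<in> minimal_irrefl_points P L"
  shows "label_count p = f p"
proof -
  have pL: "p \<in> L" "p \<in> minimal_points P L" "p \<in> irrefl_points P"
    using p by (auto simp: minimal_irrefl_points_def minimal_points_def)
  have root: "(n, p) \<in> roots" if "n < f p" for n
    using that pL L_points by (auto simp: roots_def weight_def)
  have dec: "decomp trim (\<Union>n<k. tree (n, p)) (replicate_mset k p)" if "k \<le> f p" for k
    using that
  proof (induction k)
    case 0
    show ?case using decomp_empty[of trim] by simp
  next
    case (Suc k)
    have "trim (tree (k, p)) p"
      using trim_tree[OF root[of k]] Suc(2) by simp
    moreover have "tree (k, p) \<inter> (\<Union>n<k. tree (n, p)) = {}"
      using trees_disjoint[of "(k, p)"] by fastforce
    ultimately have "decomp trim (tree (k, p) \<union> (\<Union>n<k. tree (n, p))) (add_mset p (replicate_mset k p))"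
      using Suc by (intro decomp_insert) auto
    then show ?case
      by (simp add: lessThan_Suc)
  qed
  have "A \<inter> (\<Union>n<f p. tree (n, p)) \<noteq> {}" if A: "trim A p" for A
  proof -
    obtain r where r: "r \<in> roots" "snd r \<preceq>\<^sub>P p" "A \<inter> tree r \<noteq> {}"
      using trim_meets_tree[OF A] by auto
    have "snd r \<in> L"
      using L_lower[OF pL(1) _ r(2)] r(1) by (auto simp: roots_def)
    then have "snd r = p"
      using pL(2) r(2) by (auto simp: minimal_points_def)
    then obtain n where "r = (n, p)" "n < f p"
      using r(1) pL by (cases r) (auto simp: roots_def weight_def)
    then show ?thesis using r(3) by blast
  qed
  then show ?thesis
    using label_count_eq(1)[OF dec[OF order_refl], of p] pL(3) by (auto simp: irrefl_points_def)
qed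

text \<open>
  A branch is a subset of a countable set of words.
\<close>

lemma topspace_lepoll: "topspace W \<lesssim> (UNIV :: nat set set)"
proof -
  let ?D = "lists letters"
  have ctb: "countable ?D"
    using countable_P by (simp add: letters_def countable_lists)
  have sub: "Collect x \<subseteq> ?D" if x: "x \<in> topspace W" for x
  proof
    fix w assume "w \<in> Collect x"
    then have "adm w"
      using x branchD[of x w] by (simp add: topspace_W)
    then show "w \<in> ?D"
      using adm_letters by (simp add: letters_def)
  qed
  have "inj_on (\<lambda>x. to_nat_on ?D ` Collect x) (topspace W)"
  proof (rule inj_onI)
    fix x y assume xy: "x \<in> topspace W" "y \<in> topspace W"
      and "to_nat_on ?D ` Collect x = to_nat_on ?D ` Collect y"
    then have "Collect x = Collect y"
      using inj_on_image_eq_iff[OF inj_on_to_nat_on[OF ctb] sub[OF xy(1)] sub[OF xy(2)]] by simp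
    then show "x = y" by (simp add: Collect_inj)
  qed
  then show ?thesis
    unfolding lepoll_def by blast
qed

end

lemma homeomorphic_copy_exists:
  fixes W :: "'b topology"
  assumes "topspace W \<lesssim> (UNIV :: 'a set)"
  shows "\<exists>(W' :: 'a topology) h. homeomorphic_map W W' h"
proof -
  obtain h :: "'b \<Rightarrow> 'a" where h: "inj_on h (topspace W)"
    using assms by (auto simp: lepoll_def)
  define g where "g = inv_into (topspace W) h"
  define W' where "W' = pullback_topology (h ` topspace W) g W"
  have g: "g (h x) = x" if "x \<in> topspace W" for x
    using h that by (simp add: g_def)
  have pre: "g -` U \<inter> h ` topspace W = h ` U" if "openin W U" for U
    using openin_subset[OF that] g by force
  have op: "openin W' S \<longleftrightarrow> (\<exists>U. openin W U \<and> S = h ` U)" for S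
    unfolding W'_def openin_pullback_topology using pre by metis
  have "topspace W' = h ` topspace W"
    using g by (auto simp: W'_def topspace_pullback_topology)
  moreover have "open_map W W' h"
    using op by (auto simp: open_map_def)
  moreover have "openin W {x \<in> topspace W. h x \<in> S}" if S: "openin W' S" for S
  proof -
    obtain U where U: "openin W U" "S = h ` U"
      using S op by auto
    have "{x \<in> topspace W. h x \<in> S} = U"
      using inj_on_image_mem_iff[OF h _ openin_subset[OF U(1)]] openin_subset[OF U(1)] U(2) by auto
    then show ?thesis using U(1) by simp
  qed
  ultimately have "homeomorphic_map W W' h"
    using h by (intro bijective_open_imp_homeomorphic_map) (auto simp: continuous_map)
  then show ?thesis by blast
qed

theorem realisation:
  fixes P :: "'q po_system"
  assumes ext: "extended_po_system P L f" and ctb: "countable (points P)"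
    and card: "(UNIV :: real set) \<lesssim> (UNIV :: 'a set)"
  shows "\<exists>(W :: 'a topology) trim. labelled_full W P trim \<and>
    labelled.compact_labels W P trim = L \<and>
    (\<forall>p\<in>minimal_irrefl_points P L. labelled.label_count W trim p = f p) \<and>
    (has_finite_foundation P L \<longrightarrow> labelled.bounded_labels W P trim)"
proof -
  interpret wp: weighted_po P L f
    using ext ctb by unfold_locales
  have "topspace wp.W \<lesssim> (UNIV :: 'a set)"
    using lepoll_trans[OF wp.topspace_lepoll lepoll_trans[OF eqpoll_imp_lepoll[OF nat_sets_eqpoll_reals] card]] .
  then obtain W' :: "'a topology" and h where h: "homeomorphic_map wp.W W' h"
    using homeomorphic_copy_exists by blast
  interpret labelled_copy wp.W P wp.trim W' "(`) h"
    using wp.homeomorphic_copy[OF h] wp.labelled_full_W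
    by (simp add: labelled_copy_def labelled_copy_axioms_def)
  have "copied.compact_labels = L"
    using compact_labels_copy wp.compact_labels_W by simp
  moreover have "copied.label_count p = f p" if "p \<in> minimal_irrefl_points P L" for p
    using label_count_copy[of p] wp.label_count_W[OF that] wp.compact_labels_W that by simp
  moreover have "has_finite_foundation P L \<longrightarrow> copied.bounded_labels"
    using bounded_labels_copy wp.bounded_W by blast
  ultimately show ?thesis
    using labelled_full_copy by blast
qed


section \<open>The classification\<close>

context labelled_full
begin

lemma countable_labels: "countable (points P)"
proof -
  have "points P \<subseteq> (\<lambda>A. THE p. trim A p) ` Co W"
  proof
    fix p assume "p \<in> points P"
    then obtain A where A: "trim A p"
      using label_occurs by auto
    then have "(THE p. trim A p) = p"
      using trim_unique by blast
    then show "p \<in> (\<lambda>A. THE p. trim A p) ` Co W"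
      using trim_Co[OF A] by (metis imageI)
  qed
  then show ?thesis
    using countable_Co by (meson countable_image countable_subset)
qed

lemma omega_Stone: "omega_Stone_space W"
  using Stone countable_Co by (simp add: omega_Stone_space_def)

end

locale labelled_iso = labelled_full W P trim for W :: "'a topology" and P :: "'p po_system" and trim +
  fixes Q :: "'q po_system" and \<beta> :: "'p \<Rightarrow> 'q"
  assumes Q: "po_system Q" and iso: "po_isomorphism \<beta> P Q"
begin

definition iso_trim :: "'a set \<Rightarrow> 'q \<Rightarrow> bool" where
  "iso_trim = (\<lambda>A q. \<exists>p. trim A p \<and> q = \<beta> p)"

lemma iso_trim_iff: "p \<in> points P \<Longrightarrow> iso_trim A (\<beta> p) \<longleftrightarrow> trim A p"
  using iso trim_point unfolding iso_trim_def po_isomorphism_def bij_betw_def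
  by (metis inj_onD)

lemma \<beta>_points: "\<beta> ` points P = points Q"
  using iso by (simp add: po_isomorphism_def bij_betw_def)

lemma labelled_full_iso: "labelled_full W Q iso_trim"
proof -
  interpret relabelled: labelled W Q iso_trim
    unfolding iso_trim_def
    by (rule labelled_image[OF Q po_isomorphism_morphism[OF iso]])
  have "\<exists>A. iso_trim A q" if q: "q \<in> points Q" for q
  proof -
    obtain p where "p \<in> points P" "q = \<beta> p"
      using q \<beta>_points by auto
    then show ?thesis
      using label_occurs[of p] iso_trim_iff by auto
  qed
  then show ?thesis
    by unfold_locales
qed

sublocale relabelled: labelled_full W Q iso_trim
  by (rule labelled_full_iso)

lemma compact_labels_iso: "relabelled.compact_labels = \<beta> ` compact_labels"
proof -
  have "\<beta> p \<in> relabelled.compact_labels \<longleftrightarrow> p \<in> compact_labels" if "p \<in> points P" for p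
    using that \<beta>_points iso_trim_iff[OF that] relabelled.compact_labels_iff compact_labels_iff by auto
  moreover have "relabelled.compact_labels \<subseteq> \<beta> ` points P" "compact_labels \<subseteq> points P"
    using \<beta>_points relabelled.compact_labels_iff compact_labels_iff by auto
  ultimately show ?thesis by blast
qed

lemma label_count_iso: "p \<in> points P \<Longrightarrow> relabelled.label_count (\<beta> p) = label_count p"
  by (simp add: relabelled.label_count_def label_count_def relabelled.label_points_def
      label_points_def iso_trim_iff)

end

lemma labelled_simple_exists:
  assumes W: "omega_Stone_space W" "primitive_space W" and inf: "infinite (UNIV :: 'q set)"
  shows "\<exists>(Q :: 'q po_system) trim. labelled_simple W Q trim"
proof -
  obtain c :: "'a set \<Rightarrow> 'q" where "coded_primitive W c"
    using coded_primitive_exists[OF W inf] by auto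
  then interpret coded_primitive W c .
  have "labelled_simple W split_po split_trim"
    using labelled_full_split simple_split_po by (simp add: labelled_simple_def labelled_simple_axioms_def)
  then show ?thesis by blast
qed

text \<open>
  A labelling of \<open>W\<close> is transported to \<open>W'\<close>, and both spaces have the
  invariants of the common labelling.
\<close>

lemma theta_homeomorphic:
  assumes W: "omega_Stone_space W" "primitive_space W" and inf: "infinite (UNIV :: 'q set)"
    and homeo: "W homeomorphic_space W'"
  shows "(theta W' :: 'q ext_po set) = theta W"
proof -
  obtain Q :: "'q po_system" and trim where "labelled_simple W Q trim"
    using labelled_simple_exists[OF W inf] by auto
  then interpret labelled_simple W Q trim .
  obtain h where h: "homeomorphic_map W W' h"
    using homeo by (auto simp: homeomorphic_space)
  interpret labelled_copy W Q trim W' "(`) h"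
    using homeomorphic_copy[OF h] labelled_full_axioms
    by (simp add: labelled_copy_def labelled_copy_axioms_def)
  interpret copy: labelled_simple W' Q copy_trim
    using simple by unfold_locales
  have "compact_labels \<subseteq> points Q"
    using compact_labels_iff by auto
  then show ?thesis
    unfolding theta_eq copy.theta_eq compact_labels_copy
    using label_count_copy by (intro ext_class_eq ext_iso_refl) auto
qed

text \<open>
  Equal classes yield an isomorphism between the extended PO systems of the two spaces. Relabelling
  along it gives two labellings by the same PO system, with the same compact labels and counts.
\<close>

lemma theta_bounded_inj:
  fixes W :: "'a topology" and W' :: "'b topology"
  assumes W: "omega_Stone_space W" "bounded_space W" and W': "omega_Stone_space W'" "bounded_space W'"
    and inf: "infinite (UNIV :: 'q set)" and eq: "(theta W :: 'q ext_po set) = theta W'"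
  shows "W homeomorphic_space W'"
proof -
  have prim: "primitive_space W" "primitive_space W'"
    using W(2) W'(2) by (simp_all add: bounded_space_def)
  obtain Q :: "'q po_system" and trim where "labelled_simple W Q trim"
    using labelled_simple_exists[OF W(1) prim(1) inf] by auto
  then interpret L: labelled_simple W Q trim .
  obtain Q' :: "'q po_system" and trim' where "labelled_simple W' Q' trim'"
    using labelled_simple_exists[OF W'(1) prim(2) inf] by auto
  then interpret R: labelled_simple W' Q' trim' .
  have "(Q, L.compact_labels, L.label_count) \<in> (theta W :: 'q ext_po set)"
    using L.extended ext_iso_refl[of Q L.compact_labels L.label_count L.label_count]
    by (simp add: L.theta_eq ext_class_def)
  then have "(Q, L.compact_labels, L.label_count) \<in> ext_class Q' R.compact_labels R.label_count"
    unfolding eq R.theta_eq .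
  then obtain \<beta> where \<beta>: "po_isomorphism \<beta> Q' Q" "\<beta> ` R.compact_labels = L.compact_labels"
      "\<forall>p\<in>minimal_irrefl_points Q' R.compact_labels. L.label_count (\<beta> p) = R.label_count p"
    by (auto simp: ext_class_def ext_iso_def)
  interpret labelled_iso W' Q' trim' Q \<beta>
    using \<beta>(1) L.po by unfold_locales
  interpret I: labelled_simple W' Q iso_trim
    using L.simple by unfold_locales
  interpret labelled_full_pair W W' Q trim iso_trim
    by unfold_locales
  have sub: "R.compact_labels \<subseteq> points Q'"
    using R.compact_labels_iff by auto
  show ?thesis
  proof (rule bounded_homeomorphic)
    show "L.bounded_labels" "relabelled.bounded_labels"
      using L.bounded_space_iff I.bounded_space_iff W(2) W'(2) by auto
    show L: "relabelled.compact_labels = L.compact_labels"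
      using compact_labels_iso \<beta>(2) by simp
    fix p assume "p \<in> minimal_irrefl_points Q L.compact_labels"
    then obtain q where q: "q \<in> minimal_irrefl_points Q' R.compact_labels" "p = \<beta> q"
      using po_isomorphism_minimal_irrefl[OF \<beta>(1) sub] \<beta>(2) by auto
    moreover have "q \<in> points Q'"
      using q(1) sub by (auto simp: minimal_irrefl_points_def minimal_points_def)
    ultimately show "relabelled.label_count p = L.label_count p"
      using label_count_iso \<beta>(3) by simp
  qed
qed

lemma theta_realised:
  fixes P :: "'q po_system"
  assumes ext: "extended_po_system P L f" and ctb: "countable (points P)" and simple: "simple_po P"
    and card: "(UNIV :: real set) \<lesssim> (UNIV :: 'a set)"
  shows "\<exists>(W :: 'a topology). omega_Stone_space W \<and> primitive_space W \<and>
    (theta W :: 'r ext_po set) = ext_class P L f \<and>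
    (has_finite_foundation P L \<longrightarrow> bounded_space W) \<and>
    (has_finite_foundation P L \<longrightarrow> L = points P \<longrightarrow> compact_space W) \<and>
    (finite (points P) \<longrightarrow> finitary_space W)"
proof -
  obtain W :: "'a topology" and trim where W: "labelled_full W P trim"
      "labelled.compact_labels W P trim = L"
      "\<forall>p\<in>minimal_irrefl_points P L. labelled.label_count W trim p = f p"
      "has_finite_foundation P L \<longrightarrow> labelled.bounded_labels W P trim"
    using realisation[OF ext ctb card] by blast
  interpret labelled_full W P trim by (rule W(1))
  interpret labelled_simple W P trim
    using simple by unfold_locales
  have "L \<subseteq> points P"
    using W(2) compact_labels_iff by auto
  then have "ext_class P L label_count = (ext_class P L f :: 'r ext_po set)"
    using W(3) by (intro ext_class_eq ext_iso_refl) auto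
  then have "(theta W :: 'r ext_po set) = ext_class P L f"
    using W(2) by (simp add: theta_eq)
  then show ?thesis
    using omega_Stone primitive bounded_space_iff finitary_space_iff W(2,4) compact_of_bounded by blast
qed

lemma bij_betw_theta_induced:
  fixes \<Phi> :: "'a topology \<Rightarrow> bool" and E :: "'q ext_po set set"
  assumes inf: "infinite (UNIV :: 'q set)"
    and \<Phi>: "\<And>W. \<Phi> W \<Longrightarrow> omega_Stone_space W \<and> primitive_space W"
    and image: "theta ` {W. \<Phi> W} = E"
    and inj: "\<And>W W'. \<Phi> W \<Longrightarrow> \<Phi> W' \<Longrightarrow> (theta W :: 'q ext_po set) = theta W' \<Longrightarrow> W homeomorphic_space W'"
  shows "bij_betw theta_induced ({W. \<Phi> W} // homeo_rel) E"
proof -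
  have ind: "theta_induced (homeo_rel `` {W}) = (theta W :: 'q ext_po set)" if W: "\<Phi> W" for W
  proof -
    have "W \<in> homeo_rel `` {W}"
      by (simp add: homeo_rel_def homeomorphic_space_refl)
    moreover have "(theta W' :: 'q ext_po set) = theta W" if "W' \<in> homeo_rel `` {W}" for W'
      using theta_homeomorphic[OF _ _ inf] \<Phi>[OF W] that by (auto simp: homeo_rel_def)
    ultimately have "(theta :: _ \<Rightarrow> 'q ext_po set) ` (homeo_rel `` {W}) = {theta W}"
      by blast
    then show ?thesis
      by (simp add: theta_induced_def)
  qed
  have "inj_on (theta_induced :: _ \<Rightarrow> 'q ext_po set) ({W. \<Phi> W} // homeo_rel)"
  proof (rule inj_onI)
    fix X Y assume "X \<in> {W. \<Phi> W} // homeo_rel" "Y \<in> {W. \<Phi> W} // homeo_rel"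
      and eq: "(theta_induced X :: 'q ext_po set) = theta_induced Y"
    then obtain W W' where W: "\<Phi> W" "X = homeo_rel `` {W}" "\<Phi> W'" "Y = homeo_rel `` {W'}"
      by (auto simp: quotient_def)
    then have "W homeomorphic_space W'"
      using eq ind inj by auto
    then have "W homeomorphic_space Z \<longleftrightarrow> W' homeomorphic_space Z" for Z :: "'a topology"
      using homeomorphic_space_trans homeomorphic_space_sym by metis
    then show "X = Y"
      unfolding W by (simp add: homeo_rel_def Image_singleton)
  qed
  moreover have "theta_induced ` ({W. \<Phi> W} // homeo_rel) = E"
    using ind unfolding image[symmetric] quotient_def by auto
  ultimately show ?thesis
    by (simp add: bij_betw_def)
qed

theorem theorem3p31:
  assumes "(UNIV :: real set) \<lesssim> (UNIV :: 'a set)"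
    and "infinite (UNIV :: 'q set)"
  shows
    "(theta :: 'a topology \<Rightarrow> 'q ext_po set) ` {W. omega_Stone_space W \<and> primitive_space W} = EPS
     \<and> (\<forall>(W :: 'a topology) (W' :: 'a topology).
          omega_Stone_space W \<and> primitive_space W \<and> omega_Stone_space W' \<and> primitive_space W' \<and>
          W homeomorphic_space W' \<longrightarrow> (theta W :: 'q ext_po set) = theta W')
     \<and> bij_betw (theta_induced :: 'a topology set \<Rightarrow> 'q ext_po set)
         ({W. omega_Stone_space W \<and> primitive_space W \<and> compact_space W} // homeo_rel)
         EPS_founded
     \<and> bij_betw (theta_induced :: 'a topology set \<Rightarrow> 'q ext_po set)
         ({W. omega_Stone_space W \<and> finitary_space W} // homeo_rel)
         EPS_finite
     \<and> bij_betw (theta_induced :: 'a topology set \<Rightarrow> 'q ext_po set)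
         ({W. omega_Stone_space W \<and> bounded_space W} // homeo_rel)
         EPS_lower_founded"
proof -
  let ?theta = "theta :: 'a topology \<Rightarrow> 'q ext_po set"
  have inEPS: "\<exists>(P :: 'q po_system) L f. ?theta W = ext_class P L f \<and> extended_po_system P L f \<and>
      countable (points P) \<and> simple_po P \<and> (bounded_space W \<longrightarrow> has_finite_foundation P L) \<and>
      (compact_space W \<longrightarrow> L = points P \<and> bounded_space W) \<and>
      (finitary_space W \<longrightarrow> finite (points P) \<and> bounded_space W)"
    if W: "omega_Stone_space W" "primitive_space W" for W :: "'a topology"
  proof -
    obtain Q :: "'q po_system" and trim where "labelled_simple W Q trim"
      using labelled_simple_exists[OF W assms(2)] by auto
    then interpret labelled_simple W Q trim .
    show ?thesis
      using theta_eq extended countable_labels simple bounded_space_iff finitary_space_iff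
        bounded_labels_foundation compact_labels_of_compact finite_labels_bounded
      by (intro exI[of _ Q] exI[of _ compact_labels] exI[of _ label_count]) auto
  qed
  have EPS: "?theta ` {W. omega_Stone_space W \<and> primitive_space W} = EPS"
  proof (intro equalityI subsetI)
    fix X assume "X \<in> ?theta ` {W. omega_Stone_space W \<and> primitive_space W}"
    then show "X \<in> EPS"
      using inEPS unfolding EPS_def by blast
  next
    fix X :: "'q ext_po set" assume "X \<in> EPS"
    then obtain P :: "'q po_system" and L f where X: "X = ext_class P L f"
        and P: "extended_po_system P L f" "countable (points P)" "simple_po P"
      by (auto simp: EPS_def)
    show "X \<in> ?theta ` {W. omega_Stone_space W \<and> primitive_space W}"
      using theta_realised[OF P assms(1), where 'r = 'q] X by blast
  qed
  have po: "po_system P" if "simple_po P" for P :: "'q po_system"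
    using that by (simp add: simple_po_def)
  have ext: "extended_po_system P L f"
    if "simple_po P" "lower_subset P L" "has_finite_foundation P L" "pos_weight P L f"
    for P :: "'q po_system" and L f
    using that Delta_of_foundation[OF po[OF that(1)] that(2,3)] po[OF that(1)]
    by (simp add: extended_po_system_def)
  have founded: "?theta ` {W. omega_Stone_space W \<and> primitive_space W \<and> compact_space W} = EPS_founded"
  proof (intro equalityI subsetI)
    fix X assume "X \<in> ?theta ` {W. omega_Stone_space W \<and> primitive_space W \<and> compact_space W}"
    then obtain W where W: "omega_Stone_space W" "primitive_space W" "compact_space W" "X = ?theta W"
      by auto
    then obtain P :: "'q po_system" and f where "?theta W = ext_class P (points P) f"
        "extended_po_system P (points P) f" "countable (points P)" "simple_po P"
        "has_finite_foundation P (points P)"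
      using inEPS[OF W(1,2)] by auto
    then show "X \<in> EPS_founded"
      using W(4) unfolding EPS_founded_def extended_po_system_def by blast
  next
    fix X :: "'q ext_po set" assume "X \<in> EPS_founded"
    then obtain P :: "'q po_system" and f where X: "X = ext_class P (points P) f"
        and P: "simple_po P" "countable (points P)" "has_finite_foundation P (points P)"
          "pos_weight P (points P) f"
      by (auto simp: EPS_founded_def)
    have "lower_subset P (points P)"
      by (auto simp: lower_subset_def down_set_def po_le_def)
    then show "X \<in> ?theta ` {W. omega_Stone_space W \<and> primitive_space W \<and> compact_space W}"
      using theta_realised[OF ext[OF P(1) _ P(3,4)] P(2,1) assms(1), where 'r = 'q] X P(3) by blast
  qed
  have finitary: "?theta ` {W. omega_Stone_space W \<and> finitary_space W} = EPS_finite"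
  proof (intro equalityI subsetI)
    fix X assume "X \<in> ?theta ` {W. omega_Stone_space W \<and> finitary_space W}"
    then obtain W where W: "omega_Stone_space W" "finitary_space W" "X = ?theta W"
      by auto
    have "primitive_space W"
      using W(2) by (simp add: finitary_space_def)
    then obtain P :: "'q po_system" and L f where "?theta W = ext_class P L f"
        "extended_po_system P L f" "simple_po P" "finite (points P)"
      using inEPS[OF W(1)] W(2) by auto
    then show "X \<in> EPS_finite"
      using W(3) unfolding EPS_finite_def extended_po_system_def by blast
  next
    fix X :: "'q ext_po set" assume "X \<in> EPS_finite"
    then obtain P :: "'q po_system" and L f where X: "X = ext_class P L f"
        and P: "simple_po P" "finite (points P)" "lower_subset P L" "pos_weight P L f"
      by (auto simp: EPS_finite_def)
    have "finite L" "down_set P L = L"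
      using P(2,3) by (auto simp: lower_subset_def intro: finite_subset)
    then have "finite_foundation P L L"
      using P(3) by (auto simp: finite_foundation_def up_set_def po_le_def lower_subset_def)
    then have "has_finite_foundation P L"
      by (auto simp: has_finite_foundation_def)
    then show "X \<in> ?theta ` {W. omega_Stone_space W \<and> finitary_space W}"
      using theta_realised[OF ext[OF P(1,3) _ P(4)] countable_finite[OF P(2)] P(1) assms(1), where 'r = 'q]
        X P(2) by blast
  qed
  have bounded: "?theta ` {W. omega_Stone_space W \<and> bounded_space W} = EPS_lower_founded"
  proof (intro equalityI subsetI)
    fix X assume "X \<in> ?theta ` {W. omega_Stone_space W \<and> bounded_space W}"
    then obtain W where W: "omega_Stone_space W" "bounded_space W" "X = ?theta W"
      by auto
    have "primitive_space W"
      using W(2) by (simp add: bounded_space_def)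
    then obtain P :: "'q po_system" and L f where "?theta W = ext_class P L f"
        "extended_po_system P L f" "simple_po P" "countable (points P)" "has_finite_foundation P L"
      using inEPS[OF W(1)] W(2) by auto
    then show "X \<in> EPS_lower_founded"
      using W(3) unfolding EPS_lower_founded_def extended_po_system_def by blast
  next
    fix X :: "'q ext_po set" assume "X \<in> EPS_lower_founded"
    then obtain P :: "'q po_system" and L f where X: "X = ext_class P L f"
        and P: "simple_po P" "countable (points P)" "lower_subset P L" "has_finite_foundation P L"
          "pos_weight P L f"
      by (auto simp: EPS_lower_founded_def)
    then show "X \<in> ?theta ` {W. omega_Stone_space W \<and> bounded_space W}"
      using theta_realised[OF ext[OF P(1,3,4,5)] P(2,1) assms(1), where 'r = 'q] by blast
  qed
  have inj: "W homeomorphic_space W'"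
    if "omega_Stone_space W" "bounded_space W" "omega_Stone_space W'" "bounded_space W'" "?theta W = ?theta W'"
    for W W' :: "'a topology"
    using theta_bounded_inj[OF that(1-4) assms(2) that(5)] .
  have compact_bounded: "bounded_space W" if "omega_Stone_space W" "primitive_space W" "compact_space W"
    for W :: "'a topology"
    using inEPS[OF that(1,2)] that(3) by auto
  have finitary_bounded: "bounded_space W" if "omega_Stone_space W" "finitary_space W"
    for W :: "'a topology"
    using inEPS[OF that(1)] that(2) by (auto simp: finitary_space_def)
  show ?thesis
  proof (intro conjI)
    show "?theta ` {W. omega_Stone_space W \<and> primitive_space W} = EPS"
      by (rule EPS)
    show "\<forall>W W' :: 'a topology. omega_Stone_space W \<and> primitive_space W \<and>
        omega_Stone_space W' \<and> primitive_space W' \<and> W homeomorphic_space W' \<longrightarrow> ?theta W = ?theta W'"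
      using theta_homeomorphic[OF _ _ assms(2)] by metis
    show "bij_betw (theta_induced :: 'a topology set \<Rightarrow> 'q ext_po set)
        ({W. omega_Stone_space W \<and> primitive_space W \<and> compact_space W} // homeo_rel) EPS_founded"
      using inj compact_bounded by (intro bij_betw_theta_induced[OF assms(2) _ founded]) auto
    show "bij_betw (theta_induced :: 'a topology set \<Rightarrow> 'q ext_po set)
        ({W. omega_Stone_space W \<and> finitary_space W} // homeo_rel) EPS_finite"
      using inj finitary_bounded
      by (intro bij_betw_theta_induced[OF assms(2) _ finitary]) (auto simp: finitary_space_def)
    show "bij_betw (theta_induced :: 'a topology set \<Rightarrow> 'q ext_po set)
        ({W. omega_Stone_space W \<and> bounded_space W} // homeo_rel) EPS_lower_founded"
      using inj by (intro bij_betw_theta_induced[OF assms(2) _ bounded]) (auto simp: bounded_space_def)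
  qed
qed

end
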